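(* Let $d\ge2$, $M>0$, $a\in\mathbb{R}^d$ with $|a|=1$, and let $(q,r)$ be sharp $\frac{d-1}{2}$-admissible. Then there is a constant $C(M)$ (depending also on $d,q,r$) such that for all $\phi\in L^2(\mathbb{R}^d)$ with $\operatorname{supp}\widehat{\phi}\subset\{\xi\in\mathbb{R}^d:\ |a\cdot\xi|\le M\}$, $$\|e^{it\Delta}\phi\|_{L^q_t(\mathbb{R};L^r_x(\mathbb{R}^d))}\le C(M)\|\phi\|_{L^2(\mathbb{R}^d)}.$$
   Context: A pair $(q,r)$ is sharp $\sigma$-admissible if $2\le q,r\le\infty$, $\frac1q=\sigma(\frac12-\frac1r)$ and $(q,r,\sigma)\ne(2,\infty,1)$. $e^{it\Delta}$ is the Fourier multiplier $e^{-it|\xi|^2}$ on $\mathbb{R}^d$. *)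

theory Defs
  imports "HOL-Analysis.Analysis"
begin

definition enn_rpow :: "ennreal \<Rightarrow> real \<Rightarrow> ennreal" where
  "enn_rpow x p = (if x = top then top else ennreal (enn2real x powr p))"

definition lp_norm :: "'a measure \<Rightarrow> ereal \<Rightarrow> ('a \<Rightarrow> ennreal) \<Rightarrow> ennreal" where
  "lp_norm M p g =
     (if p = \<infinity> then Inf {c. AE x in M. g x \<le> c}
      else enn_rpow (\<integral>\<^sup>+ x. enn_rpow (g x) (real_of_ereal p) \<partial>M) (1 / real_of_ereal p))"

definition L2 :: "('a::euclidean_space \<Rightarrow> complex) set" where
  "L2 = {f. f \<in> borel_measurable lborel \<and> (\<integral>\<^sup>+ x. ennreal ((cmod (f x))\<^sup>2) \<partial>lborel) < \<infinity>}"

definition fourier_L2 :: "('a::euclidean_space \<Rightarrow> complex) \<Rightarrow> ('a \<Rightarrow> complex) \<Rightarrow> bool" where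
  "fourier_L2 \<phi> \<psi> \<longleftrightarrow> \<psi> \<in> L2 \<and>
     ((\<lambda>R::real. \<integral>\<^sup>+ \<xi>. ennreal ((cmod (\<psi> \<xi> -
         (\<integral>x\<in>ball 0 R. \<phi> x * cis (- (x \<bullet> \<xi>)) \<partial>lborel)))\<^sup>2) \<partial>lborel) \<longlongrightarrow> 0) at_top"

definition sharp_admissible :: "real \<Rightarrow> ereal \<Rightarrow> ereal \<Rightarrow> bool" where
  "sharp_admissible \<sigma> q r \<longleftrightarrow> 2 \<le> q \<and> 2 \<le> r \<and>
     inverse q = ereal \<sigma> * (ereal (1/2) - inverse r) \<and>
     \<not> (q = 2 \<and> r = \<infinity> \<and> \<sigma> = 1)"

end

theory Submission
  imports Defs "HOL-Probability.Probability" "HOL-Complex_Analysis.Complex_Analysis"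
begin

text \<open>
  The multiplier \<open>exp (- (a \<bullet> \<xi>)\<^sup>2)\<close> may be inserted at the cost of a factor \<open>exp (M\<^sup>2)\<close>. It turns the
  kernel of the flow at time \<open>t\<close> into an explicit Gaussian which is \<open>O(\<bar>t\<bar> powr - \<sigma>)\<close> with \<open>\<sigma> = (d - 1) / 2\<close>,
  uniformly in \<open>a\<close>, because one of the \<open>d\<close> directions does not see the dispersion any more. The estimate
  then follows from the method of Keel and Tao, in a form that uses no interpolation theorem: the dual
  function is built from superlevel sets of the solution, so it is a sum of atoms of measure about \<open>2 ^ m\<close>,
  and for atoms the \<open>L1\<close> and \<open>L2\<close> bounds already contain all the intermediate ones. For \<open>q > 2\<close> the atoms
  sum up to a Hardy-Littlewood-Sobolev inequality in time; for \<open>q = 2\<close> atoms of different scale are almost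
  orthogonal. All of this is done on a time grid of step \<open>h\<close>, where only atoms of time scale at least \<open>h\<close>
  are used. The measures of superlevel sets are lower semicontinuous under \<open>L2\<close> convergence, so that Fatou's
  lemma yields the estimate in continuous time without any measurability question in \<open>(t, x)\<close>.
\<close>

section \<open>Gaussian integrals\<close>

text \<open>For pairings at time distance t, atoms of measure about 2^m have two bounds: L2 gives
  2^m, dispersion gives t powr -\<sigma> * 4^m. They agree at t = 2 powr (m / \<sigma>), the time
  scale of the atom, and the sums over scales converge geometrically on both sides of such a
  balance. On the diagonal of a time grid there is no dispersion; an atom of time scale at least h
  nevertheless satisfies the dispersive bound with t = h there, by its L2 bound. This is the reason
  for a threshold h powr \<sigma> on the measures, and since it tends to 0 with h, no level is lost
  in the limit. The endpoint is delicate because Hardy-Littlewood-Sobolev fails for the kernel 1 /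
  t. For two time scales X < Y, summing the absolute values of all pairings gains nothing: it would
  need short time differences to stop below sqrt (X * Y) and long ones to start above it. The gain
  comes from keeping the vectors of the shorter scale together over a window of times: the squared
  norm of their sum is controlled by the sum of squares, with a constant that depends neither on X
  nor on the length of the window.\<close>

lemma integrable_gaussian_real:
  fixes p :: real assumes "p > 0" shows "integrable lborel (\<lambda>x::real. exp (- p * x\<^sup>2))"
proof -
  have "integrable lborel (\<lambda>x. (sqrt (2 * pi) * sqrt (1 / (2*p))) * normal_density 0 (sqrt (1 / (2*p))) x)"
    using assms by (intro integrable_mult_right integrable_normal_density) auto
  then show ?thesis
    by (rule back_subst[of "integrable lborel"]) (use assms in \<open>auto simp: normal_density_def real_sqrt_mult real_sqrt_divide field_simps fun_eq_iff\<close>)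
qed

lemma norm_exp_gauss: "norm (exp (- \<zeta> * of_real (x\<^sup>2)) * cis (- (y * x))) = exp (- Re \<zeta> * (x::real)\<^sup>2)"
  by (simp add: norm_mult norm_exp_eq_Re)

lemma integrable_gauss1:
  fixes \<zeta> :: complex assumes "Re \<zeta> > 0"
  shows "integrable lborel (\<lambda>x::real. exp (- \<zeta> * of_real (x\<^sup>2)) * cis (- (y * x)))"
proof (rule Bochner_Integration.integrable_bound[OF integrable_gaussian_real[OF assms]])
  show "(\<lambda>x::real. exp (- \<zeta> * of_real (x\<^sup>2)) * cis (- (y * x))) \<in> borel_measurable lborel"
    by (intro borel_measurable_continuous_onI continuous_intros | simp)+
qed (intro AE_I2, subst norm_exp_gauss, simp)

text \<open>The substitution x -> c * x with c = 1 / sqrt (2 * p) turns p * x^2 into x^2 / 2, and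
  the integral becomes a multiple of the characteristic function of the standard normal law.\<close>

lemma gauss1_real:
  fixes p y :: real assumes p: "p > 0"
  shows "(LINT x|lborel. exp (- of_real p * of_real (x\<^sup>2)) * cis (- (y * x))) = csqrt (pi / p) * exp (- of_real (y\<^sup>2) / (4 * of_real p))"
proof -
  define c where "c = 1 / sqrt (2 * p)"
  have c: "c > 0" using p by (simp add: c_def)
  have c2: "c\<^sup>2 = 1 / (2*p)" using p by (simp add: c_def power_divide)
  have "(LINT x|lborel. exp (- of_real p * of_real (x\<^sup>2)) * cis (- (y * x)))
     = \<bar>c\<bar> *\<^sub>R (LINT x|lborel. exp (- of_real p * of_real ((c * x)\<^sup>2)) * cis (- (y * (c*x))))"
    using lborel_integral_real_affine[of c "\<lambda>x. exp (- of_real p * of_real (x\<^sup>2)) * cis (- (y * x))" 0] c by simp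
  also have "(\<lambda>x. exp (- of_real p * of_real ((c * x)\<^sup>2)) * cis (- (y * (c*x))))
      = (\<lambda>x. of_real (sqrt (2*pi)) * (std_normal_density x *\<^sub>R iexp ((- y * c) * x)))"
  proof
    fix x :: real
    have "p * (c*x)\<^sup>2 = x\<^sup>2 / 2" using p by (simp add: power_mult_distrib c2)
    hence "exp (- of_real p * of_real ((c * x)\<^sup>2)) = complex_of_real (exp (- x\<^sup>2/2))"
      by (simp only: exp_of_real[symmetric] of_real_mult[symmetric] mult_minus_left of_real_minus) simp
    thus "exp (- of_real p * of_real ((c * x)\<^sup>2)) * cis (- (y * (c*x))) = of_real (sqrt (2*pi)) * (std_normal_density x *\<^sub>R iexp ((- y * c) * x))"
      by (simp add: std_normal_density_def cis_conv_exp scaleR_conv_of_real mult_ac)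
  qed
  also have "(LINT x|lborel. of_real (sqrt (2*pi)) * (std_normal_density x *\<^sub>R iexp ((- y * c) * x)))
     = of_real (sqrt (2*pi)) * char std_normal_distribution (- y * c)"
    by (subst integral_mult_right_zero, simp only: char_def, subst integral_density) auto
  also have "\<dots> = of_real (sqrt (2*pi)) * of_real (exp (- (y * c)\<^sup>2 / 2))"
    by (simp add: char_std_normal_distribution)
  finally have *: "(LINT x|lborel. exp (- of_real p * of_real (x\<^sup>2)) * cis (- (y * x))) = complex_of_real (c * sqrt (2*pi) * exp (- (y\<^sup>2 / (4*p))))"
    using c p by (simp add: scaleR_conv_of_real mult_ac power_mult_distrib c2)
  have "csqrt (pi / p) = complex_of_real (sqrt (pi/p))" using p by (subst csqrt_of_real_nonneg) auto
  moreover have "c * sqrt (2*pi) = sqrt (pi/p)" using p by (simp add: c_def real_sqrt_divide real_sqrt_mult)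
  moreover have "exp (- complex_of_real (y\<^sup>2) / (4 * of_real p)) = of_real (exp (- (y\<^sup>2 / (4*p))))"
    by (simp flip: exp_of_real)
  ultimately show ?thesis using * by (simp only: of_real_mult)
qed

text \<open>Integrals over [-n, n] are holomorphic by the Leibniz rule. On the disc of radius d = Re
  z / 2 around z every \<zeta> has real part at least d, so the tails are dominated by those of exp
  (- d * x^2) and the convergence is uniform there.\<close>

lemma gauss1_holomorphic:
  "(\<lambda>\<zeta>. LINT x|lborel. exp (- \<zeta> * of_real (x\<^sup>2)) * cis (- (y * x))) holomorphic_on {\<zeta>. Re \<zeta> > 0}"
proof (rule holomorphic_uniform_sequence)
  let ?F = "\<lambda>\<zeta> x::real. exp (- \<zeta> * of_real (x\<^sup>2)) * cis (- (y * x))"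
  show "open {\<zeta>. Re \<zeta> > 0}" by (rule open_halfspace_Re_gt)
  show "(\<lambda>\<zeta>. integral (cbox (- real n) (real n)) (?F \<zeta>)) holomorphic_on {\<zeta>. Re \<zeta> > 0}" for n
  proof (rule leibniz_rule_holomorphic[where fx = "\<lambda>\<zeta> x. - of_real (x\<^sup>2) * exp (- \<zeta> * of_real (x\<^sup>2)) * cis (- (y * x))"])
    show "?F \<zeta> integrable_on cbox (- real n) (real n)" for \<zeta>
      by (intro integrable_continuous continuous_intros)
    show "continuous_on ({\<zeta>. 0 < Re \<zeta>} \<times> cbox (- real n) (real n))
     (\<lambda>(\<zeta>, x). - complex_of_real (x\<^sup>2) * exp (- \<zeta> * complex_of_real (x\<^sup>2)) * cis (- (y * x)))"
      unfolding case_prod_beta by (intro continuous_intros)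
    show "convex {\<zeta>. 0 < Re \<zeta>}" by (rule convex_halfspace_Re_gt)
  qed (auto intro!: derivative_eq_intros)
  fix z assume "z \<in> {\<zeta>. Re \<zeta> > 0}"
  hence z: "Re z > 0" by simp
  define d where "d = Re z / 2"
  have d: "d > 0" using z by (simp add: d_def)
  have Re: "Re \<zeta> \<ge> d" if "\<zeta> \<in> cball z d" for \<zeta>
    using that abs_Re_le_cmod[of "z - \<zeta>"] by (auto simp: d_def dist_norm)
  have "uniform_limit (cball z d) (\<lambda>n \<zeta>. integral (cbox (- real n) (real n)) (?F \<zeta>)) (\<lambda>\<zeta>. LINT x|lborel. ?F \<zeta> x) sequentially"
  proof (rule uniform_limitI)
    fix e :: real assume e: "e > 0"
    let ?g = "\<lambda>x::real. exp (- d * x\<^sup>2)"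
    have gi: "integrable lborel ?g" by (rule integrable_gaussian_real[OF d])
    have "(\<lambda>n. LINT x|lborel. indicator (- {- real n..real n}) x * ?g x) \<longlonglongrightarrow> (LINT x::real|lborel. 0)"
    proof (rule integral_dominated_convergence[where w = ?g])
      show "AE x in lborel. (\<lambda>n. indicator (- {- real n..real n}) x * ?g x) \<longlonglongrightarrow> 0"
      proof (rule AE_I2)
        fix x :: real
        have "\<forall>\<^sub>F n in sequentially. real n \<ge> \<bar>x\<bar>"
          using filterlim_real_sequentially by (auto simp: filterlim_at_top)
        hence "\<forall>\<^sub>F n in sequentially. indicator (- {- real n..real n}) x * ?g x = 0"
          by eventually_elim (auto simp: indicator_def)
        thus "(\<lambda>n. indicator (- {- real n..real n}) x * ?g x) \<longlonglongrightarrow> 0" by (rule tendsto_eventually)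
      qed
    qed (use gi in \<open>auto simp: indicator_def\<close>)
    hence "\<forall>\<^sub>F n in sequentially. (LINT x|lborel. indicator (- {- real n..real n}) x * ?g x) < e"
      using e by (intro order_tendstoD) auto
    thus "\<forall>\<^sub>F n in sequentially. \<forall>\<zeta>\<in>cball z d. dist (integral (cbox (- real n) (real n)) (?F \<zeta>)) (LINT x|lborel. ?F \<zeta> x) < e"
    proof eventually_elim
      case (elim n)
      show ?case
      proof
        fix \<zeta> assume "\<zeta> \<in> cball z d"
        hence R: "Re \<zeta> \<ge> d" by (rule Re)
        hence Fi: "integrable lborel (?F \<zeta>)" using d by (intro integrable_gauss1) auto
        let ?I = "{- real n..real n}"
        have si: "set_integrable lborel ?I (?F \<zeta>)" using Fi
          unfolding set_integrable_def by (intro integrable_mult_indicator) auto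
        have "integral (cbox (- real n) (real n)) (?F \<zeta>) = (LINT x|lborel. indicator ?I x *\<^sub>R ?F \<zeta> x)"
          using set_borel_integral_eq_integral(2)[OF si] by (simp add: set_lebesgue_integral_def)
        hence "dist (integral (cbox (- real n) (real n)) (?F \<zeta>)) (LINT x|lborel. ?F \<zeta> x)
          = norm (LINT x|lborel. ?F \<zeta> x - indicator ?I x *\<^sub>R ?F \<zeta> x)"
          using si Fi unfolding set_integrable_def by (subst Bochner_Integration.integral_diff) (auto simp: dist_norm norm_minus_commute)
        also have "\<dots> \<le> (LINT x|lborel. indicator (- ?I) x * ?g x)"
        proof (rule Bochner_Integration.integral_norm_bound_integral)
          show "integrable lborel (\<lambda>x. indicator (- ?I) x * ?g x)"
            using integrable_mult_indicator[OF _ gi, of "-?I"] by simp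
          show "norm (?F \<zeta> x - indicator ?I x *\<^sub>R ?F \<zeta> x) \<le> indicator (- ?I) x * ?g x" for x
            using R by (auto simp: indicator_def norm_exp_gauss norm_mult norm_exp_eq_Re intro!: mult_right_mono)
        qed (use si Fi in \<open>auto simp: set_integrable_def\<close>)
        finally show "dist (integral (cbox (- real n) (real n)) (?F \<zeta>)) (LINT x|lborel. ?F \<zeta> x) < e" using elim by simp
      qed
    qed
  qed
  thus "\<exists>d>0. cball z d \<subseteq> {\<zeta>. Re \<zeta> > 0} \<and> uniform_limit (cball z d) (\<lambda>n \<zeta>. integral (cbox (- real n) (real n)) (?F \<zeta>)) (\<lambda>\<zeta>. LINT x|lborel. ?F \<zeta> x) sequentially"
    using d Re by (intro exI[of _ d]) force
qed

text \<open>Analytic continuation from the positive axis, where \<open>gauss1_real\<close> applies.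
  The principal root is holomorphic here because pi / \<zeta> stays in the right half-plane.\<close>

lemma gauss1:
  fixes \<zeta> :: complex assumes "Re \<zeta> > 0"
  shows "(LINT x|lborel. exp (- \<zeta> * of_real (x\<^sup>2)) * cis (- (y * x))) = csqrt (pi / \<zeta>) * exp (- of_real (y\<^sup>2) / (4 * \<zeta>))"
proof -
  let ?S = "{\<zeta>. Re \<zeta> > 0}"
  let ?f = "\<lambda>\<zeta>::complex. (LINT x|lborel. exp (- \<zeta> * of_real (x\<^sup>2)) * cis (- (y * x))) - csqrt (pi / \<zeta>) * exp (- of_real (y\<^sup>2) / (4 * \<zeta>))"
  have pos: "complex_of_real pi / \<zeta> \<notin> \<real>\<^sub>\<le>\<^sub>0" if "Re \<zeta> > 0" for \<zeta>
  proof -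
    have "Re (complex_of_real pi / \<zeta>) > 0" using that by (auto simp: Re_divide intro!: divide_pos_pos add_pos_nonneg)
    thus ?thesis unfolding complex_nonpos_Reals_iff by linarith
  qed
  have "?f \<zeta> = 0"
  proof (rule analytic_continuation[of ?f ?S "of_real ` {0<..}" 1])
    show "?f holomorphic_on ?S"
      using pos by (intro holomorphic_on_diff gauss1_holomorphic holomorphic_intros) auto
    show "open ?S" by (rule open_halfspace_Re_gt)
    show "connected ?S" by (intro convex_connected convex_halfspace_Re_gt)
    show "1 islimpt complex_of_real ` {0<..}"
      unfolding islimpt_approachable
    proof (intro allI impI)
      fix e :: real assume "e > 0"
      hence "dist (complex_of_real (1 + e / 2)) 1 < e"
        by (simp add: dist_norm)
      moreover have "complex_of_real (1 + e / 2) \<noteq> 1"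
        using \<open>e > 0\<close> by (metis add_cancel_right_right divide_eq_0_iff less_numeral_extra(3) of_real_eq_1_iff zero_neq_numeral)
      ultimately show "\<exists>x'\<in>complex_of_real ` {0<..}. x' \<noteq> 1 \<and> dist x' 1 < e"
        using \<open>e > 0\<close> by (intro bexI[of _ "complex_of_real (1 + e / 2)"] conjI imageI) auto
    qed
    show "?f z = 0" if "z \<in> complex_of_real ` {0<..}" for z
      using that gauss1_real by auto
  qed (use assms in auto)
  thus ?thesis by simp
qed

text \<open>Lebesgue measure is the image of the product measure over \<open>Basis\<close>; this
  reduces the Gaussian integral in d dimensions to \<open>gauss1\<close>.\<close>

lemma lborel_product_integral:
  fixes f :: "'a::euclidean_space \<Rightarrow> real \<Rightarrow> complex"
  assumes "\<And>b. b \<in> Basis \<Longrightarrow> integrable lborel (f b)"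
  shows "integrable lborel (\<lambda>x::'a. \<Prod>b\<in>Basis. f b (x \<bullet> b))"
    and "(LINT x|lborel. (\<Prod>b\<in>Basis. f b (x \<bullet> b))) = (\<Prod>b\<in>Basis. LINT t|lborel. f b t)"
proof -
  interpret product_sigma_finite "\<lambda>_::'a. lborel :: real measure"
    by (intro product_sigma_finite.intro sigma_finite_lborel)
  let ?S = "\<lambda>f. \<Sum>b\<in>(Basis :: 'a set). f b *\<^sub>R b"
  have S: "?S \<in> (\<Pi>\<^sub>M b\<in>Basis. lborel) \<rightarrow>\<^sub>M borel" by measurable
  have m: "f b \<in> borel_measurable borel" if "b \<in> Basis" for b
    using borel_measurable_integrable[OF assms[OF that]] by simp
  have mm: "(\<lambda>x. \<Prod>b\<in>Basis. f b (x \<bullet> b)) \<in> borel_measurable borel"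
    by (intro borel_measurable_prod measurable_compose[OF _ m]) auto
  have eq: "(\<Prod>b\<in>Basis. f b (?S g \<bullet> b)) = (\<Prod>b\<in>Basis. f b (g b))" for g
    by (intro prod.cong) auto
  show "integrable lborel (\<lambda>x::'a. \<Prod>b\<in>Basis. f b (x \<bullet> b))"
    by (subst lborel_eq, subst integrable_distr_eq[OF S mm]) (simp add: eq product_integrable_prod assms del: inner_sum_left_Basis)
  show "(LINT x|lborel. (\<Prod>b\<in>Basis. f b (x \<bullet> b))) = (\<Prod>b\<in>Basis. LINT t|lborel. f b t)"
    by (subst lborel_eq, subst integral_distr[OF S mm]) (simp add: eq product_integral_prod assms del: inner_sum_left_Basis)
qed

lemma gauss_prod:
  fixes \<xi> z :: "'a::euclidean_space"
  shows "exp (- \<zeta> * of_real ((norm \<xi>)\<^sup>2)) * cis (- (z \<bullet> \<xi>))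
    = (\<Prod>b\<in>Basis. exp (- \<zeta> * of_real ((\<xi> \<bullet> b)\<^sup>2)) * cis (- ((z \<bullet> b) * (\<xi> \<bullet> b))))"
proof -
  have 1: "(norm \<xi>)\<^sup>2 = (\<Sum>b\<in>Basis. (\<xi> \<bullet> b)\<^sup>2)"
    unfolding power2_norm_eq_inner by (subst euclidean_inner) (simp add: power2_eq_square)
  have 2: "z \<bullet> \<xi> = (\<Sum>b\<in>Basis. (z \<bullet> b) * (\<xi> \<bullet> b))" by (rule euclidean_inner)
  show ?thesis unfolding prod.distrib 1 2 cis_conv_exp exp_sum[OF finite_Basis, symmetric]
    by (simp add: sum_distrib_left sum_negf)
qed

lemma
  fixes z :: "'a::euclidean_space" and \<zeta> :: complex assumes "Re \<zeta> > 0"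
  shows integrable_gaussN: "integrable lborel (\<lambda>\<xi>::'a. exp (- \<zeta> * of_real ((norm \<xi>)\<^sup>2)) * cis (- (z \<bullet> \<xi>)))"
    and integral_gaussN: "(LINT \<xi>|lborel. exp (- \<zeta> * of_real ((norm \<xi>)\<^sup>2)) * cis (- (z \<bullet> \<xi>)))
      = csqrt (pi / \<zeta>) ^ DIM('a) * exp (- of_real ((norm z)\<^sup>2) / (4 * \<zeta>))"
proof -
  note p = lborel_product_integral[of "\<lambda>b x. exp (- \<zeta> * of_real (x\<^sup>2)) * cis (- ((z \<bullet> b) * x))", OF integrable_gauss1[OF assms]]
  show "integrable lborel (\<lambda>\<xi>::'a. exp (- \<zeta> * of_real ((norm \<xi>)\<^sup>2)) * cis (- (z \<bullet> \<xi>)))"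
    unfolding gauss_prod by (rule p(1))
  have 1: "(norm z)\<^sup>2 = (\<Sum>b\<in>Basis. (z \<bullet> b)\<^sup>2)"
    unfolding power2_norm_eq_inner by (subst euclidean_inner) (simp add: power2_eq_square)
  show "(LINT \<xi>|lborel. exp (- \<zeta> * of_real ((norm \<xi>)\<^sup>2)) * cis (- (z \<bullet> \<xi>)))
      = csqrt (pi / \<zeta>) ^ DIM('a) * exp (- of_real ((norm z)\<^sup>2) / (4 * \<zeta>))"
    unfolding gauss_prod p(2) gauss1[OF assms]
    by (simp add: prod.distrib exp_sum[symmetric] 1 sum_negf sum_divide_distrib)
qed

section \<open>Fourier multipliers, their kernels, and the kernel of the weighted flow\<close>

definition fourier :: "('a::euclidean_space \<Rightarrow> complex) \<Rightarrow> 'a \<Rightarrow> complex" where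
  "fourier F \<xi> = (LINT x|lborel. F x * cis (- (x \<bullet> \<xi>)))"

lemma integrable_mult_cis:
  fixes F :: "'a::euclidean_space \<Rightarrow> complex"
  assumes "integrable lborel F" "g \<in> borel_measurable borel"
  shows "integrable lborel (\<lambda>x. F x * cis (g x))"
proof (rule Bochner_Integration.integrable_bound[OF assms(1)])
  have "cis \<in> borel_measurable borel" by (intro borel_measurable_continuous_onI continuous_intros)
  from measurable_compose[OF assms(2) this] borel_measurable_integrable[OF assms(1)]
  show "(\<lambda>x. F x * cis (g x)) \<in> borel_measurable lborel" by simp
qed (auto simp: norm_mult)

lemma integrable_pair_mult:
  fixes F :: "'a::euclidean_space \<Rightarrow> complex" and G :: "'b::euclidean_space \<Rightarrow> complex"
  assumes F: "integrable lborel F" and G: "integrable lborel G"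
  shows "integrable (lborel \<Otimes>\<^sub>M lborel) (\<lambda>(x, y). F x * G y)"
proof -
  have [measurable]: "F \<in> borel_measurable lborel" "G \<in> borel_measurable lborel"
    using F G by (auto dest: borel_measurable_integrable)
  show ?thesis
  proof (rule lborel_pair.Fubini_integrable)
    show "(\<lambda>(x, y). F x * G y) \<in> borel_measurable (lborel \<Otimes>\<^sub>M lborel)" by measurable
    show "integrable lborel (\<lambda>x. LINT y|lborel. norm (case (x, y) of (x, y) \<Rightarrow> F x * G y))"
      using F by (simp add: norm_mult)
    show "AE x in lborel. integrable lborel (\<lambda>y. case (x, y) of (x, y) \<Rightarrow> F x * G y)"
      using G by simp
  qed
qed

lemma integral_pair_mult:
  fixes F :: "'a::euclidean_space \<Rightarrow> complex" and G :: "'b::euclidean_space \<Rightarrow> complex"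
  assumes F: "integrable lborel F" and G: "integrable lborel G"
  shows "(LINT p|(lborel \<Otimes>\<^sub>M lborel). F (fst p) * G (snd p)) = (LINT x|lborel. F x) * (LINT y|lborel. G y)"
proof -
  show ?thesis
    using lborel_pair.integral_fst'[OF integrable_pair_mult[OF F G]] by (simp add: case_prod_beta')
qed

lemma sigma_finite_lborel_pair: "sigma_finite_measure ((lborel :: 'a::euclidean_space measure) \<Otimes>\<^sub>M (lborel :: 'b::euclidean_space measure))"
  by (simp add: lborel_prod sigma_finite_lborel)

text \<open>Fubini over (\<xi>, (x, y)), integrating \<xi> first in one order and (x, y) first in
  the other. Integrability of w makes the triple integral absolutely convergent; the oscillating
  multiplier of the flow lacks it and will be reached as a limit of Gaussian
  regularisations.\<close>

lemma fourier_multiplier: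
  fixes F G w :: "'a::euclidean_space \<Rightarrow> complex"
  assumes F: "integrable lborel F" and G: "integrable lborel G" and w: "integrable lborel w"
  shows "integrable (lborel \<Otimes>\<^sub>M lborel) (\<lambda>p. F (fst p) * cnj (G (snd p)) * fourier w (fst p - snd p))"
    and "(LINT \<xi>|lborel. w \<xi> * (fourier F \<xi> * cnj (fourier G \<xi>)))
     = (LINT p|(lborel \<Otimes>\<^sub>M lborel). F (fst p) * cnj (G (snd p)) * fourier w (fst p - snd p))"
proof -
  let ?P = "(lborel :: 'a measure) \<Otimes>\<^sub>M (lborel :: 'a measure)"
  have P: "?P = lborel" by (rule lborel_prod)
  interpret pair_sigma_finite "lborel :: 'a measure" "?P"
    by (intro pair_sigma_finite.intro sigma_finite_lborel sigma_finite_lborel_pair)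
  have Gc: "integrable lborel (\<lambda>y. cnj (G y))" using G by simp
  have FG: "integrable ?P (\<lambda>p. F (fst p) * cnj (G (snd p)))"
    using integrable_pair_mult[OF F Gc] by (simp add: case_prod_beta')
  let ?h = "\<lambda>\<xi> p. w \<xi> * (F (fst p) * cnj (G (snd p))) * cis (- ((fst p - snd p) \<bullet> \<xi>))"
  have int: "integrable (lborel \<Otimes>\<^sub>M ?P) (\<lambda>(\<xi>, p). ?h \<xi> p)"
  proof -
    have "integrable (lborel \<Otimes>\<^sub>M ?P) (\<lambda>(\<xi>, p). w \<xi> * (F (fst p) * cnj (G (snd p))))"
      using integrable_pair_mult[OF w FG[unfolded P]] by (simp add: P)
    hence 0: "integrable lborel (\<lambda>x. case x of (\<xi>, p) \<Rightarrow> w \<xi> * (F (fst p) * cnj (G (snd p))))"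
      unfolding P lborel_prod .
    have "(\<lambda>x::'a\<times>'a\<times>'a. - ((fst (snd x) - snd (snd x)) \<bullet> fst x)) \<in> borel_measurable borel"
      by (intro borel_measurable_continuous_onI continuous_intros)
    from integrable_mult_cis[OF 0 this] show ?thesis
      unfolding P lborel_prod by (simp add: case_prod_beta')
  qed
  have in1: "(LINT p|?P. ?h \<xi> p) = w \<xi> * (fourier F \<xi> * cnj (fourier G \<xi>))" for \<xi>
  proof -
    have cs: "cis (- ((x - y) \<bullet> \<xi>)) = cis (- (x \<bullet> \<xi>)) * cis (y \<bullet> \<xi>)" for x y
      by (simp add: cis_mult inner_diff_left)
    have m: "(\<lambda>x. - (x \<bullet> \<xi>)) \<in> borel_measurable borel" "(\<lambda>x. x \<bullet> \<xi>) \<in> borel_measurable borel" by auto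
    have "(LINT p|?P. ?h \<xi> p) = (LINT p|?P. w \<xi> * ((F (fst p) * cis (- (fst p \<bullet> \<xi>))) * (cnj (G (snd p)) * cis (snd p \<bullet> \<xi>))))"
      by (intro Bochner_Integration.integral_cong refl) (simp add: cs mult_ac)
    also have "\<dots> = w \<xi> * (fourier F \<xi> * (LINT y|lborel. cnj (G y) * cis (y \<bullet> \<xi>)))"
      using integral_pair_mult[OF integrable_mult_cis[OF F m(1)] integrable_mult_cis[OF Gc m(2)]]
      by (simp add: fourier_def)
    also have "(LINT y|lborel. cnj (G y) * cis (y \<bullet> \<xi>)) = cnj (fourier G \<xi>)"
      unfolding fourier_def by (subst Bochner_Integration.integral_cnj[symmetric]) (simp add: cis_cnj)
    finally show ?thesis .
  qed
  have in2: "(LINT \<xi>|lborel. ?h \<xi> p) = F (fst p) * cnj (G (snd p)) * fourier w (fst p - snd p)" for p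
  proof -
    have "(LINT \<xi>|lborel. ?h \<xi> p) = (LINT \<xi>|lborel. (F (fst p) * cnj (G (snd p))) * (w \<xi> * cis (- (\<xi> \<bullet> (fst p - snd p)))))"
      by (intro Bochner_Integration.integral_cong refl) (simp add: inner_commute mult_ac)
    thus ?thesis by (simp add: fourier_def)
  qed
  show "integrable (lborel \<Otimes>\<^sub>M lborel) (\<lambda>p. F (fst p) * cnj (G (snd p)) * fourier w (fst p - snd p))"
    using integrable_snd[OF int] by (simp add: in2)
  show "(LINT \<xi>|lborel. w \<xi> * (fourier F \<xi> * cnj (fourier G \<xi>)))
     = (LINT p|(lborel \<Otimes>\<^sub>M lborel). F (fst p) * cnj (G (snd p)) * fourier w (fst p - snd p))"
    using Fubini_integral[OF int] by (simp add: in1 in2)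
qed

lemma fourier_multiplier_bound:
  fixes F G w :: "'a::euclidean_space \<Rightarrow> complex"
  assumes F: "integrable lborel F" and G: "integrable lborel G" and w: "integrable lborel w"
    and B: "\<And>z. norm (fourier w z) \<le> B"
  shows "norm (LINT \<xi>|lborel. w \<xi> * (fourier F \<xi> * cnj (fourier G \<xi>)))
     \<le> B * (LINT x|lborel. norm (F x)) * (LINT x|lborel. norm (G x))"
proof -
  let ?P = "(lborel :: 'a measure) \<Otimes>\<^sub>M (lborel :: 'a measure)"
  \<comment> \<open>Complex copies of the norms, so that the complex product lemmas apply to
    them.\<close>
  have F': "integrable lborel (\<lambda>x. complex_of_real (norm (F x)))" and G': "integrable lborel (\<lambda>x. complex_of_real (norm (G x)))"
    using F G by auto
  have i: "integrable ?P (\<lambda>p. complex_of_real (norm (F (fst p))) * of_real (norm (G (snd p))))"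
    using integrable_pair_mult[OF F' G'] by (simp add: case_prod_beta')
  hence i': "integrable ?P (\<lambda>p. norm (F (fst p)) * norm (G (snd p)))"
    using integrable_Re by fastforce
  have "complex_of_real (LINT p|?P. norm (F (fst p)) * norm (G (snd p))) = of_real ((LINT x|lborel. norm (F x)) * (LINT x|lborel. norm (G x)))"
    using integral_pair_mult[OF F' G'] by (simp only: integral_complex_of_real of_real_mult[symmetric])
  hence v: "(LINT p|?P. norm (F (fst p)) * norm (G (snd p))) = (LINT x|lborel. norm (F x)) * (LINT x|lborel. norm (G x))"
    by (simp only: of_real_eq_iff)
  have "norm (LINT \<xi>|lborel. w \<xi> * (fourier F \<xi> * cnj (fourier G \<xi>)))
    \<le> (LINT p|?P. B * (norm (F (fst p)) * norm (G (snd p))))"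
    unfolding fourier_multiplier(2)[OF F G w]
  proof (rule Bochner_Integration.integral_norm_bound_integral[OF fourier_multiplier(1)[OF F G w]])
    show "integrable ?P (\<lambda>p. B * (norm (F (fst p)) * norm (G (snd p))))" using i' by simp
    show "norm (F (fst p) * cnj (G (snd p)) * fourier w (fst p - snd p)) \<le> B * (norm (F (fst p)) * norm (G (snd p)))" for p
      using mult_left_mono[OF B[of "fst p - snd p"], of "norm (F (fst p)) * norm (G (snd p))"] by (simp add: norm_mult mult_ac)
  qed
  also have "\<dots> = B * ((LINT x|lborel. norm (F x)) * (LINT x|lborel. norm (G x)))"
    by (simp add: v)
  finally show ?thesis by (simp add: mult_ac)
qed

lemma integral_gaussian_real:
  fixes p :: real assumes "p > 0" shows "(LINT x::real|lborel. exp (- p * x\<^sup>2)) = sqrt (pi / p)"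
proof -
  have "complex_of_real (exp (- p * x\<^sup>2)) = exp (- of_real p * of_real (x\<^sup>2)) * cis (- (0 * x))" for x
    by (simp flip: exp_of_real)
  hence "complex_of_real (LINT x::real|lborel. exp (- p * x\<^sup>2)) = csqrt (pi / p)"
    unfolding integral_complex_of_real[symmetric] using gauss1_real[OF assms, of 0] by simp
  also have "csqrt (pi / p) = complex_of_real (sqrt (pi/p))" using assms by (subst csqrt_of_real_nonneg) auto
  finally show ?thesis by (simp only: of_real_eq_iff)
qed

text \<open>Pairing two adjoint flows multiplies two weights exp (- (a \<bullet> \<xi>)^2), whence
  the factor 2 in the exponent. The parameter \<zeta> will be a small positive regularisation minus
  \<i> times the time difference.\<close>

abbreviation anisotropic_gauss :: "complex \<Rightarrow> 'a::euclidean_space \<Rightarrow> 'a \<Rightarrow> complex" where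
  "anisotropic_gauss \<zeta> a \<equiv> (\<lambda>\<xi>. exp (- \<zeta> * of_real ((norm \<xi>)\<^sup>2)) * of_real (exp (- 2 * (a \<bullet> \<xi>)\<^sup>2)))"

lemma integrable_anisotropic_gauss:
  fixes a :: "'a::euclidean_space" and \<zeta> :: complex assumes "Re \<zeta> > 0"
  shows "integrable lborel (anisotropic_gauss \<zeta> a)"
proof (rule Bochner_Integration.integrable_bound[OF integrable_gaussN[OF assms, of 0]])
  show "anisotropic_gauss \<zeta> a \<in> borel_measurable lborel"
    by (subst measurable_lborel2, intro borel_measurable_continuous_onI continuous_intros)
  show "AE \<xi> in lborel. norm (anisotropic_gauss \<zeta> a \<xi>) \<le> norm (exp (- \<zeta> * of_real ((norm \<xi>)\<^sup>2)) * cis (- (0 \<bullet> \<xi>)))"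
    by (intro AE_I2) (simp add: norm_mult mult_left_le)
qed

text \<open>Writing the weight as a superposition of characters reduces everything to the isotropic Gaussian, so
  that \<open>a\<close> need not be rotated to a coordinate axis.\<close>

lemma fourier_anisotropic_gauss:
  fixes a z :: "'a::euclidean_space" and \<zeta> :: complex assumes \<zeta>: "Re \<zeta> > 0"
  shows "fourier (anisotropic_gauss \<zeta> a) z = csqrt (pi / \<zeta>) ^ DIM('a) *
    (LINT y|lborel. of_real (exp (- (y\<^sup>2 / 8)) / sqrt (8 * pi)) * exp (- of_real ((norm (z + y *\<^sub>R a))\<^sup>2) / (4 * \<zeta>)))"
proof -
  let ?g = "\<lambda>y::real. complex_of_real (exp (- (y\<^sup>2 / 8)) / sqrt (8 * pi))"
  have gi: "integrable lborel ?g"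
    using integrable_gaussian_real[of "1/8"] by (intro integrable_of_real integrable_divide) simp
  \<comment> \<open>The parameter 1/8 of \<open>?g\<close> is dictated by s^2 / (4 * (1/8)) = 2 *
    s^2, and sqrt (8 * pi) is the resulting prefactor of \<open>gauss1_real\<close>.\<close>
  have e: "complex_of_real (exp (- 2 * s\<^sup>2)) = (LINT y|lborel. ?g y * cis (- (s * y)))" for s
  proof -
    have c: "csqrt (8 * complex_of_real pi) = of_real (sqrt (8 * pi))"
      by simp
    have "(LINT y|lborel. ?g y * cis (- (s * y))) = (LINT y|lborel. (exp (- of_real (1/8) * of_real (y\<^sup>2)) * cis (- (s * y))) / of_real (sqrt (8 * pi)))"
      by (intro Bochner_Integration.integral_cong refl) (simp flip: exp_of_real)
    also have "\<dots> = (LINT y|lborel. (exp (- of_real (1/8) * of_real (y\<^sup>2)) * cis (- (s * y)))) / of_real (sqrt (8 * pi))"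
      by (rule integral_divide_zero)
    also have "\<dots> = csqrt (8 * pi) * exp (- of_real (2 * s\<^sup>2)) / of_real (sqrt (8 * pi))"
      by (subst gauss1_real) (auto simp: mult_ac)
    also have "\<dots> = complex_of_real (exp (- 2 * s\<^sup>2))"
      using c by (simp flip: exp_of_real)
    finally show ?thesis by simp
  qed
  let ?E = "\<lambda>\<xi>::'a. exp (- \<zeta> * of_real ((norm \<xi>)\<^sup>2)) * cis (- (0 \<bullet> \<xi>))"
  let ?h = "\<lambda>\<xi> y. ?E \<xi> * ?g y * cis (- ((z + y *\<^sub>R a) \<bullet> \<xi>))"
  have int: "integrable (lborel \<Otimes>\<^sub>M lborel) (\<lambda>(\<xi>, y). ?h \<xi> y)"
  proof -
    have 0: "integrable lborel (\<lambda>(\<xi>, y). ?E \<xi> * ?g y)"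
      using integrable_pair_mult[OF integrable_gaussN[OF \<zeta>, of 0] gi] unfolding lborel_prod .
    have "(\<lambda>x::'a\<times>real. - ((z + snd x *\<^sub>R a) \<bullet> fst x)) \<in> borel_measurable borel"
      by (intro borel_measurable_continuous_onI continuous_intros)
    from integrable_mult_cis[OF 0 this] show ?thesis
      unfolding lborel_prod by (simp add: case_prod_beta')
  qed
  have in1: "(LINT y|lborel. ?h \<xi> y) = anisotropic_gauss \<zeta> a \<xi> * cis (- (\<xi> \<bullet> z))" for \<xi>
  proof -
    have cs: "cis (- ((z + y *\<^sub>R a) \<bullet> \<xi>)) = cis (- (\<xi> \<bullet> z)) * cis (- ((a \<bullet> \<xi>) * y))" for y
      by (simp add: cis_mult inner_add_left inner_commute[of a \<xi>] inner_commute[of z \<xi>] algebra_simps)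
    have "(LINT y|lborel. ?h \<xi> y) = (LINT y|lborel. (exp (- \<zeta> * of_real ((norm \<xi>)\<^sup>2)) * cis (- (\<xi> \<bullet> z))) * (?g y * cis (- ((a \<bullet> \<xi>) * y))))"
      by (intro Bochner_Integration.integral_cong refl)
        (simp add: cs mult_ac)
    thus ?thesis by (simp only: integral_mult_right_zero e[symmetric]) (simp add: mult_ac)
  qed
  have in2: "(LINT \<xi>|lborel. ?h \<xi> y) = csqrt (pi / \<zeta>) ^ DIM('a) * (?g y * exp (- of_real ((norm (z + y *\<^sub>R a))\<^sup>2) / (4 * \<zeta>)))" for y
  proof -
    have "(LINT \<xi>|lborel. ?h \<xi> y) = (LINT \<xi>|lborel. ?g y * (exp (- \<zeta> * of_real ((norm \<xi>)\<^sup>2)) * cis (- ((z + y *\<^sub>R a) \<bullet> \<xi>))))"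
      by (intro Bochner_Integration.integral_cong refl) (simp add: mult_ac)
    thus ?thesis by (simp only: integral_mult_right_zero integral_gaussN[OF \<zeta>]) (simp add: mult_ac)
  qed
  show ?thesis
    using lborel_pair.Fubini_integral[OF int] unfolding in1 in2 fourier_def by simp
qed

text \<open>With s = a \<bullet> z, the square of the norm of z + y * a splits into ?q \<ge> 0,
  which contributes a factor of modulus at most 1, and (s + y)^2. What remains of the y-integral,
  together with one factor csqrt (pi / \<zeta>), is the same transform on the real line at s. That
  one is bounded by the integral of exp (- 2 * x^2), independently of \<zeta>. Only d - 1 factors
  are left to decay.\<close>

lemma norm_fourier_anisotropic_gauss:
  fixes a z :: "'a::euclidean_space" and \<zeta> :: complex assumes \<zeta>: "Re \<zeta> > 0" and a: "norm a = 1"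
  shows "norm (fourier (anisotropic_gauss \<zeta> a) z) \<le> sqrt (pi / norm \<zeta>) ^ (DIM('a) - 1) * sqrt (pi / 2)"
proof -
  define s where "s = a \<bullet> z"
  let ?\<kappa> = "csqrt (pi / \<zeta>)"
  let ?g = "\<lambda>y::real. complex_of_real (exp (- (y\<^sup>2 / 8)) / sqrt (8 * pi))"
  let ?q = "(norm z)\<^sup>2 - s\<^sup>2"
  have q: "?q \<ge> 0"
    using Cauchy_Schwarz_ineq2[of a z] a power_mono[of "\<bar>s\<bar>" "norm z" 2] by (auto simp: s_def)
  have n: "(norm (z + y *\<^sub>R a))\<^sup>2 = ?q + (norm (s + y *\<^sub>R 1))\<^sup>2" for y :: real
  proof -
    have "a \<bullet> a = 1" using a by (simp add: norm_eq_1)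
    thus ?thesis
      by (simp add: power2_norm_eq_inner inner_add_left inner_add_right s_def inner_commute)
        (simp add: power2_eq_square algebra_simps)
  qed
  have "fourier (anisotropic_gauss \<zeta> a) z = ?\<kappa> ^ DIM('a) *
    (LINT y|lborel. exp (- of_real ?q / (4 * \<zeta>)) * (?g y * exp (- of_real ((norm (s + y *\<^sub>R 1))\<^sup>2) / (4 * \<zeta>))))"
    unfolding fourier_anisotropic_gauss[OF \<zeta>] n
    by (intro arg_cong[where f = "\<lambda>I. ?\<kappa> ^ DIM('a) * I"] refl Bochner_Integration.integral_cong)
      (simp only: of_real_add minus_add_distrib add_divide_distrib exp_add mult_ac)
  \<comment> \<open>The formula of \<open>fourier_anisotropic_gauss\<close> is read backwards in
    dimension 1, where it absorbs one factor \<open>?\<kappa>\<close>.\<close>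
  also have "\<dots> = ?\<kappa> ^ (DIM('a) - 1) * exp (- of_real ?q / (4 * \<zeta>)) * fourier (anisotropic_gauss \<zeta> 1) s"
    unfolding fourier_anisotropic_gauss[OF \<zeta>] integral_mult_right_zero
    using DIM_positive[where 'a='a] power_minus_mult[of "DIM('a)" ?\<kappa>] by simp
  finally have E: "norm (fourier (anisotropic_gauss \<zeta> a) z)
    = norm ?\<kappa> ^ (DIM('a) - 1) * norm (exp (- of_real ?q / (4 * \<zeta>))) * norm (fourier (anisotropic_gauss \<zeta> 1) s)"
    by (simp only: norm_mult norm_power)
  have k1: "norm ?\<kappa> = sqrt (pi / norm \<zeta>)" by (simp add: norm_divide)
  have k2: "norm (exp (- of_real ?q / (4 * \<zeta>))) \<le> 1"
  proof -
    have "Re (of_real ?q / (4 * \<zeta>)) \<ge> 0"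
      using q \<zeta> by (subst Re_complex_div_ge_0) auto
    thus ?thesis
      by (simp only: norm_exp_eq_Re minus_divide_left[symmetric] uminus_complex.sel) simp
  qed
  have k3: "norm (fourier (anisotropic_gauss \<zeta> 1) s) \<le> sqrt (pi / 2)"
  proof -
    have "norm (fourier (anisotropic_gauss \<zeta> 1) s) \<le> (LINT x::real|lborel. exp (- 2 * x\<^sup>2))"
      unfolding fourier_def
    proof (rule Bochner_Integration.integral_norm_bound_integral)
      show "integrable lborel (\<lambda>x. anisotropic_gauss \<zeta> 1 x * cis (- (x \<bullet> s)))"
        by (intro integrable_mult_cis integrable_anisotropic_gauss \<zeta>) auto
      show "integrable lborel (\<lambda>x::real. exp (- 2 * x\<^sup>2))" by (rule integrable_gaussian_real) simp
      show "norm (anisotropic_gauss \<zeta> 1 x * cis (- (x \<bullet> s))) \<le> exp (- 2 * x\<^sup>2)" for x :: real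
        using \<zeta> by (simp add: norm_mult mult_left_le_one_le)
    qed
    thus ?thesis using integral_gaussian_real[of 2] by simp
  qed
  have "sqrt (pi / norm \<zeta>) ^ (DIM('a) - 1) * norm (exp (- of_real ?q / (4 * \<zeta>))) * norm (fourier (anisotropic_gauss \<zeta> 1) s)
    \<le> sqrt (pi / norm \<zeta>) ^ (DIM('a) - 1) * 1 * sqrt (pi / 2)"
    by (intro mult_mono mult_nonneg_nonneg k2 k3 order_refl) auto
  thus ?thesis unfolding E k1 by simp
qed

section \<open>Square-integrable functions\<close>

lemma borel_measurable_cnj [measurable (raw)]:
  "f \<in> borel_measurable M \<Longrightarrow> (\<lambda>x. cnj (f x)) \<in> borel_measurable M"
  by (rule measurable_compose[of f M borel cnj]) (auto intro!: borel_measurable_continuous_onI continuous_intros)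

lemma L2_iff: "f \<in> L2 \<longleftrightarrow> f \<in> borel_measurable borel \<and> integrable lborel (\<lambda>x. (cmod (f x))\<^sup>2)"
proof -
  have "integrable lborel (\<lambda>x. (cmod (f x))\<^sup>2) \<longleftrightarrow> (\<integral>\<^sup>+ x. ennreal ((cmod (f x))\<^sup>2) \<partial>lborel) < \<infinity>" if "f \<in> borel_measurable borel"
    using that by (subst integrable_iff_bounded) auto
  thus ?thesis by (auto simp: L2_def)
qed

lemma L2_measurable: "f \<in> L2 \<Longrightarrow> f \<in> borel_measurable borel"
  and L2_integrable: "f \<in> L2 \<Longrightarrow> integrable lborel (\<lambda>x. (cmod (f x))\<^sup>2)"
  by (auto simp: L2_iff)

lemma L2_bound:
  assumes "g \<in> L2" "f \<in> borel_measurable borel" "\<And>x. cmod (f x) \<le> B * cmod (g x)"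
  shows "f \<in> L2"
proof -
  note [measurable] = assms(2)
  have "integrable lborel (\<lambda>x. (cmod (f x))\<^sup>2)"
  proof (rule Bochner_Integration.integrable_bound)
    show "integrable lborel (\<lambda>x. B\<^sup>2 * (cmod (g x))\<^sup>2)" using L2_integrable[OF assms(1)] by simp
    show "AE x in lborel. norm ((cmod (f x))\<^sup>2) \<le> norm (B\<^sup>2 * (cmod (g x))\<^sup>2)"
      using power_mono[OF assms(3) norm_ge_zero, of _ 2] by (intro AE_I2) (simp add: power_mult_distrib)
  qed measurable
  thus ?thesis using assms(2) by (simp add: L2_iff)
qed

definition ip :: "('a::euclidean_space \<Rightarrow> complex) \<Rightarrow> ('a \<Rightarrow> complex) \<Rightarrow> complex" where
  "ip f g = (LINT x|lborel. f x * cnj (g x))"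

definition nsq :: "('a::euclidean_space \<Rightarrow> complex) \<Rightarrow> real" where
  "nsq f = (LINT x|lborel. (cmod (f x))\<^sup>2)"

lemma nsq_nonneg [simp]: "nsq f \<ge> 0" by (simp add: nsq_def)

lemma ip_self: "ip f f = of_real (nsq f)"
  unfolding ip_def nsq_def integral_complex_of_real[symmetric] complex_norm_square ..

lemma integrable_ip:
  assumes "f \<in> L2" "g \<in> L2"
  shows "integrable lborel (\<lambda>x. f x * cnj (g x))"
proof (rule Bochner_Integration.integrable_bound)
  show "integrable lborel (\<lambda>x. (cmod (f x))\<^sup>2 + (cmod (g x))\<^sup>2)" using assms by (auto simp: L2_iff)
  have "f \<in> borel_measurable borel" "g \<in> borel_measurable borel" using assms by (auto simp: L2_iff)
  thus "(\<lambda>x. f x * cnj (g x)) \<in> borel_measurable lborel" by measurable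
  have "a * b \<le> a\<^sup>2 + b\<^sup>2" if "a \<ge> 0" "b \<ge> 0" for a b :: real
    using sum_squares_bound[of a b] that mult_nonneg_nonneg[of a b] by linarith
  thus "AE x in lborel. norm (f x * cnj (g x)) \<le> norm ((cmod (f x))\<^sup>2 + (cmod (g x))\<^sup>2)"
    by (intro AE_I2) (simp add: norm_mult)
qed

lemma L2_add: assumes "f \<in> L2" "g \<in> L2" shows "(\<lambda>x. f x + g x) \<in> L2"
proof -
  have [measurable]: "f \<in> borel_measurable borel" "g \<in> borel_measurable borel" using assms by (auto simp: L2_iff)
  have "integrable lborel (\<lambda>x. (cmod (f x + g x))\<^sup>2)"
  proof (rule Bochner_Integration.integrable_bound)
    show "integrable lborel (\<lambda>x. 2 * (cmod (f x))\<^sup>2 + 2 * (cmod (g x))\<^sup>2)" using assms by (auto simp: L2_iff)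
    have "(cmod (a + b))\<^sup>2 \<le> 2 * (cmod a)\<^sup>2 + 2 * (cmod b)\<^sup>2" for a b
      using power_mono[OF norm_triangle_ineq[of a b], of 2] sum_squares_bound[of "cmod a" "cmod b"]
      by (simp add: power2_sum)
    thus "AE x in lborel. norm ((cmod (f x + g x))\<^sup>2) \<le> norm (2 * (cmod (f x))\<^sup>2 + 2 * (cmod (g x))\<^sup>2)"
      by (intro AE_I2) simp
  qed measurable
  thus ?thesis by (simp add: L2_iff)
qed

lemma L2_cmult: assumes "f \<in> L2" shows "(\<lambda>x. c * f x) \<in> L2"
proof (rule L2_bound[where g = f and B = "cmod c"])
  note [measurable] = L2_measurable[OF assms]
  show "(\<lambda>x. c * f x) \<in> borel_measurable borel" by measurable
qed (use assms in \<open>simp_all add: norm_mult\<close>)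

lemma L2_diff: assumes "f \<in> L2" "g \<in> L2" shows "(\<lambda>x. f x - g x) \<in> L2"
  using L2_add[OF assms(1) L2_cmult[OF assms(2), of "-1"]] by simp

lemma L2_zero [simp]: "(\<lambda>x. 0) \<in> L2" by (simp add: L2_iff)

lemma L2_sum: "(\<And>i. i \<in> I \<Longrightarrow> f i \<in> L2) \<Longrightarrow> (\<lambda>x. \<Sum>i\<in>I. f i x) \<in> L2"
  by (induction I rule: infinite_finite_induct) (auto intro: L2_add)

lemma nsq_add_le: assumes "f \<in> L2" "g \<in> L2" shows "nsq (\<lambda>x. f x + g x) \<le> 2 * nsq f + 2 * nsq g"
proof -
  have "(cmod (a + b))\<^sup>2 \<le> 2 * (cmod a)\<^sup>2 + 2 * (cmod b)\<^sup>2" for a b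
    using power_mono[OF norm_triangle_ineq[of a b], of 2] sum_squares_bound[of "cmod a" "cmod b"]
    by (simp add: power2_sum)
  hence "nsq (\<lambda>x. f x + g x) \<le> (LINT x|lborel. 2 * (cmod (f x))\<^sup>2 + 2 * (cmod (g x))\<^sup>2)"
    unfolding nsq_def using assms by (intro integral_mono L2_integrable L2_add) (auto simp: L2_iff)
  thus ?thesis using assms by (simp add: nsq_def L2_iff)
qed

lemma nsq_cmult: "nsq (\<lambda>x. c * f x) = (cmod c)\<^sup>2 * nsq f"
  by (simp add: nsq_def norm_mult power_mult_distrib)

lemma nsq_bound:
  assumes "g \<in> L2" "f \<in> borel_measurable borel" "\<And>x. cmod (f x) \<le> B * cmod (g x)"
  shows "nsq f \<le> B\<^sup>2 * nsq g"
proof -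
  have "nsq f \<le> (LINT x|lborel. B\<^sup>2 * (cmod (g x))\<^sup>2)" unfolding nsq_def
    using L2_integrable[OF L2_bound[OF assms]] L2_integrable[OF assms(1)] power_mono[OF assms(3) norm_ge_zero, of _ 2]
    by (intro integral_mono) (auto simp: power_mult_distrib)
  thus ?thesis by (simp add: nsq_def)
qed

lemma ip_commute: "ip g f = cnj (ip f g)"
  unfolding ip_def by (subst Bochner_Integration.integral_cnj[symmetric]) (simp add: mult.commute)

lemma ip_cmult_left: "ip (\<lambda>x. c * f x) g = c * ip f g"
  by (simp add: ip_def mult.assoc)

lemma ip_cmult_right: "ip f (\<lambda>x. c * g x) = cnj c * ip f g"
  by (simp add: ip_def mult.left_commute)

lemma ip_zero [simp]: "ip (\<lambda>x. 0) g = 0" "ip f (\<lambda>x. 0) = 0" by (simp_all add: ip_def)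

lemma ip_add_left: "f \<in> L2 \<Longrightarrow> g \<in> L2 \<Longrightarrow> h \<in> L2 \<Longrightarrow> ip (\<lambda>x. f x + g x) h = ip f h + ip g h"
  by (simp add: ip_def integrable_ip distrib_right Bochner_Integration.integral_add)

lemma ip_add_right: "f \<in> L2 \<Longrightarrow> g \<in> L2 \<Longrightarrow> h \<in> L2 \<Longrightarrow> ip f (\<lambda>x. g x + h x) = ip f g + ip f h"
  by (simp add: ip_def integrable_ip distrib_left Bochner_Integration.integral_add)

lemma ip_diff_right: "f \<in> L2 \<Longrightarrow> g \<in> L2 \<Longrightarrow> h \<in> L2 \<Longrightarrow> ip f (\<lambda>x. g x - h x) = ip f g - ip f h"
  by (simp add: ip_def integrable_ip right_diff_distrib)

lemma ip_sum_left:
  assumes "\<And>i. i \<in> I \<Longrightarrow> f i \<in> L2" "g \<in> L2"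
  shows "ip (\<lambda>x. \<Sum>i\<in>I. f i x) g = (\<Sum>i\<in>I. ip (f i) g)"
  unfolding ip_def sum_distrib_right using assms by (intro Bochner_Integration.integral_sum integrable_ip)

lemma ip_sum_right:
  assumes "\<And>i. i \<in> I \<Longrightarrow> f i \<in> L2" "g \<in> L2"
  shows "ip g (\<lambda>x. \<Sum>i\<in>I. f i x) = (\<Sum>i\<in>I. ip g (f i))"
  by (subst ip_commute, subst ip_sum_left) (auto simp: assms ip_commute[of g] cnj_sum)

text \<open>Expand the nonnegative \<open>nsq\<close> of f - s * ip f g * g for real s. The
  minimiser s = 1 / nsq g gives the claim; if nsq g = 0, the resulting inequality is linear in s and
  fails for large s unless ip f g = 0.\<close>

lemma ip_Cauchy_Schwarz:
  assumes f: "f \<in> L2" and g: "g \<in> L2"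
  shows "cmod (ip f g) \<le> sqrt (nsq f) * sqrt (nsq g)"
proof -
  let ?z = "ip f g"
  have *: "2 * s * (cmod ?z)\<^sup>2 \<le> nsq f + s\<^sup>2 * (cmod ?z)\<^sup>2 * nsq g" for s :: real
  proof -
    define c where "c = - of_real s * ?z"
    have "0 \<le> Re (ip (\<lambda>x. f x + c * g x) (\<lambda>x. f x + c * g x))"
      by (simp add: ip_self)
    also have "ip (\<lambda>x. f x + c * g x) (\<lambda>x. f x + c * g x) = ip f f + cnj c * ip f g + c * ip g f + c * cnj c * ip g g"
      using f g by (simp add: ip_add_left ip_add_right L2_add L2_cmult ip_cmult_left ip_cmult_right algebra_simps)
    also have "\<dots> = of_real (nsq f) - of_real (2 * s) * (?z * cnj ?z) + of_real (s\<^sup>2) * (?z * cnj ?z) * of_real (nsq g)"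
      by (simp add: c_def ip_self ip_commute[of g f] power2_eq_square algebra_simps)
    also have "\<dots> = of_real (nsq f - 2 * s * (cmod ?z)\<^sup>2 + s\<^sup>2 * (cmod ?z)\<^sup>2 * nsq g)"
      by (simp only: complex_norm_square[symmetric] of_real_add of_real_diff of_real_mult)
    finally show ?thesis by simp
  qed
  have "(cmod ?z)\<^sup>2 \<le> nsq f * nsq g"
  proof (cases "?z = 0")
    case False
    define Z where "Z = (cmod ?z)\<^sup>2"
    have Z: "Z > 0" using False by (simp add: Z_def)
    have g0: "nsq g > 0"
    proof (rule ccontr)
      assume "\<not> nsq g > 0"
      hence "nsq g = 0" using nsq_nonneg[of g] by linarith
      thus False using *[of "(nsq f + 1) / (2 * Z)"] Z by (simp add: Z_def[symmetric])
    qed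
    show ?thesis using *[of "1 / nsq g"] g0 by (simp add: field_simps power2_eq_square)
  qed simp
  thus ?thesis by (metis real_sqrt_le_iff real_sqrt_mult real_sqrt_abs abs_norm_cancel)
qed

lemma nsq_sum:
  assumes "\<And>i. i \<in> I \<Longrightarrow> f i \<in> L2"
  shows "nsq (\<lambda>x. \<Sum>i\<in>I. f i x) = Re (\<Sum>i\<in>I. \<Sum>j\<in>I. ip (f i) (f j))"
proof -
  have "complex_of_real (nsq (\<lambda>x. \<Sum>i\<in>I. f i x)) = (\<Sum>i\<in>I. \<Sum>j\<in>I. ip (f i) (f j))"
    unfolding ip_self[symmetric] using assms by (simp add: ip_sum_left ip_sum_right L2_sum)
  thus ?thesis by (metis Re_complex_of_real)
qed

lemma nsq_triangle:
  assumes f: "f \<in> L2" and g: "g \<in> L2" shows "sqrt (nsq (\<lambda>x. f x + g x)) \<le> sqrt (nsq f) + sqrt (nsq g)"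
proof -
  have "complex_of_real (nsq (\<lambda>x. f x + g x)) = ip f f + ip f g + cnj (ip f g) + ip g g"
    unfolding ip_self[symmetric]
    using f g by (simp add: ip_add_left ip_add_right L2_add ip_commute[of g f])
  hence "nsq (\<lambda>x. f x + g x) = Re (ip f f + ip f g + cnj (ip f g) + ip g g)"
    by (metis Re_complex_of_real)
  also have "\<dots> \<le> nsq f + 2 * cmod (ip f g) + nsq g"
    using complex_Re_le_cmod[of "ip f g"] by (simp add: ip_self)
  also have "\<dots> \<le> (sqrt (nsq f) + sqrt (nsq g))\<^sup>2"
    using ip_Cauchy_Schwarz[OF f g] by (simp add: power2_sum)
  finally show ?thesis by (intro real_le_lsqrt) auto
qed

section \<open>Continuity of translations\<close>

lemma lborel_integral_translation:
  fixes F :: "'a::euclidean_space \<Rightarrow> 'b::{banach,second_countable_topology}"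
  assumes "F \<in> borel_measurable borel"
  shows "integrable lborel (\<lambda>x. F (w + x)) \<longleftrightarrow> integrable lborel F"
    and "(LINT x|lborel. F (w + x)) = (LINT x|lborel. F x)"
proof -
  have w: "(+) w \<in> lborel \<rightarrow>\<^sub>M borel" by measurable
  show "integrable lborel (\<lambda>x. F (w + x)) \<longleftrightarrow> integrable lborel F"
    using integrable_distr_eq[OF w assms] by (simp add: lborel_distr_plus)
  show "(LINT x|lborel. F (w + x)) = (LINT x|lborel. F x)"
    using integral_distr[OF w assms] by (simp add: lborel_distr_plus)
qed

lemma integrable_indicator_complex:
  assumes "A \<in> sets borel" "emeasure lborel A < \<infinity>"
  shows "integrable lborel (indicator A :: 'a::euclidean_space \<Rightarrow> complex)"
proof -
  have "integrable lborel (indicat_real A)" using assms by auto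
  from integrable_scaleR_left[OF this, of "1 :: complex"]
  show ?thesis by (rule back_subst[of "integrable lborel"]) (auto simp: indicator_def)
qed

text \<open>The L1 modulus of continuity. Its decay at 0 is proved in order to obtain the analogous
  L2 statement, on which the Plancherel theorem below rests.\<close>

definition L1_shift :: "('a::euclidean_space \<Rightarrow> complex) \<Rightarrow> 'a \<Rightarrow> real" where
  "L1_shift F w = (LINT x|lborel. cmod (F (w + x) - F x))"

lemma integrable_shift_diff:
  fixes F :: "'a::euclidean_space \<Rightarrow> complex"
  assumes F: "integrable lborel F" shows "integrable lborel (\<lambda>x. F (w + x) - F x)"
  using F lborel_integral_translation(1)[of F w] by (auto dest: borel_measurable_integrable)

lemma L1_shift_diff_le:
  fixes F G :: "'a::euclidean_space \<Rightarrow> complex"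
  assumes F: "integrable lborel F" and G: "integrable lborel G"
  shows "L1_shift F w \<le> 2 * (LINT x|lborel. cmod (F x - G x)) + L1_shift G w"
proof -
  let ?D = "\<lambda>x. cmod (F x - G x)"
  have D: "integrable lborel ?D" using F G by auto
  hence Dm: "?D \<in> borel_measurable borel" by (auto dest: borel_measurable_integrable)
  have Dw: "integrable lborel (\<lambda>x. ?D (w + x))" "(LINT x|lborel. ?D (w + x)) = (LINT x|lborel. ?D x)"
    using D lborel_integral_translation[OF Dm, of w] by auto
  have Gs: "integrable lborel (\<lambda>x. cmod (G (w + x) - G x))" and Fs: "integrable lborel (\<lambda>x. cmod (F (w + x) - F x))"
    using integrable_shift_diff[OF F] integrable_shift_diff[OF G] by auto
  have "L1_shift F w \<le> (LINT x|lborel. ?D (w + x) + ?D x + cmod (G (w + x) - G x))"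
    unfolding L1_shift_def
  proof (rule integral_mono[OF Fs])
    show "integrable lborel (\<lambda>x. ?D (w + x) + ?D x + cmod (G (w + x) - G x))"
      using Dw(1) D Gs by auto
    show "cmod (F (w + x) - F x) \<le> ?D (w + x) + ?D x + cmod (G (w + x) - G x)" for x
      using norm_triangle_ineq4[of "F (w+x) - G (w+x)" "F x - G x"]
        norm_triangle_ineq[of "(F (w+x) - G (w+x)) - (F x - G x)" "G (w+x) - G x"]
      by (simp add: algebra_simps)
  qed
  also have "\<dots> = 2 * (LINT x|lborel. ?D x) + L1_shift G w"
    using Dw D Gs by (simp add: L1_shift_def)
  finally show ?thesis .
qed

text \<open>By \<open>L1_shift_diff_le\<close>, the functions whose modulus vanishes along w form an
  L1-closed class: an L1 error below e / 4 costs at most e / 2.\<close>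

lemma L1_shift_approx:
  fixes F :: "'a::euclidean_space \<Rightarrow> complex" and w :: "nat \<Rightarrow> 'a"
  assumes F: "integrable lborel F"
    and ap: "\<And>e. e > 0 \<Longrightarrow> \<exists>G. integrable lborel G \<and> (\<lambda>n. L1_shift G (w n)) \<longlonglongrightarrow> 0 \<and> (LINT x|lborel. cmod (F x - G x)) < e"
  shows "(\<lambda>n. L1_shift F (w n)) \<longlonglongrightarrow> 0"
proof (rule LIMSEQ_I)
  fix e :: real assume "e > 0"
  hence "e / 4 > 0" by simp
  from ap[OF this] obtain G where G: "integrable lborel G" "(\<lambda>n. L1_shift G (w n)) \<longlonglongrightarrow> 0" "(LINT x|lborel. cmod (F x - G x)) < e / 4"
    by blast
  have "\<forall>\<^sub>F n in sequentially. L1_shift G (w n) < e / 2"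
    using G(2) \<open>e > 0\<close> by (intro order_tendstoD) auto
  hence "\<forall>\<^sub>F n in sequentially. norm (L1_shift F (w n) - 0) < e"
  proof eventually_elim
    case (elim n)
    have "L1_shift F (w n) \<ge> 0" by (simp add: L1_shift_def)
    thus ?case using L1_shift_diff_le[OF F G(1), of "w n"] G(3) elim by simp
  qed
  thus "\<exists>no. \<forall>n\<ge>no. norm (L1_shift F (w n) - 0) < e" by (simp add: eventually_sequentially)
qed

text \<open>Translation preserves the integral of the indicator, so its gains and losses have equal
  mass and it suffices to control the points of U that are moved out of U. For open U each point
  eventually stays inside, and dominated convergence applies.\<close>

lemma L1_shift_open:
  fixes U :: "'a::euclidean_space set" and w :: "nat \<Rightarrow> 'a"
  assumes U: "open U" "emeasure lborel U < \<infinity>" and w: "w \<longlonglongrightarrow> 0"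
  shows "(\<lambda>n. L1_shift (indicator U) (w n)) \<longlonglongrightarrow> 0"
proof -
  let ?I = "indicator U :: 'a \<Rightarrow> real"
  have Us: "U \<in> sets borel" using U by auto
  have I: "integrable lborel ?I" using U Us by auto
  have Im: "?I \<in> borel_measurable borel" using Us by auto
  note Iw = lborel_integral_translation[OF Im]
  have eq: "L1_shift (indicator U) v = (LINT x|lborel. 2 * max 0 (?I x - ?I (v + x)))" for v
  proof -
    have a: "\<bar>?I (v + x) - ?I x\<bar> = 2 * max 0 (?I x - ?I (v + x)) + (?I (v + x) - ?I x)" for x by (auto simp: indicator_def)
    have "L1_shift (indicator U) v = (LINT x|lborel. \<bar>?I (v + x) - ?I x\<bar>)"
      unfolding L1_shift_def by (intro Bochner_Integration.integral_cong refl) (auto simp: indicator_def)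
    also have "\<dots> = (LINT x|lborel. 2 * max 0 (?I x - ?I (v + x))) + (LINT x|lborel. (?I (v + x) - ?I x))"
      unfolding a using I Iw(1)[of v] by (intro Bochner_Integration.integral_add) auto
    also have "(LINT x|lborel. (?I (v + x) - ?I x)) = 0"
      using I Iw[of v] by (subst Bochner_Integration.integral_diff) auto
    finally show ?thesis by simp
  qed
  have "(\<lambda>n. LINT x|lborel. 2 * max 0 (?I x - ?I (w n + x))) \<longlonglongrightarrow> (LINT x::'a|lborel. 0)"
  proof (rule integral_dominated_convergence[where w = "\<lambda>x. 2 * ?I x"])
    show "AE x in lborel. (\<lambda>n. 2 * max 0 (?I x - ?I (w n + x))) \<longlonglongrightarrow> 0"
    proof (rule AE_I2)
      fix x
      show "(\<lambda>n. 2 * max 0 (?I x - ?I (w n + x))) \<longlonglongrightarrow> 0"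
      proof (cases "x \<in> U")
        case True
        have "(\<lambda>n. w n + x) \<longlonglongrightarrow> 0 + x" by (intro tendsto_intros w)
        hence "\<forall>\<^sub>F n in sequentially. w n + x \<in> U" using U(1) True by (auto elim: topological_tendstoD)
        hence "\<forall>\<^sub>F n in sequentially. 2 * max 0 (?I x - ?I (w n + x)) = 0" by eventually_elim (use True in auto)
        thus ?thesis by (rule tendsto_eventually)
      qed auto
    qed
    show "(\<lambda>x. 2 * max 0 (?I x - ?I (w i + x))) \<in> borel_measurable lborel" for i
      using Im by measurable
    show "AE x in lborel. norm (2 * max 0 (?I x - ?I (w i + x))) \<le> 2 * ?I x" for i
      by (intro AE_I2) (auto simp: indicator_def)
  qed (use I in auto)
  thus ?thesis by (simp add: eq)
qed

text \<open>Induction over integrable functions. Indicators of finite measure are approximated from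
  outside by open sets; sums and limits follow from the triangle inequality and
  \<open>L1_shift_approx\<close>.\<close>

lemma L1_shift_tendsto:
  fixes F :: "'a::euclidean_space \<Rightarrow> complex" and w :: "nat \<Rightarrow> 'a"
  assumes F: "integrable lborel F" and w: "w \<longlonglongrightarrow> 0"
  shows "(\<lambda>n. L1_shift F (w n)) \<longlonglongrightarrow> 0"
  using F
proof (induction rule: integrable_induct)
  case (base A c)
  have ind: "(\<lambda>n. L1_shift (indicator A) (w n)) \<longlonglongrightarrow> 0"
  proof (rule L1_shift_approx)
    show "complex_integrable lborel (indicator A)" using base by (intro integrable_indicator_complex) auto
    fix e :: real assume e: "e > 0"
    have "A \<in> sets lebesgue" using base by auto
    then obtain U where U: "open U" "A \<subseteq> U" "U - A \<in> lmeasurable" "emeasure lebesgue (U - A) < ennreal e"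
      using sets_lebesgue_outer_open[of A e] e by metis
    have Us: "U \<in> sets borel" "A \<in> sets borel" using U base by auto
    have UA: "emeasure lborel (U - A) < ennreal e" using U(4) Us by (subst (asm) emeasure_completion) auto
    have "A \<union> (U - A) = U" using U(2) by blast
    hence "emeasure lborel U \<le> emeasure lborel A + emeasure lborel (U - A)"
      using Us emeasure_subadditive[of A lborel "U - A"] by simp
    also have "\<dots> < \<infinity>" using UA base by (auto simp: ennreal_add_eq_top less_top[symmetric])
    finally have Uf: "emeasure lborel U < \<infinity>" .
    have "(LINT x|lborel. cmod (indicator A x - indicator U x)) = (LINT x|lborel. indicator (U - A) x)"
      using U(2) by (intro Bochner_Integration.integral_cong refl) (auto simp: indicator_def)
    also have "\<dots> = measure lborel (U - A)" by simp
    also have "\<dots> < e"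
    proof -
      have "emeasure lborel (U - A) \<noteq> top" using UA by auto
      hence "ennreal (measure lborel (U - A)) < ennreal e" using UA by (simp add: emeasure_eq_ennreal_measure)
      thus ?thesis by (simp add: ennreal_less_iff)
    qed
    finally show "\<exists>G. complex_integrable lborel G \<and> (\<lambda>n. L1_shift G (w n)) \<longlonglongrightarrow> 0 \<and> (LINT x|lborel. cmod (indicator A x - G x)) < e"
      using Us Uf U(1) L1_shift_open[OF U(1) Uf w] by (intro exI[of _ "indicator U"] conjI integrable_indicator_complex) auto
  qed
  have "L1_shift (\<lambda>x. indicator A x *\<^sub>R c) v = cmod c * L1_shift (indicator A) v" for v
  proof -
    have "cmod (indicator A (v + x) *\<^sub>R c - indicator A x *\<^sub>R c) = cmod c * cmod (indicator A (v + x) - indicator A x :: complex)" for x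
      by (auto simp: indicator_def)
    thus ?thesis by (simp add: L1_shift_def)
  qed
  thus ?case using tendsto_mult_right_zero[OF ind, of "cmod c"] by simp
next
  case (add f g)
  show ?case
  proof (rule tendsto_sandwich[OF _ _ tendsto_const])
    show "(\<lambda>n. L1_shift f (w n) + L1_shift g (w n)) \<longlonglongrightarrow> 0" using tendsto_add[OF add(3,4)] by simp
    have "L1_shift (\<lambda>x. f x + g x) v \<le> L1_shift f v + L1_shift g v" for v
    proof -
      have i: "integrable lborel (\<lambda>x. cmod (f (v + x) - f x))" "integrable lborel (\<lambda>x. cmod (g (v + x) - g x))"
        using integrable_shift_diff[OF add(1), of v] integrable_shift_diff[OF add(2), of v] by auto
      have "L1_shift (\<lambda>x. f x + g x) v \<le> (LINT x|lborel. cmod (f (v + x) - f x) + cmod (g (v + x) - g x))"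
        unfolding L1_shift_def
      proof (rule integral_mono)
        show "integrable lborel (\<lambda>x. cmod (f (v + x) + g (v + x) - (f x + g x)))"
          using integrable_shift_diff[of "\<lambda>x. f x + g x" v] add(1,2) by auto
        show "cmod (f (v + x) + g (v + x) - (f x + g x)) \<le> cmod (f (v + x) - f x) + cmod (g (v + x) - g x)" for x
          using norm_triangle_ineq[of "f (v + x) - f x" "g (v + x) - g x"] by (simp add: algebra_simps)
      qed (use i in auto)
      thus ?thesis using i by (simp add: L1_shift_def)
    qed
    thus "\<forall>\<^sub>F n in sequentially. L1_shift (\<lambda>x. f x + g x) (w n) \<le> L1_shift f (w n) + L1_shift g (w n)" by simp
  qed (simp add: L1_shift_def)
next
  case (lim f s)
  show ?case
  proof (rule L1_shift_approx[OF lim(4)])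
    fix e :: real assume e: "e > 0"
    have m: "f \<in> borel_measurable borel" "\<And>i. s i \<in> borel_measurable borel" using lim(1,4) by (auto dest: borel_measurable_integrable)
    have "(\<lambda>i. LINT x|lborel. cmod (f x - s i x)) \<longlonglongrightarrow> (LINT x::'a|lborel. 0)"
    proof (rule integral_dominated_convergence[where w = "\<lambda>x. 3 * cmod (f x)"])
      show "AE x in lborel. (\<lambda>i. cmod (f x - s i x)) \<longlonglongrightarrow> 0"
      proof (rule AE_I2)
        fix x
        have "(\<lambda>i. cmod (f x - s i x)) \<longlonglongrightarrow> cmod (f x - f x)" using lim(2)[of x] by (intro tendsto_intros) auto
        thus "(\<lambda>i. cmod (f x - s i x)) \<longlonglongrightarrow> 0" by simp
      qed
      show "AE x in lborel. norm (cmod (f x - s i x)) \<le> 3 * cmod (f x)" for i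
      proof (rule AE_I2)
        fix x
        show "norm (cmod (f x - s i x)) \<le> 3 * cmod (f x)" using lim(3)[of x i] norm_triangle_ineq4[of "f x" "s i x"] by simp
      qed
    qed (use m lim(4) in auto)
    hence "\<forall>\<^sub>F i in sequentially. (LINT x|lborel. cmod (f x - s i x)) < e" using e by (intro order_tendstoD) auto
    then obtain i where "(LINT x|lborel. cmod (f x - s i x)) < e" by (auto simp: eventually_sequentially)
    thus "\<exists>G. complex_integrable lborel G \<and> (\<lambda>n. L1_shift G (w n)) \<longlonglongrightarrow> 0 \<and> (LINT x|lborel. cmod (f x - G x)) < e"
      using lim(1,5) by blast
  qed
qed

lemma nsq_shift:
  fixes F :: "'a::euclidean_space \<Rightarrow> complex"
  assumes "F \<in> L2" shows "(\<lambda>x. F (w + x)) \<in> L2" "nsq (\<lambda>x. F (w + x)) = nsq F"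
proof -
  have m: "F \<in> borel_measurable borel" using assms by (simp add: L2_iff)
  hence m2: "(\<lambda>x. (cmod (F x))\<^sup>2) \<in> borel_measurable borel" by simp
  have "(\<lambda>x. F (w + x)) \<in> borel_measurable borel" using m by measurable
  thus "(\<lambda>x. F (w + x)) \<in> L2" "nsq (\<lambda>x. F (w + x)) = nsq F"
    using lborel_integral_translation[OF m2, of w] assms by (auto simp: L2_iff nsq_def)
qed

lemma L2_truncation_tendsto:
  fixes F :: "'a::euclidean_space \<Rightarrow> complex"
  assumes F: "F \<in> L2" and S: "\<And>n. S n \<in> sets borel" and ev: "\<And>x. \<forall>\<^sub>F n in sequentially. x \<in> S n"
  shows "(\<lambda>n. nsq (\<lambda>x. F x - indicator (S n) x * F x)) \<longlonglongrightarrow> 0"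
proof -
  have [measurable]: "F \<in> borel_measurable borel" using F by (simp add: L2_iff)
  have "(\<lambda>n. LINT x|lborel. (cmod (F x - indicator (S n) x * F x))\<^sup>2) \<longlonglongrightarrow> (LINT x::'a|lborel. 0)"
  proof (rule integral_dominated_convergence[where w = "\<lambda>x. (cmod (F x))\<^sup>2"])
    show "AE x in lborel. (\<lambda>n. (cmod (F x - indicator (S n) x * F x))\<^sup>2) \<longlonglongrightarrow> 0"
    proof (rule AE_I2)
      fix x
      have "\<forall>\<^sub>F n in sequentially. (cmod (F x - indicator (S n) x * F x))\<^sup>2 = 0"
        using ev[of x] by eventually_elim auto
      thus "(\<lambda>n. (cmod (F x - indicator (S n) x * F x))\<^sup>2) \<longlonglongrightarrow> 0" by (rule tendsto_eventually)
    qed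
    show "(\<lambda>x. (cmod (F x - indicator (S n) x * F x))\<^sup>2) \<in> borel_measurable lborel" for n using S[of n] by simp
    show "AE x in lborel. norm ((cmod (F x - indicator (S n) x * F x))\<^sup>2) \<le> (cmod (F x))\<^sup>2" for n
      by (intro AE_I2) (auto simp: indicator_def)
  qed (use F in \<open>auto simp: L2_iff\<close>)
  thus ?thesis by (simp add: nsq_def)
qed

text \<open>Truncating F in space and in height leaves an integrable G bounded by N, and for such G
  the squared increment is at most 2 * N times the increment, so L1 continuity is enough.\<close>

lemma nsq_shift_tendsto:
  fixes F :: "'a::euclidean_space \<Rightarrow> complex" and w :: "nat \<Rightarrow> 'a"
  assumes F: "F \<in> L2" and w: "w \<longlonglongrightarrow> 0"
  shows "(\<lambda>n. nsq (\<lambda>x. F (w n + x) - F x)) \<longlonglongrightarrow> 0"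
proof (rule LIMSEQ_I)
  fix e :: real assume e: "e > 0"
  have [measurable]: "F \<in> borel_measurable borel" using F by (simp add: L2_iff)
  define S where "S N = {x. norm x \<le> real N \<and> cmod (F x) \<le> real N}" for N :: nat
  have S: "S N \<in> sets borel" for N unfolding S_def by measurable
  have "\<forall>\<^sub>F n in sequentially. x \<in> S n" for x
  proof -
    have "\<forall>\<^sub>F n in sequentially. real n \<ge> max (norm x) (cmod (F x))"
      by (rule filterlim_at_top[THEN iffD1, rule_format, OF filterlim_real_sequentially])
    thus ?thesis by eventually_elim (auto simp: S_def)
  qed
  from L2_truncation_tendsto[OF F S this]
  have "\<forall>\<^sub>F N in sequentially. nsq (\<lambda>x. F x - indicator (S N) x * F x) < e / 16" using e by (intro order_tendstoD) auto
  then obtain N where N: "nsq (\<lambda>x. F x - indicator (S N) x * F x) < e / 16" by (auto simp: eventually_sequentially)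
  define G where "G x = indicator (S N) x * F x" for x
  have Gm[measurable]: "G \<in> borel_measurable borel" unfolding G_def using S[of N] by measurable
  have GL2: "G \<in> L2" using F by (rule L2_bound[where B = 1]) (auto simp: G_def indicator_def)
  have Gi: "integrable lborel G"
  proof (rule Bochner_Integration.integrable_bound)
    show "integrable lborel (\<lambda>x::'a. real N * indicator (cball 0 (real N)) x)"
      by (intro integrable_mult_right integrable_real_indicator emeasure_bounded_finite) auto
    show "AE x in lborel. cmod (G x) \<le> norm (real N * indicator (cball 0 (real N)) x)"
      by (intro AE_I2) (auto simp: G_def S_def indicator_def)
  qed simp
  have GN: "cmod (G x) \<le> real N" for x by (auto simp: G_def S_def indicator_def)
  have D: "(\<lambda>x. F x - G x) \<in> L2" by (rule L2_diff[OF F GL2])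
  \<comment> \<open>Two uses of \<open>nsq_add_le\<close> multiply the truncation error by 8, which
    is why it was taken below e / 16.\<close>
  have b: "nsq (\<lambda>x. F (v + x) - F x) \<le> e / 2 + 4 * (real N * L1_shift G v)" for v
  proof -
    have Ds: "(\<lambda>x. F (v + x) - G (v + x)) \<in> L2" "nsq (\<lambda>x. F (v + x) - G (v + x)) = nsq (\<lambda>x. F x - G x)"
      using nsq_shift[OF D, of v] by auto
    have Gs: "(\<lambda>x. G (v + x) - G x) \<in> L2" by (intro L2_diff nsq_shift GL2)
    have D': "(\<lambda>x. -1 * (F x - G x)) \<in> L2" by (intro L2_cmult D)
    have "nsq (\<lambda>x. F (v + x) - F x) = nsq (\<lambda>x. ((F (v + x) - G (v + x)) + -1 * (F x - G x)) + (G (v + x) - G x))"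
      by (simp add: algebra_simps)
    also have "\<dots> \<le> 2 * nsq (\<lambda>x. (F (v + x) - G (v + x)) + -1 * (F x - G x)) + 2 * nsq (\<lambda>x. G (v + x) - G x)"
      by (intro nsq_add_le L2_add Ds D' Gs)
    also have "nsq (\<lambda>x. (F (v + x) - G (v + x)) + -1 * (F x - G x)) \<le> 2 * nsq (\<lambda>x. F (v + x) - G (v + x)) + 2 * nsq (\<lambda>x. -1 * (F x - G x))"
      by (intro nsq_add_le Ds D')
    also have "nsq (\<lambda>x. -1 * (F x - G x)) = nsq (\<lambda>x. F x - G x)" by (subst nsq_cmult) simp
    also have "nsq (\<lambda>x. G (v + x) - G x) \<le> (LINT x|lborel. (2 * real N) * cmod (G (v + x) - G x))"
      unfolding nsq_def
    proof (rule integral_mono)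
      show "integrable lborel (\<lambda>x. (cmod (G (v + x) - G x))\<^sup>2)" using Gs by (simp add: L2_iff)
      show "integrable lborel (\<lambda>x. 2 * real N * cmod (G (v + x) - G x))"
        using integrable_shift_diff[OF Gi, of v] by auto
      have "cmod (G (v + x) - G x) \<le> 2 * real N" for x using GN[of "v + x"] GN[of x] norm_triangle_ineq4[of "G (v + x)" "G x"] by linarith
      thus "(cmod (G (v + x) - G x))\<^sup>2 \<le> 2 * real N * cmod (G (v + x) - G x)" for x
        by (simp add: power2_eq_square mult_right_mono)
    qed
    also have "\<dots> = 2 * real N * L1_shift G v" by (simp add: L1_shift_def)
    finally have "nsq (\<lambda>x. F (v + x) - F x) \<le> 2 * (2 * nsq (\<lambda>x. F x - G x) + 2 * nsq (\<lambda>x. F x - G x)) + 2 * (2 * real N * L1_shift G v)"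
      by (simp add: Ds(2))
    thus ?thesis using N by (simp add: G_def)
  qed
  have "(\<lambda>n. 4 * (real N * L1_shift G (w n))) \<longlonglongrightarrow> 0"
    by (intro tendsto_mult_right_zero L1_shift_tendsto Gi w)
  from order_tendstoD(2)[OF this, of "e / 2"] e
  have "\<forall>\<^sub>F n in sequentially. 4 * (real N * L1_shift G (w n)) < e / 2" by simp
  hence "\<forall>\<^sub>F n in sequentially. norm (nsq (\<lambda>x. F (w n + x) - F x) - 0) < e"
  proof eventually_elim
    case (elim n)
    thus ?case using b[of "w n"] by simp
  qed
  thus "\<exists>no. \<forall>n\<ge>no. norm (nsq (\<lambda>x. F (w n + x) - F x) - 0) < e" by (simp add: eventually_sequentially)
qed

section \<open>The Plancherel theorem\<close>

lemma borel_measurable_cis [measurable (raw)]: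
  "f \<in> borel_measurable M \<Longrightarrow> (\<lambda>x. cis (f x)) \<in> borel_measurable M"
  by (rule measurable_compose[of f M borel cis]) (auto intro!: borel_measurable_continuous_onI continuous_intros)

lemma fourier_measurable [measurable]:
  assumes "F \<in> borel_measurable borel" shows "fourier F \<in> borel_measurable borel"
  unfolding fourier_def
  by (rule lborel.borel_measurable_lebesgue_integral) (use assms in measurable)

lemma norm_fourier_le:
  assumes "integrable lborel F" shows "cmod (fourier F \<xi>) \<le> (LINT x|lborel. cmod (F x))"
proof -
  have "cmod (fourier F \<xi>) \<le> (LINT x|lborel. cmod (F x * cis (- (x \<bullet> \<xi>))))"
    unfolding fourier_def by (rule Bochner_Integration.integral_norm_bound)
  thus ?thesis by (simp add: norm_mult)
qed

lemma integral_scale: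
  fixes f :: "'a::euclidean_space \<Rightarrow> complex"
  assumes "f \<in> borel_measurable borel" "c > 0"
  shows "(LINT x|lborel. f x) = (LINT x|lborel. of_real (c ^ DIM('a)) * f (c *\<^sub>R x))"
proof -
  have m: "(\<lambda>x::'a. 0 + c *\<^sub>R x) \<in> lborel \<rightarrow>\<^sub>M borel" by measurable
  have "(LINT x|lborel. f x) = (LINT x|density (distr lborel borel (\<lambda>x::'a. 0 + c *\<^sub>R x)) (\<lambda>_. \<bar>c\<bar> ^ DIM('a)). f x)"
    using lborel_affine[of c "0::'a"] assms(2) by simp
  also have "\<dots> = (LINT x|distr lborel borel (\<lambda>x::'a. 0 + c *\<^sub>R x). (\<bar>c\<bar> ^ DIM('a)) *\<^sub>R f x)"
    using assms by (intro integral_density) auto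
  also have "\<dots> = (LINT x|lborel. (\<bar>c\<bar> ^ DIM('a)) *\<^sub>R f (0 + c *\<^sub>R x))"
    using assms by (intro integral_distr[OF m]) auto
  finally show ?thesis using assms(2) by (simp add: scaleR_conv_of_real)
qed

text \<open>By \<open>fourier_multiplier\<close> the regularised form is the integral of K n (- v) *
  \<phi> v, where \<phi> v correlates F with the translate of G by v. The kernel \<open>K n\<close>
  is an approximate identity of total mass (2 * pi)^d, and \<phi> is continuous at 0 with \<phi> 0 =
  ip F G because translations are continuous in L2.\<close>

lemma gauss_regularised_tendsto:
  fixes F G :: "'a::euclidean_space \<Rightarrow> complex"
  assumes F: "integrable lborel F" "F \<in> L2" and G: "integrable lborel G" "G \<in> L2"
  shows "(\<lambda>n. LINT \<xi>|lborel. of_real (exp (- (norm \<xi>)\<^sup>2 / real (Suc n))) * (fourier F \<xi> * cnj (fourier G \<xi>)))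
    \<longlonglongrightarrow> (2 * pi) ^ DIM('a) * ip F G"
proof -
  have [measurable]: "F \<in> borel_measurable borel" "G \<in> borel_measurable borel" using F G by (auto simp: L2_iff)
  define \<phi> where "\<phi> v = ip F (\<lambda>x. G (v + x))" for v
  let ?w = "\<lambda>n \<xi>. complex_of_real (exp (- (norm \<xi>)\<^sup>2 / real (Suc n)))"
  let ?d = "DIM('a)"
  define K where "K n z = complex_of_real (sqrt (pi * real (Suc n)) ^ ?d * exp (- ((norm z)\<^sup>2 * real (Suc n) / 4)))" for n and z :: 'a
  have w_eq: "?w n \<xi> = exp (- of_real (1 / real (Suc n)) * of_real ((norm \<xi>)\<^sup>2))" for n and \<xi> :: 'a
    by (simp flip: exp_of_real)
  have Re1: "Re (complex_of_real (1 / real (Suc n))) > 0" for n by simp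
  have wi: "integrable lborel (?w n :: 'a \<Rightarrow> complex)" for n
    using integrable_gaussN[OF Re1[of n], of "0::'a"] unfolding w_eq by simp
  have wK: "fourier (?w n) z = K n z" for n and z :: 'a
  proof -
    have "fourier (?w n) z = csqrt (complex_of_real pi / complex_of_real (1 / real (Suc n))) ^ ?d * exp (- of_real ((norm z)\<^sup>2) / (4 * of_real (1 / real (Suc n))))"
      unfolding fourier_def w_eq integral_gaussN[OF Re1[of n], symmetric]
      by (intro Bochner_Integration.integral_cong refl) (metis inner_commute)
    also have "csqrt (complex_of_real pi / complex_of_real (1 / real (Suc n))) = csqrt (of_real (pi * real (Suc n)))" by simp
    also have "\<dots> = of_real (sqrt (pi * real (Suc n)))" by (rule csqrt_of_real) simp
    also have "- of_real ((norm z)\<^sup>2) / (4 * of_real (1 / real (Suc n))) = complex_of_real (- ((norm z)\<^sup>2 * real (Suc n) / 4))" by simp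
    finally show ?thesis unfolding K_def exp_of_real by (simp only: of_real_mult of_real_power)
  qed
  have Kb: "cmod (K n z) \<le> sqrt (pi * real (Suc n)) ^ ?d" for n z
    unfolding K_def norm_of_real by (simp add: abs_mult power_abs mult_left_le)
  have Km[measurable]: "K n \<in> borel_measurable borel" for n
    unfolding K_def[abs_def] by (intro borel_measurable_continuous_onI continuous_intros) auto
  have FGi: "integrable (lborel \<Otimes>\<^sub>M lborel) (\<lambda>(x, v). F x * cnj (G (x + v)))"
  proof (rule lborel_pair.Fubini_integrable)
    show "(\<lambda>(x, v). F x * cnj (G (x + v))) \<in> borel_measurable (lborel \<Otimes>\<^sub>M lborel)" by measurable
    have gm: "(\<lambda>v. cmod (G v)) \<in> borel_measurable borel" by measurable
    show "integrable lborel (\<lambda>x. LINT v|lborel. norm (case (x, v) of (x, v) \<Rightarrow> F x * cnj (G (x + v))))"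
      using F(1) by (simp add: norm_mult lborel_integral_translation(2)[OF gm])
    have "integrable lborel (\<lambda>v. G (x + v))" for x using lborel_integral_translation(1)[of G x] G by simp
    thus "AE x in lborel. integrable lborel (\<lambda>v. case (x, v) of (x, v) \<Rightarrow> F x * cnj (G (x + v)))"
      by (intro AE_I2) simp
  qed
  have FGKi: "integrable (lborel \<Otimes>\<^sub>M lborel) (\<lambda>(x, v). F x * cnj (G (x + v)) * K n (- v))" for n
  proof (rule Bochner_Integration.integrable_bound)
    show "integrable (lborel \<Otimes>\<^sub>M lborel) (\<lambda>p. of_real (sqrt (pi * real (Suc n)) ^ ?d) * (case p of (x, v) \<Rightarrow> F x * cnj (G (x + v))))"
      using FGi by (rule integrable_mult_right)
    show "(\<lambda>(x, v). F x * cnj (G (x + v)) * K n (- v)) \<in> borel_measurable (lborel \<Otimes>\<^sub>M lborel)" by measurable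
    show "AE p in lborel \<Otimes>\<^sub>M lborel. norm (case p of (x, v) \<Rightarrow> F x * cnj (G (x + v)) * K n (- v))
       \<le> norm (of_real (sqrt (pi * real (Suc n)) ^ ?d) * (case p of (x, v) \<Rightarrow> F x * cnj (G (x + v))))"
    proof (rule AE_I2)
      fix p :: "'a \<times> 'a"
      have "norm (F (fst p) * cnj (G (fst p + snd p))) * cmod (K n (- snd p)) \<le> norm (F (fst p) * cnj (G (fst p + snd p))) * sqrt (pi * real (Suc n)) ^ ?d"
        by (intro mult_left_mono Kb) auto
      thus "norm (case p of (x, v) \<Rightarrow> F x * cnj (G (x + v)) * K n (- v))
       \<le> norm (of_real (sqrt (pi * real (Suc n)) ^ ?d) * (case p of (x, v) \<Rightarrow> F x * cnj (G (x + v))))"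
        by (simp add: case_prod_beta' norm_mult norm_power mult_ac)
    qed
  qed
  have in1: "(LINT x|lborel. F x * cnj (G (x + v)) * K n (- v)) = K n (- v) * \<phi> v" for n v
    unfolding \<phi>_def ip_def by (simp add: add.commute mult.commute)
  have Kphi_i: "integrable lborel (\<lambda>v. K n (- v) * \<phi> v)" for n
    using lborel_pair.integrable_snd[OF FGKi[of n]] unfolding in1 .
  have I: "(LINT \<xi>|lborel. ?w n \<xi> * (fourier F \<xi> * cnj (fourier G \<xi>))) = (LINT v|lborel. K n (- v) * \<phi> v)" for n
  proof -
    note fm = fourier_multiplier[OF F(1) G(1) wi[of n], unfolded wK]
    have "(LINT \<xi>|lborel. ?w n \<xi> * (fourier F \<xi> * cnj (fourier G \<xi>))) = (LINT x|lborel. LINT y|lborel. F x * cnj (G y) * K n (x - y))"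
      using lborel_pair.integral_fst'[OF fm(1)] fm(2) by simp
    also have "\<dots> = (LINT x|lborel. LINT v|lborel. F x * cnj (G (x + v)) * K n (- v))"
    proof (rule Bochner_Integration.integral_cong[OF refl])
      fix x
      have "(\<lambda>y. F x * cnj (G y) * K n (x - y)) \<in> borel_measurable borel" by measurable
      from lborel_integral_translation(2)[OF this, of x]
      show "(LINT y|lborel. F x * cnj (G y) * K n (x - y)) = (LINT v|lborel. F x * cnj (G (x + v)) * K n (- v))" by simp
    qed
    also have "\<dots> = (LINT v|lborel. LINT x|lborel. F x * cnj (G (x + v)) * K n (- v))"
      by (rule lborel_pair.Fubini_integral[OF FGKi[of n], symmetric])
    finally show ?thesis unfolding in1 .
  qed
  \<comment> \<open>The width of \<open>K n\<close>. Rescaling by it makes the Gaussian independent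
    of n, and n survives only in the argument of \<phi>, which tends to 0.\<close>
  define c where "c n = sqrt (1 / real (Suc n))" for n
  have c: "c n > 0" for n by (simp add: c_def)
  have c2: "(c n)\<^sup>2 = 1 / real (Suc n)" for n by (simp add: c_def)
  have cK: "of_real (c n ^ ?d) * K n (- (c n *\<^sub>R v)) = complex_of_real (sqrt pi ^ ?d * exp (- (norm v)\<^sup>2 / 4))" for n v
  proof -
    have "c n * sqrt (pi * real (Suc n)) = sqrt pi" by (simp add: c_def real_sqrt_mult real_sqrt_divide)
    moreover have "(norm (- (c n *\<^sub>R v)))\<^sup>2 * real (Suc n) = (norm v)\<^sup>2" using c2[of n] by (simp add: power_mult_distrib)
    ultimately have "c n ^ ?d * (sqrt (pi * real (Suc n)) ^ ?d * exp (- ((norm (- (c n *\<^sub>R v)))\<^sup>2 * real (Suc n) / 4))) = sqrt pi ^ ?d * exp (- (norm v)\<^sup>2 / 4)"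
      by (metis minus_divide_left mult.assoc power_mult_distrib)
    thus ?thesis unfolding K_def of_real_mult[symmetric] by simp
  qed
  have J: "(LINT v|lborel. K n (- v) * \<phi> v) = (LINT v|lborel. of_real (sqrt pi ^ ?d * exp (- (norm v)\<^sup>2 / 4)) * \<phi> (c n *\<^sub>R v))" for n
    using integral_scale[of "\<lambda>v. K n (- v) * \<phi> v", OF _ c[of n]] borel_measurable_integrable[OF Kphi_i[of n]]
    unfolding mult.assoc[symmetric] cK by simp
  have phib: "cmod (\<phi> v) \<le> sqrt (nsq F) * sqrt (nsq G)" for v
    unfolding \<phi>_def using ip_Cauchy_Schwarz[OF F(2) nsq_shift(1)[OF G(2)]] by (simp add: nsq_shift[OF G(2)])
  have gi: "integrable lborel (\<lambda>v::'a. exp (- (norm v)\<^sup>2 / 4))"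
  proof -
    have "(\<lambda>v::'a. exp (- (norm v)\<^sup>2 / 4)) = (\<lambda>v. Re (exp (- of_real (1/4) * of_real ((norm v)\<^sup>2)) * cis (- (0 \<bullet> v))))"
    proof
      fix v :: 'a
      have "exp (- complex_of_real (1/4) * of_real ((norm v)\<^sup>2)) = of_real (exp (- (norm v)\<^sup>2 / 4))"
        unfolding exp_of_real[symmetric] by simp
      thus "exp (- (norm v)\<^sup>2 / 4) = Re (exp (- of_real (1/4) * of_real ((norm v)\<^sup>2)) * cis (- (0 \<bullet> v)))" by simp
    qed
    thus ?thesis using integrable_Re[OF integrable_gaussN[of "of_real (1/4)" "0::'a"]] by simp
  qed
  have gv: "(LINT v|lborel. complex_of_real (exp (- (norm (v::'a))\<^sup>2 / 4))) = of_real (sqrt (4 * pi) ^ ?d)"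
  proof -
    have "complex_of_real (exp (- (norm v)\<^sup>2 / 4)) = exp (- complex_of_real (1/4) * of_real ((norm v)\<^sup>2)) * cis (- (0 \<bullet> v))" for v :: 'a
      by (simp flip: exp_of_real)
    hence "(LINT v|lborel. complex_of_real (exp (- (norm (v::'a))\<^sup>2 / 4))) = csqrt (complex_of_real pi / complex_of_real (1/4)) ^ ?d"
      using integral_gaussN[of "of_real (1/4)" "0::'a"] by simp
    also have "csqrt (complex_of_real pi / complex_of_real (1/4)) = of_real (sqrt (4 * pi))"
      by (simp add: mult.commute)
    finally show ?thesis by simp
  qed
  have phit: "(\<lambda>n. \<phi> (c n *\<^sub>R v)) \<longlonglongrightarrow> ip F G" for v
  proof -
    have "(\<lambda>n. c n) \<longlonglongrightarrow> sqrt 0" unfolding c_def by (intro tendsto_real_sqrt lim_1_over_n[THEN LIMSEQ_Suc])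
    hence "(\<lambda>n. c n *\<^sub>R v) \<longlonglongrightarrow> sqrt 0 *\<^sub>R v" by (intro tendsto_intros)
    hence cv: "(\<lambda>n. c n *\<^sub>R v) \<longlonglongrightarrow> 0" by simp
    have "(\<lambda>n. \<phi> (c n *\<^sub>R v) - ip F G) \<longlonglongrightarrow> 0"
    proof (rule Lim_null_comparison)
      show "(\<lambda>n. sqrt (nsq F) * sqrt (nsq (\<lambda>x. G (c n *\<^sub>R v + x) - G x))) \<longlonglongrightarrow> 0"
        using tendsto_real_sqrt[OF nsq_shift_tendsto[OF G(2) cv]] by (intro tendsto_mult_right_zero) simp
      have "\<phi> (c n *\<^sub>R v) - ip F G = ip F (\<lambda>x. G (c n *\<^sub>R v + x) - G x)" for n
        unfolding \<phi>_def by (rule ip_diff_right[symmetric]) (use F G nsq_shift in auto)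
      thus "\<forall>\<^sub>F n in sequentially. norm (\<phi> (c n *\<^sub>R v) - ip F G) \<le> sqrt (nsq F) * sqrt (nsq (\<lambda>x. G (c n *\<^sub>R v + x) - G x))"
        using ip_Cauchy_Schwarz[OF F(2) L2_diff[OF nsq_shift(1)[OF G(2)] G(2)]] by simp
    qed
    thus ?thesis by (simp add: LIM_zero_iff)
  qed
  have "(\<lambda>n. LINT v|lborel. of_real (sqrt pi ^ ?d * exp (- (norm v)\<^sup>2 / 4)) * \<phi> (c n *\<^sub>R v))
     \<longlonglongrightarrow> (LINT v::'a|lborel. of_real (sqrt pi ^ ?d * exp (- (norm v)\<^sup>2 / 4)) * ip F G)"
  proof (rule integral_dominated_convergence[where w = "\<lambda>v. (sqrt pi ^ ?d * (sqrt (nsq F) * sqrt (nsq G))) * exp (- (norm v)\<^sup>2 / 4)"])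
    \<comment> \<open>Fubini yields the measurability of the product with the kernel; dividing by a
      kernel without zeros recovers that of \<phi>.\<close>
    have pm: "\<phi> \<in> borel_measurable borel"
    proof -
      have "(\<lambda>v. K 0 (- v) * \<phi> v / K 0 (- v)) \<in> borel_measurable borel"
        using borel_measurable_integrable[OF Kphi_i[of 0]] by measurable
      moreover have "K 0 (- v) \<noteq> 0" for v by (simp add: K_def)
      ultimately show ?thesis by simp
    qed
    note [measurable] = pm
    show "(\<lambda>v. of_real (sqrt pi ^ ?d * exp (- (norm v)\<^sup>2 / 4)) * \<phi> (c n *\<^sub>R v)) \<in> borel_measurable lborel" for n by measurable
    show "(\<lambda>v::'a. of_real (sqrt pi ^ ?d * exp (- (norm v)\<^sup>2 / 4)) * ip F G) \<in> borel_measurable lborel" by measurable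
    show "integrable lborel (\<lambda>v::'a. (sqrt pi ^ ?d * (sqrt (nsq F) * sqrt (nsq G))) * exp (- (norm v)\<^sup>2 / 4))"
      by (rule integrable_mult_right[OF gi])
    show "AE v in lborel. (\<lambda>n. of_real (sqrt pi ^ ?d * exp (- (norm v)\<^sup>2 / 4)) * \<phi> (c n *\<^sub>R v)) \<longlonglongrightarrow> of_real (sqrt pi ^ ?d * exp (- (norm v)\<^sup>2 / 4)) * ip F G"
      by (intro AE_I2 tendsto_intros phit)
    show "AE v in lborel. norm (of_real (sqrt pi ^ ?d * exp (- (norm v)\<^sup>2 / 4)) * \<phi> (c n *\<^sub>R v)) \<le> (sqrt pi ^ ?d * (sqrt (nsq F) * sqrt (nsq G))) * exp (- (norm v)\<^sup>2 / 4)" for n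
    proof (rule AE_I2)
      fix v :: 'a
      have "(sqrt pi ^ ?d * exp (- (norm v)\<^sup>2 / 4)) * cmod (\<phi> (c n *\<^sub>R v)) \<le> (sqrt pi ^ ?d * exp (- (norm v)\<^sup>2 / 4)) * (sqrt (nsq F) * sqrt (nsq G))"
        by (intro mult_left_mono phib) simp
      thus "norm (of_real (sqrt pi ^ ?d * exp (- (norm v)\<^sup>2 / 4)) * \<phi> (c n *\<^sub>R v)) \<le> (sqrt pi ^ ?d * (sqrt (nsq F) * sqrt (nsq G))) * exp (- (norm v)\<^sup>2 / 4)"
        by (simp only: norm_mult norm_of_real) (simp add: mult_ac)
    qed
  qed
  also have "(LINT v::'a|lborel. of_real (sqrt pi ^ ?d * exp (- (norm v)\<^sup>2 / 4)) * ip F G) = of_real (sqrt pi ^ ?d) * ip F G * of_real (sqrt (4 * pi) ^ ?d)"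
    unfolding gv[symmetric] by (simp only: integral_mult_right_zero[symmetric] of_real_mult) (simp add: mult_ac)
  also have "\<dots> = (2 * pi) ^ ?d * ip F G"
  proof -
    have "sqrt pi ^ ?d * sqrt (4 * pi) ^ ?d = (2 * pi) ^ ?d"
    proof -
      have "sqrt pi * sqrt (4 * pi) = 2 * pi" by (simp add: real_sqrt_mult)
      thus ?thesis unfolding power_mult_distrib[symmetric] by simp
    qed
    hence "complex_of_real (sqrt pi ^ ?d) * of_real (sqrt (4 * pi) ^ ?d) = of_real ((2 * pi) ^ ?d)"
      by (simp only: of_real_mult[symmetric])
    thus ?thesis by (simp add: mult_ac)
  qed
  finally show ?thesis unfolding I J .
qed

text \<open>The regularised integrals increase to the integral of the squared modulus while their
  limit is already known. Monotone convergence therefore gives membership in L2 together with the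
  value; (2 * pi)^d reflects the unnormalised transform.\<close>

lemma fourier_Plancherel:
  fixes F :: "'a::euclidean_space \<Rightarrow> complex"
  assumes F: "integrable lborel F" "F \<in> L2"
  shows "fourier F \<in> L2" and "nsq (fourier F) = (2 * pi) ^ DIM('a) * nsq F"
proof -
  have [measurable]: "F \<in> borel_measurable borel" using F by (auto simp: L2_iff)
  let ?f = "\<lambda>n \<xi>. exp (- (norm \<xi>)\<^sup>2 / real (Suc n)) * (cmod (fourier F \<xi>))\<^sup>2"
  have eq: "(LINT \<xi>|lborel. of_real (exp (- (norm \<xi>)\<^sup>2 / real (Suc n))) * (fourier F \<xi> * cnj (fourier F \<xi>)))
     = complex_of_real (LINT \<xi>|lborel. ?f n \<xi>)" for n
    unfolding complex_norm_square[symmetric] of_real_mult[symmetric] integral_complex_of_real ..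
  have lim: "(\<lambda>n. LINT \<xi>|lborel. ?f n \<xi>) \<longlonglongrightarrow> (2 * pi) ^ DIM('a) * nsq F"
    using tendsto_Re[OF gauss_regularised_tendsto[OF F F, unfolded eq]]
    unfolding ip_self of_real_mult[symmetric] of_real_power[symmetric] Re_complex_of_real by simp
  have gi: "integrable lborel (\<lambda>\<xi>::'a. exp (- (norm \<xi>)\<^sup>2 / real (Suc n)))" for n
  proof -
    have "exp (- (norm v)\<^sup>2 / real (Suc n)) = Re (exp (- of_real (1/real (Suc n)) * of_real ((norm v)\<^sup>2)) * cis (- (0 \<bullet> v)))" for v :: 'a
    proof -
      have "exp (- complex_of_real (1/real (Suc n)) * of_real ((norm v)\<^sup>2)) = of_real (exp (- (norm v)\<^sup>2 / real (Suc n)))"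
        unfolding exp_of_real[symmetric] by simp
      thus ?thesis by simp
    qed
    thus ?thesis using integrable_Re[OF integrable_gaussN[of "of_real (1/real (Suc n))" "0::'a"]] by simp
  qed
  have fi: "integrable lborel (?f n)" for n
  proof (rule Bochner_Integration.integrable_bound[OF integrable_mult_right[OF gi[of n], of "(LINT x|lborel. cmod (F x))\<^sup>2"]])
    show "AE x in lborel. norm (?f n x) \<le> norm ((LINT x|lborel. cmod (F x))\<^sup>2 * exp (- (norm x)\<^sup>2 / real (Suc n)))"
      using norm_fourier_le[OF F(1)] by (intro AE_I2) (simp add: abs_mult mult.commute mult_right_mono power_mono)
  qed measurable
  have mono: "mono (\<lambda>n. ?f n \<xi>)" for \<xi>
    by (intro monoI mult_right_mono) (auto intro!: divide_left_mono)
  have pw: "(\<lambda>n. ?f n \<xi>) \<longlonglongrightarrow> (cmod (fourier F \<xi>))\<^sup>2" for \<xi>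
  proof -
    have "(\<lambda>n. - (norm \<xi>)\<^sup>2 * (1 / real (Suc n))) \<longlonglongrightarrow> - (norm \<xi>)\<^sup>2 * 0"
      by (intro tendsto_intros lim_1_over_n[THEN LIMSEQ_Suc])
    hence "(\<lambda>n. exp (- (norm \<xi>)\<^sup>2 / real (Suc n)) * (cmod (fourier F \<xi>))\<^sup>2) \<longlonglongrightarrow> exp 0 * (cmod (fourier F \<xi>))\<^sup>2"
      by (intro tendsto_intros) simp
    thus ?thesis by simp
  qed
  have m: "(\<lambda>\<xi>. (cmod (fourier F \<xi>))\<^sup>2) \<in> borel_measurable lborel" by measurable
  note hyps = fi AE_I2[OF mono] AE_I2[OF pw] lim m
  show "fourier F \<in> L2"
    using integrable_monotone_convergence[OF hyps] by (simp add: L2_iff)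
  show "nsq (fourier F) = (2 * pi) ^ DIM('a) * nsq F"
    using integral_monotone_convergence[OF hyps] by (simp add: nsq_def)
qed

text \<open>Now that both transforms are in L2, their product is an integrable majorant, and
  dominated convergence identifies the limit of the regularised integrals.\<close>

lemma fourier_Parseval:
  fixes F G :: "'a::euclidean_space \<Rightarrow> complex"
  assumes F: "integrable lborel F" "F \<in> L2" and G: "integrable lborel G" "G \<in> L2"
  shows "ip (fourier F) (fourier G) = (2 * pi) ^ DIM('a) * ip F G"
proof -
  note L = fourier_Plancherel(1)[OF F] fourier_Plancherel(1)[OF G]
  note i = integrable_ip[OF L]
  have "(\<lambda>n. LINT \<xi>|lborel. of_real (exp (- (norm \<xi>)\<^sup>2 / real (Suc n))) * (fourier F \<xi> * cnj (fourier G \<xi>)))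
    \<longlonglongrightarrow> (LINT \<xi>|lborel. fourier F \<xi> * cnj (fourier G \<xi>))"
  proof (rule integral_dominated_convergence[where w = "\<lambda>\<xi>. cmod (fourier F \<xi> * cnj (fourier G \<xi>))"])
    note [measurable] = borel_measurable_integrable[OF i]
    show "(\<lambda>\<xi>. fourier F \<xi> * cnj (fourier G \<xi>)) \<in> borel_measurable lborel" by measurable
    show "(\<lambda>\<xi>. of_real (exp (- (norm \<xi>)\<^sup>2 / real (Suc n))) * (fourier F \<xi> * cnj (fourier G \<xi>))) \<in> borel_measurable lborel" for n
      by measurable
    show "integrable lborel (\<lambda>\<xi>. cmod (fourier F \<xi> * cnj (fourier G \<xi>)))" using i by simp
    show "AE \<xi> in lborel. (\<lambda>n. of_real (exp (- (norm \<xi>)\<^sup>2 / real (Suc n))) * (fourier F \<xi> * cnj (fourier G \<xi>))) \<longlonglongrightarrow> fourier F \<xi> * cnj (fourier G \<xi>)"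
    proof (rule AE_I2)
      fix \<xi> :: 'a
      have "(\<lambda>n. - (norm \<xi>)\<^sup>2 * (1 / real (Suc n))) \<longlonglongrightarrow> - (norm \<xi>)\<^sup>2 * 0"
        by (intro tendsto_intros lim_1_over_n[THEN LIMSEQ_Suc])
      hence "(\<lambda>n. complex_of_real (exp (- (norm \<xi>)\<^sup>2 / real (Suc n))) * (fourier F \<xi> * cnj (fourier G \<xi>))) \<longlonglongrightarrow> of_real (exp 0) * (fourier F \<xi> * cnj (fourier G \<xi>))"
        by (intro tendsto_intros) simp
      thus "(\<lambda>n. of_real (exp (- (norm \<xi>)\<^sup>2 / real (Suc n))) * (fourier F \<xi> * cnj (fourier G \<xi>))) \<longlonglongrightarrow> fourier F \<xi> * cnj (fourier G \<xi>)" by simp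
    qed
    show "AE \<xi> in lborel. norm (of_real (exp (- (norm \<xi>)\<^sup>2 / real (Suc n))) * (fourier F \<xi> * cnj (fourier G \<xi>))) \<le> cmod (fourier F \<xi> * cnj (fourier G \<xi>))" for n
      by (intro AE_I2) (simp add: norm_mult mult_left_le_one_le)
  qed
  from LIMSEQ_unique[OF this gauss_regularised_tendsto[OF F G]] show ?thesis by (simp add: ip_def)
qed

section \<open>The frequency-localised Schroedinger flow\<close>

lemma nsq_tendsto:
  assumes f: "f \<in> L2" and s: "\<And>n. s n \<in> L2" and lim: "(\<lambda>n. nsq (\<lambda>x. f x - s n x)) \<longlonglongrightarrow> 0"
  shows "(\<lambda>n. nsq (s n)) \<longlonglongrightarrow> nsq f"
proof -
  have d: "(\<lambda>x. f x - s n x) \<in> L2" "(\<lambda>x. -1 * (f x - s n x)) \<in> L2" for n by (intro L2_diff L2_cmult f s)+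
  have "(\<lambda>n. sqrt (nsq (s n)) - sqrt (nsq f)) \<longlonglongrightarrow> 0"
  proof (rule Lim_null_comparison)
    show "(\<lambda>n. sqrt (nsq (\<lambda>x. f x - s n x))) \<longlonglongrightarrow> 0" using tendsto_real_sqrt[OF lim] by simp
    have "\<bar>sqrt (nsq (s n)) - sqrt (nsq f)\<bar> \<le> sqrt (nsq (\<lambda>x. f x - s n x))" for n
      using nsq_triangle[OF s[of n] d(1)[of n]] nsq_triangle[OF f d(2)[of n]] nsq_cmult[of "-1" "\<lambda>x. f x - s n x"] by simp
    thus "\<forall>\<^sub>F n in sequentially. norm (sqrt (nsq (s n)) - sqrt (nsq f)) \<le> sqrt (nsq (\<lambda>x. f x - s n x))" by simp
  qed
  hence "(\<lambda>n. sqrt (nsq (s n))) \<longlonglongrightarrow> sqrt (nsq f)" by (simp add: LIM_zero_iff)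
  hence "(\<lambda>n. (sqrt (nsq (s n)))\<^sup>2) \<longlonglongrightarrow> (sqrt (nsq f))\<^sup>2" by (rule tendsto_power)
  thus ?thesis by (simp only: real_sqrt_pow2 nsq_nonneg)
qed

lemma ip_tendsto_left:
  assumes f: "f \<in> L2" and s: "\<And>n. s n \<in> L2" and g: "g \<in> L2" and lim: "(\<lambda>n. nsq (\<lambda>x. f x - s n x)) \<longlonglongrightarrow> 0"
  shows "(\<lambda>n. ip (s n) g) \<longlonglongrightarrow> ip f g"
proof -
  have d: "(\<lambda>x. f x - s n x) \<in> L2" for n by (intro L2_diff f s)
  have "(\<lambda>n. ip (s n) g - ip f g) \<longlonglongrightarrow> 0"
  proof (rule Lim_null_comparison)
    show "(\<lambda>n. sqrt (nsq (\<lambda>x. f x - s n x)) * sqrt (nsq g)) \<longlonglongrightarrow> 0"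
      using tendsto_real_sqrt[OF lim] by (intro tendsto_mult_left_zero) simp
    have "ip f g = ip (s n) g + ip (\<lambda>x. f x - s n x) g" for n
      using ip_add_left[OF s d g, of n n] by simp
    hence "norm (ip (s n) g - ip f g) \<le> sqrt (nsq (\<lambda>x. f x - s n x)) * sqrt (nsq g)" for n
      using ip_Cauchy_Schwarz[OF d[of n] g] by (metis add_diff_cancel_left' norm_minus_commute)
    thus "\<forall>\<^sub>F n in sequentially. norm (ip (s n) g - ip f g) \<le> sqrt (nsq (\<lambda>x. f x - s n x)) * sqrt (nsq g)" by simp
  qed
  thus ?thesis by (simp add: LIM_zero_iff)
qed

text \<open>Matches the truncated integral in \<open>fourier_L2\<close> along integer radii; a
  truncated L2 function is integrable, so that \<open>fourier\<close> applies to it.\<close>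

definition cutoff :: "('a::euclidean_space \<Rightarrow> complex) \<Rightarrow> nat \<Rightarrow> 'a \<Rightarrow> complex" where
  "cutoff f n x = indicator (ball 0 (real n)) x * f x"

lemma cutoff_L2: assumes "f \<in> L2" shows "cutoff f n \<in> L2"
proof (rule L2_bound[where B = 1, OF assms])
  show "cutoff f n \<in> borel_measurable borel"
    unfolding cutoff_def[abs_def] using L2_measurable[OF assms]
    by (intro borel_measurable_times borel_measurable_indicator) auto
qed (auto simp: cutoff_def indicator_def)

lemma cutoff_integrable: assumes "f \<in> L2" shows "integrable lborel (cutoff f n)"
proof -
  have "(indicator (ball 0 (real n)) :: 'a \<Rightarrow> complex) \<in> L2"
  proof -
    have "integrable lborel (indicat_real (ball (0::'a) (real n)))"
      by (intro integrable_real_indicator emeasure_bounded_finite) auto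
    moreover have "(\<lambda>x. (cmod (indicator (ball 0 (real n)) x))\<^sup>2) = indicat_real (ball (0::'a) (real n))"
      by (auto simp: indicator_def)
    ultimately show ?thesis by (simp add: L2_iff borel_measurable_indicator)
  qed
  from integrable_ip[OF assms this] show ?thesis
    by (rule back_subst[of "integrable lborel"]) (auto simp: cutoff_def indicator_def)
qed

lemma cutoff_tendsto:
  assumes "f \<in> L2" shows "(\<lambda>n. nsq (\<lambda>x. f x - cutoff f n x)) \<longlonglongrightarrow> 0"
  unfolding cutoff_def
proof (rule L2_truncation_tendsto[OF assms])
  fix x :: 'a
  have "\<forall>\<^sub>F n in sequentially. real n \<ge> norm x + 1"
    by (rule filterlim_at_top[THEN iffD1, rule_format, OF filterlim_real_sequentially])
  thus "\<forall>\<^sub>F n in sequentially. x \<in> ball 0 (real n)" by eventually_elim auto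
qed simp

lemma fourier_diff:
  assumes "integrable lborel f" "integrable lborel g"
  shows "fourier (\<lambda>x. f x - g x) \<xi> = fourier f \<xi> - fourier g \<xi>"
proof -
  have m: "(\<lambda>x. - (x \<bullet> \<xi>)) \<in> borel_measurable borel" by measurable
  show ?thesis unfolding fourier_def left_diff_distrib
    by (intro Bochner_Integration.integral_diff integrable_mult_cis assms m)
qed

lemma fourier_L2_seq:
  assumes \<phi>: "\<phi> \<in> L2" and F: "fourier_L2 \<phi> \<psi>"
  shows "\<psi> \<in> L2" and "(\<lambda>n. nsq (\<lambda>\<xi>. \<psi> \<xi> - fourier (cutoff \<phi> n) \<xi>)) \<longlonglongrightarrow> 0"
proof -
  show \<psi>: "\<psi> \<in> L2" using F by (simp add: fourier_L2_def)
  have "((\<lambda>R::real. \<integral>\<^sup>+ \<xi>. ennreal ((cmod (\<psi> \<xi> - (\<integral>x\<in>ball 0 R. \<phi> x * cis (- (x \<bullet> \<xi>)) \<partial>lborel)))\<^sup>2) \<partial>lborel) \<longlongrightarrow> 0) at_top"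
    using F by (simp add: fourier_L2_def)
  from filterlim_compose[OF this filterlim_real_sequentially]
  have 1: "(\<lambda>n. \<integral>\<^sup>+ \<xi>. ennreal ((cmod (\<psi> \<xi> - (\<integral>x\<in>ball 0 (real n). \<phi> x * cis (- (x \<bullet> \<xi>)) \<partial>lborel)))\<^sup>2) \<partial>lborel) \<longlonglongrightarrow> 0" .
  have 2: "(\<integral>x\<in>ball 0 (real n). \<phi> x * cis (- (x \<bullet> \<xi>)) \<partial>lborel) = fourier (cutoff \<phi> n) \<xi>" for n \<xi>
    unfolding fourier_def cutoff_def set_lebesgue_integral_def
    by (intro Bochner_Integration.integral_cong refl) (auto simp: indicator_def)
  have d: "(\<lambda>\<xi>. \<psi> \<xi> - fourier (cutoff \<phi> n) \<xi>) \<in> L2" for n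
    by (intro L2_diff \<psi> fourier_Plancherel cutoff_L2 cutoff_integrable \<phi>)
  have 3: "(\<integral>\<^sup>+ \<xi>. ennreal ((cmod (\<psi> \<xi> - fourier (cutoff \<phi> n) \<xi>))\<^sup>2) \<partial>lborel) = ennreal (nsq (\<lambda>\<xi>. \<psi> \<xi> - fourier (cutoff \<phi> n) \<xi>))" for n
    unfolding nsq_def using L2_integrable[OF d[of n]] by (intro nn_integral_eq_integral) auto
  have "(\<lambda>n. ennreal (nsq (\<lambda>\<xi>. \<psi> \<xi> - fourier (cutoff \<phi> n) \<xi>))) \<longlonglongrightarrow> ennreal 0"
    using 1 unfolding 2 3 by simp
  thus "(\<lambda>n. nsq (\<lambda>\<xi>. \<psi> \<xi> - fourier (cutoff \<phi> n) \<xi>)) \<longlonglongrightarrow> 0"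
    by (subst (asm) tendsto_ennreal_iff) auto
qed

lemma fourier_L2_Plancherel:
  fixes \<phi> \<psi> :: "'a::euclidean_space \<Rightarrow> complex"
  assumes \<phi>: "\<phi> \<in> L2" and F: "fourier_L2 \<phi> \<psi>"
  shows "nsq \<psi> = (2 * pi) ^ DIM('a) * nsq \<phi>"
proof (rule LIMSEQ_unique)
  note s = fourier_L2_seq[OF \<phi> F]
  note c = cutoff_integrable[OF \<phi>] cutoff_L2[OF \<phi>]
  show "(\<lambda>n. nsq (fourier (cutoff \<phi> n))) \<longlonglongrightarrow> nsq \<psi>"
    by (intro nsq_tendsto s fourier_Plancherel c)
  show "(\<lambda>n. nsq (fourier (cutoff \<phi> n))) \<longlonglongrightarrow> (2 * pi) ^ DIM('a) * nsq \<phi>"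
    unfolding fourier_Plancherel(2)[OF c] by (intro tendsto_intros nsq_tendsto cutoff_tendsto \<phi> c)
qed

text \<open>Serves the continuity of the solution in time. Since \<open>fourier_L2\<close> is a
  relation, linearity is used on the truncations, where it is exact, and passed to the
  limit.\<close>

lemma fourier_L2_Plancherel_diff:
  fixes \<phi> \<psi> :: "'a::euclidean_space \<Rightarrow> complex"
  assumes \<phi>: "\<phi> \<in> L2" "\<phi>' \<in> L2" and F: "fourier_L2 \<phi> \<psi>" "fourier_L2 \<phi>' \<psi>'"
  shows "nsq (\<lambda>\<xi>. \<psi> \<xi> - \<psi>' \<xi>) = (2 * pi) ^ DIM('a) * nsq (\<lambda>x. \<phi> x - \<phi>' x)"
proof (rule LIMSEQ_unique)
  note s = fourier_L2_seq[OF \<phi>(1) F(1)] and s' = fourier_L2_seq[OF \<phi>(2) F(2)]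
  note c = cutoff_integrable cutoff_L2
  let ?D = "\<lambda>x. \<phi> x - \<phi>' x"
  have D: "?D \<in> L2" by (intro L2_diff \<phi>)
  have cD: "cutoff ?D n = (\<lambda>x. cutoff \<phi> n x - cutoff \<phi>' n x)" for n by (auto simp: cutoff_def algebra_simps)
  have fD: "fourier (cutoff ?D n) \<xi> = fourier (cutoff \<phi> n) \<xi> - fourier (cutoff \<phi>' n) \<xi>" for n \<xi>
    unfolding cD by (intro fourier_diff cutoff_integrable \<phi>)
  show "(\<lambda>n. nsq (fourier (cutoff ?D n))) \<longlonglongrightarrow> nsq (\<lambda>\<xi>. \<psi> \<xi> - \<psi>' \<xi>)"
  proof (rule nsq_tendsto)
    show "(\<lambda>\<xi>. \<psi> \<xi> - \<psi>' \<xi>) \<in> L2" by (intro L2_diff s s')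
    show "fourier (cutoff ?D n) \<in> L2" for n by (intro fourier_Plancherel c D)
    show "(\<lambda>n. nsq (\<lambda>\<xi>. \<psi> \<xi> - \<psi>' \<xi> - fourier (cutoff ?D n) \<xi>)) \<longlonglongrightarrow> 0"
    proof (rule Lim_null_comparison)
      show "(\<lambda>n. 2 * nsq (\<lambda>\<xi>. \<psi> \<xi> - fourier (cutoff \<phi> n) \<xi>) + 2 * nsq (\<lambda>\<xi>. -1 * (\<psi>' \<xi> - fourier (cutoff \<phi>' n) \<xi>))) \<longlonglongrightarrow> 0"
        unfolding nsq_cmult using s(2) s'(2) by (auto intro!: tendsto_eq_intros)
      have "nsq (\<lambda>\<xi>. \<psi> \<xi> - \<psi>' \<xi> - fourier (cutoff ?D n) \<xi>) \<le> 2 * nsq (\<lambda>\<xi>. \<psi> \<xi> - fourier (cutoff \<phi> n) \<xi>) + 2 * nsq (\<lambda>\<xi>. -1 * (\<psi>' \<xi> - fourier (cutoff \<phi>' n) \<xi>))" for n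
      proof -
        have "nsq (\<lambda>\<xi>. \<psi> \<xi> - \<psi>' \<xi> - fourier (cutoff ?D n) \<xi>) = nsq (\<lambda>\<xi>. (\<psi> \<xi> - fourier (cutoff \<phi> n) \<xi>) + -1 * (\<psi>' \<xi> - fourier (cutoff \<phi>' n) \<xi>))"
          by (simp add: fD algebra_simps)
        also have "\<dots> \<le> 2 * nsq (\<lambda>\<xi>. \<psi> \<xi> - fourier (cutoff \<phi> n) \<xi>) + 2 * nsq (\<lambda>\<xi>. -1 * (\<psi>' \<xi> - fourier (cutoff \<phi>' n) \<xi>))"
          by (intro nsq_add_le L2_cmult L2_diff s s' fourier_Plancherel c \<phi>)
        finally show ?thesis .
      qed
      thus "\<forall>\<^sub>F n in sequentially. norm (nsq (\<lambda>\<xi>. \<psi> \<xi> - \<psi>' \<xi> - fourier (cutoff ?D n) \<xi>))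
        \<le> 2 * nsq (\<lambda>\<xi>. \<psi> \<xi> - fourier (cutoff \<phi> n) \<xi>) + 2 * nsq (\<lambda>\<xi>. -1 * (\<psi>' \<xi> - fourier (cutoff \<phi>' n) \<xi>))" by simp
    qed
  qed
  show "(\<lambda>n. nsq (fourier (cutoff ?D n))) \<longlonglongrightarrow> (2 * pi) ^ DIM('a) * nsq ?D"
    unfolding fourier_Plancherel(2)[OF cutoff_integrable[OF D] cutoff_L2[OF D]] by (intro tendsto_intros nsq_tendsto cutoff_tendsto D c)
qed

lemma fourier_L2_Parseval:
  fixes \<phi> \<psi> G :: "'a::euclidean_space \<Rightarrow> complex"
  assumes \<phi>: "\<phi> \<in> L2" and F: "fourier_L2 \<phi> \<psi>" and G: "integrable lborel G" "G \<in> L2"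
  shows "ip \<psi> (fourier G) = (2 * pi) ^ DIM('a) * ip \<phi> G"
proof (rule LIMSEQ_unique)
  note s = fourier_L2_seq[OF \<phi> F]
  note c = cutoff_integrable[OF \<phi>] cutoff_L2[OF \<phi>]
  show "(\<lambda>n. ip (fourier (cutoff \<phi> n)) (fourier G)) \<longlonglongrightarrow> ip \<psi> (fourier G)"
    by (intro ip_tendsto_left s fourier_Plancherel c G)
  show "(\<lambda>n. ip (fourier (cutoff \<phi> n)) (fourier G)) \<longlonglongrightarrow> (2 * pi) ^ DIM('a) * ip \<phi> G"
    unfolding fourier_Parseval[OF c G] by (intro tendsto_intros ip_tendsto_left cutoff_tendsto \<phi> c G)
qed

text \<open>The adjoint flow carries the weight \<open>exp (- (a \<bullet> \<xi>)\<^sup>2)\<close>, and \<open>unweight\<close> removes it from the data, where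
  \<open>M\<close> bounds \<open>\<bar>a \<bullet> \<xi>\<bar>\<close>.\<close>

definition adjoint_flow :: "'a::euclidean_space \<Rightarrow> real \<Rightarrow> ('a \<Rightarrow> complex) \<Rightarrow> 'a \<Rightarrow> complex" where
  "adjoint_flow a t F \<xi> = cis (t * (norm \<xi>)\<^sup>2) * of_real (exp (- (a \<bullet> \<xi>)\<^sup>2)) * fourier F \<xi>"

lemma adjoint_flow_L2:
  fixes F :: "'a::euclidean_space \<Rightarrow> complex"
  assumes F: "integrable lborel F" "F \<in> L2"
  shows "adjoint_flow a t F \<in> L2" and "nsq (adjoint_flow a t F) \<le> (2 * pi) ^ DIM('a) * nsq F"
proof -
  note P = fourier_Plancherel[OF F]
  note [measurable] = L2_measurable[OF P(1)]
  have m: "adjoint_flow a t F \<in> borel_measurable borel" unfolding adjoint_flow_def[abs_def] by measurable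
  have b: "cmod (adjoint_flow a t F \<xi>) \<le> 1 * cmod (fourier F \<xi>)" for \<xi>
    by (simp add: adjoint_flow_def norm_mult mult_left_le_one_le)
  show "adjoint_flow a t F \<in> L2" by (rule L2_bound[OF P(1) m b])
  show "nsq (adjoint_flow a t F) \<le> (2 * pi) ^ DIM('a) * nsq F"
    using nsq_bound[OF P(1) m b] P(2) by simp
qed

text \<open>The two multipliers combine to cis ((t - s) * |\<xi>|^2) * exp (- 2 * (a \<bullet>
  \<xi>)^2), the pointwise limit of integrable multipliers \<open>anisotropic_gauss\<close>. Their
  kernels are bounded uniformly because the modulus of \<zeta> n is at least |t - s|, and Plancherel
  supplies the majorant for the limit.\<close>

lemma adjoint_flow_dispersive:
  fixes F G :: "'a::euclidean_space \<Rightarrow> complex"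
  assumes F: "integrable lborel F" "F \<in> L2" and G: "integrable lborel G" "G \<in> L2"
    and a: "norm a = 1" and ts: "t \<noteq> s"
  shows "cmod (ip (adjoint_flow a t F) (adjoint_flow a s G))
    \<le> (sqrt (pi / \<bar>t - s\<bar>) ^ (DIM('a) - 1) * sqrt (pi / 2)) * (LINT x|lborel. cmod (F x)) * (LINT x|lborel. cmod (G x))"
proof -
  define \<tau> where "\<tau> = t - s"
  \<comment> \<open>The sign of the imaginary part makes exp (- \<zeta> n * |\<xi>|^2) oscillate
    like cis (\<tau> * |\<xi>|^2).\<close>
  define \<zeta> where "\<zeta> n = Complex (1 / real (Suc n)) (- \<tau>)" for n
  have \<zeta>: "Re (\<zeta> n) > 0" for n by (simp add: \<zeta>_def)
  let ?B = "sqrt (pi / \<bar>\<tau>\<bar>) ^ (DIM('a) - 1) * sqrt (pi / 2)"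
  have B: "cmod (fourier (anisotropic_gauss (\<zeta> n) a) z) \<le> ?B" for n z
  proof -
    have "\<bar>\<tau>\<bar> \<le> cmod (\<zeta> n)" using abs_Im_le_cmod[of "\<zeta> n"] by (simp add: \<zeta>_def)
    hence "pi / cmod (\<zeta> n) \<le> pi / \<bar>\<tau>\<bar>" using ts by (intro divide_left_mono mult_pos_pos) (auto simp: \<tau>_def)
    hence "sqrt (pi / cmod (\<zeta> n)) ^ (DIM('a) - 1) * sqrt (pi / 2) \<le> ?B"
      by (intro mult_right_mono power_mono) auto
    thus ?thesis using norm_fourier_anisotropic_gauss[OF \<zeta>[of n] a, of z] by linarith
  qed
  note L = fourier_Plancherel(1)[OF F] fourier_Plancherel(1)[OF G]
  note i = integrable_ip[OF L]
  let ?f = "\<lambda>n \<xi>. anisotropic_gauss (\<zeta> n) a \<xi> * (fourier F \<xi> * cnj (fourier G \<xi>))"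
  have e: "exp (- \<zeta> n * of_real ((norm \<xi>)\<^sup>2)) = of_real (exp (- (norm \<xi>)\<^sup>2 / real (Suc n))) * cis (\<tau> * (norm \<xi>)\<^sup>2)" for n and \<xi> :: 'a
  proof -
    have "- \<zeta> n * of_real ((norm \<xi>)\<^sup>2) = of_real (- (norm \<xi>)\<^sup>2 / real (Suc n)) + \<i> * of_real (\<tau> * (norm \<xi>)\<^sup>2)"
      by (auto simp: \<zeta>_def complex_eq_iff)
    thus ?thesis unfolding cis_conv_exp exp_of_real[symmetric] exp_add[symmetric] by simp
  qed
  have nb: "cmod (anisotropic_gauss (\<zeta> n) a \<xi>) \<le> 1" for n and \<xi> :: 'a
    unfolding e norm_mult norm_of_real by (simp add: mult_le_one)
  have lim: "(\<lambda>n. LINT \<xi>|lborel. ?f n \<xi>) \<longlonglongrightarrow> (LINT \<xi>|lborel. adjoint_flow a t F \<xi> * cnj (adjoint_flow a s G \<xi>))"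
  proof (rule integral_dominated_convergence[where w = "\<lambda>\<xi>. cmod (fourier F \<xi> * cnj (fourier G \<xi>))"])
    show "(\<lambda>\<xi>. adjoint_flow a t F \<xi> * cnj (adjoint_flow a s G \<xi>)) \<in> borel_measurable lborel"
      by (intro borel_measurable_integrable integrable_ip adjoint_flow_L2 F G)
    show "?f n \<in> borel_measurable lborel" for n
      by (rule borel_measurable_times[OF borel_measurable_integrable[OF integrable_anisotropic_gauss[OF \<zeta>]] borel_measurable_integrable[OF i]])
    show "integrable lborel (\<lambda>\<xi>. cmod (fourier F \<xi> * cnj (fourier G \<xi>)))" using i by simp
    show "AE \<xi> in lborel. norm (?f n \<xi>) \<le> cmod (fourier F \<xi> * cnj (fourier G \<xi>))" for n
      using nb by (intro AE_I2) (simp only: norm_mult[of "anisotropic_gauss (\<zeta> n) a _" "_ * _"] mult_left_le_one_le norm_ge_zero)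
    show "AE \<xi> in lborel. (\<lambda>n. ?f n \<xi>) \<longlonglongrightarrow> adjoint_flow a t F \<xi> * cnj (adjoint_flow a s G \<xi>)"
    proof (rule AE_I2)
      fix \<xi> :: 'a
      have "(\<lambda>n. - (norm \<xi>)\<^sup>2 * (1 / real (Suc n))) \<longlonglongrightarrow> - (norm \<xi>)\<^sup>2 * 0"
        by (intro tendsto_intros lim_1_over_n[THEN LIMSEQ_Suc])
      hence "(\<lambda>n. complex_of_real (exp (- (norm \<xi>)\<^sup>2 / real (Suc n))) * cis (\<tau> * (norm \<xi>)\<^sup>2) * of_real (exp (- 2 * (a \<bullet> \<xi>)\<^sup>2)) * (fourier F \<xi> * cnj (fourier G \<xi>)))
        \<longlonglongrightarrow> of_real (exp 0) * cis (\<tau> * (norm \<xi>)\<^sup>2) * of_real (exp (- 2 * (a \<bullet> \<xi>)\<^sup>2)) * (fourier F \<xi> * cnj (fourier G \<xi>))"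
        by (intro tendsto_intros) simp
      also have "of_real (exp 0) * cis (\<tau> * (norm \<xi>)\<^sup>2) * of_real (exp (- 2 * (a \<bullet> \<xi>)\<^sup>2)) * (fourier F \<xi> * cnj (fourier G \<xi>))
        = adjoint_flow a t F \<xi> * cnj (adjoint_flow a s G \<xi>)"
      proof -
        have 1: "cis (\<tau> * (norm \<xi>)\<^sup>2) = cis (t * (norm \<xi>)\<^sup>2) * cnj (cis (s * (norm \<xi>)\<^sup>2))"
          by (simp add: \<tau>_def cis_cnj cis_mult left_diff_distrib)
        have 2: "exp (- 2 * (a \<bullet> \<xi>)\<^sup>2) = exp (- (a \<bullet> \<xi>)\<^sup>2) * exp (- (a \<bullet> \<xi>)\<^sup>2)" by (simp flip: exp_add)
        show ?thesis unfolding 1 2 adjoint_flow_def by (simp add: mult_ac)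
      qed
      finally show "(\<lambda>n. ?f n \<xi>) \<longlonglongrightarrow> adjoint_flow a t F \<xi> * cnj (adjoint_flow a s G \<xi>)" unfolding e .
    qed
  qed
  have "norm (LINT \<xi>|lborel. ?f n \<xi>) \<le> ?B * (LINT x|lborel. cmod (F x)) * (LINT x|lborel. cmod (G x))" for n
    by (rule fourier_multiplier_bound[OF F(1) G(1) integrable_anisotropic_gauss[OF \<zeta>] B])
  hence "norm (LINT \<xi>|lborel. adjoint_flow a t F \<xi> * cnj (adjoint_flow a s G \<xi>)) \<le> ?B * (LINT x|lborel. cmod (F x)) * (LINT x|lborel. cmod (G x))"
    by (intro LIMSEQ_le_const2[OF tendsto_norm[OF lim]]) auto
  thus ?thesis by (simp add: ip_def \<tau>_def)
qed

definition unweight :: "real \<Rightarrow> 'a::euclidean_space \<Rightarrow> ('a \<Rightarrow> complex) \<Rightarrow> 'a \<Rightarrow> complex" where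
  "unweight M a \<psi> \<xi> = indicator {\<xi>. \<bar>a \<bullet> \<xi>\<bar> \<le> M} \<xi> * of_real (exp ((a \<bullet> \<xi>)\<^sup>2)) * \<psi> \<xi>"

lemma unweight_L2:
  assumes "\<psi> \<in> L2" shows "unweight M a \<psi> \<in> L2" and "nsq (unweight M a \<psi>) \<le> (exp (M\<^sup>2))\<^sup>2 * nsq \<psi>"
proof -
  note [measurable] = L2_measurable[OF assms]
  have m: "unweight M a \<psi> \<in> borel_measurable borel" unfolding unweight_def[abs_def] by measurable
  have b: "cmod (unweight M a \<psi> \<xi>) \<le> exp (M\<^sup>2) * cmod (\<psi> \<xi>)" for \<xi>
    using power_mono[of "\<bar>a \<bullet> \<xi>\<bar>" M 2] by (auto simp: unweight_def indicator_def norm_mult intro!: mult_right_mono)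
  show "unweight M a \<psi> \<in> L2" by (rule L2_bound[OF assms m b])
  show "nsq (unweight M a \<psi>) \<le> (exp (M\<^sup>2))\<^sup>2 * nsq \<psi>" by (rule nsq_bound[OF assms m b])
qed

text \<open>Parseval, once the weights are removed: on the strip the growing factor in
  \<open>unweight\<close> cancels the decaying one in \<open>adjoint_flow\<close>, and off the strip
  \<psi> vanishes almost everywhere.\<close>

lemma adjoint_flow_pairing:
  fixes v \<psi> F :: "'a::euclidean_space \<Rightarrow> complex"
  assumes v: "v \<in> L2" "fourier_L2 v (\<lambda>\<xi>. cis (- t * (norm \<xi>)\<^sup>2) * \<psi> \<xi>)"
    and supp: "AE \<xi> in lborel. \<bar>a \<bullet> \<xi>\<bar> > M \<longrightarrow> \<psi> \<xi> = 0" and \<psi>: "\<psi> \<in> L2"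
    and F: "integrable lborel F" "F \<in> L2"
  shows "ip (unweight M a \<psi>) (adjoint_flow a t F) = (2 * pi) ^ DIM('a) * ip v F"
proof -
  have "ip (unweight M a \<psi>) (adjoint_flow a t F) = ip (\<lambda>\<xi>. cis (- t * (norm \<xi>)\<^sup>2) * \<psi> \<xi>) (fourier F)"
    unfolding ip_def
  proof (rule integral_cong_AE)
    show "(\<lambda>\<xi>. unweight M a \<psi> \<xi> * cnj (adjoint_flow a t F \<xi>)) \<in> borel_measurable lborel"
      by (intro borel_measurable_integrable integrable_ip unweight_L2 adjoint_flow_L2 \<psi> F)
    show "(\<lambda>\<xi>. cis (- t * (norm \<xi>)\<^sup>2) * \<psi> \<xi> * cnj (fourier F \<xi>)) \<in> borel_measurable lborel"
      by (intro borel_measurable_integrable integrable_ip fourier_L2_seq[OF v] fourier_Plancherel F)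
    show "AE \<xi> in lborel. unweight M a \<psi> \<xi> * cnj (adjoint_flow a t F \<xi>) = cis (- t * (norm \<xi>)\<^sup>2) * \<psi> \<xi> * cnj (fourier F \<xi>)"
      using supp
    proof eventually_elim
      case (elim \<xi>)
      have "complex_of_real (exp ((a \<bullet> \<xi>)\<^sup>2)) * of_real (exp (- (a \<bullet> \<xi>)\<^sup>2)) = 1"
        unfolding of_real_mult[symmetric] exp_add[symmetric] by simp
      moreover have "cnj (adjoint_flow a t F \<xi>) = cis (- t * (norm \<xi>)\<^sup>2) * of_real (exp (- (a \<bullet> \<xi>)\<^sup>2)) * cnj (fourier F \<xi>)"
        by (simp add: adjoint_flow_def cis_cnj)
      ultimately show ?case using elim
        by (cases "\<bar>a \<bullet> \<xi>\<bar> \<le> M") (auto simp: unweight_def indicator_def mult_ac)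
    qed
  qed
  also have "\<dots> = (2 * pi) ^ DIM('a) * ip v F" by (rule fourier_L2_Parseval[OF v F])
  finally show ?thesis .
qed

section \<open>Sums over time grids\<close>

text \<open>A discrete substitute for comparison with the integral over [j - 1, j]. It combines ln y
  \<le> y - 1 at y = (j - 1) / j with 1 + x \<le> exp x.\<close>

lemma powr_neg_le_telescope:
  fixes \<sigma> :: real assumes "\<sigma> > 1" "j \<ge> 2"
  shows "real j powr - \<sigma> \<le> ((real j - 1) powr (1 - \<sigma>) - real j powr (1 - \<sigma>)) / (\<sigma> - 1)"
proof -
  define y where "y = (real j - 1) / real j"
  have y: "y > 0" using assms by (simp add: y_def)
  have j: "real j > 0" using assms by simp
  have y1: "1 - y = 1 / real j" using j by (simp add: y_def field_simps)
  have "1 + (\<sigma> - 1) / real j = 1 + (\<sigma> - 1) * (1 - y)" by (simp add: y1)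
  also have "\<dots> \<le> 1 + (1 - \<sigma>) * ln y"
    using mult_left_mono[OF ln_le_minus_one[OF y], of "\<sigma> - 1"] assms by (simp add: algebra_simps)
  also have "\<dots> \<le> exp ((1 - \<sigma>) * ln y)" by (rule exp_ge_add_one_self)
  also have "\<dots> = y powr (1 - \<sigma>)" using y by (simp add: powr_def)
  finally have "real j powr (1 - \<sigma>) * (1 + (\<sigma> - 1) / real j) \<le> real j powr (1 - \<sigma>) * y powr (1 - \<sigma>)"
    by (intro mult_left_mono) auto
  also have "\<dots> = (real j - 1) powr (1 - \<sigma>)"
    using j assms by (simp add: y_def powr_divide)
  finally have "real j powr (1 - \<sigma>) * ((\<sigma> - 1) / real j) \<le> (real j - 1) powr (1 - \<sigma>) - real j powr (1 - \<sigma>)"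
    by (simp add: algebra_simps)
  moreover have "real j powr (1 - \<sigma>) * ((\<sigma> - 1) / real j) = (\<sigma> - 1) * real j powr - \<sigma>"
    using j by (simp add: powr_diff powr_minus field_simps)
  ultimately have "(\<sigma> - 1) * real j powr - \<sigma> \<le> (real j - 1) powr (1 - \<sigma>) - real j powr (1 - \<sigma>)" by simp
  thus ?thesis using assms by (simp add: pos_le_divide_eq mult.commute)
qed

lemma sum_powr_tail_nat:
  fixes \<sigma> :: real assumes \<sigma>: "\<sigma> > 1" and "m \<ge> 1"
  shows "(\<Sum>j\<in>{m<..n}. real j powr - \<sigma>) \<le> real m powr (1 - \<sigma>) / (\<sigma> - 1)"
proof (cases "m \<le> n")
  case True
  have "(\<Sum>j\<in>{m<..n}. real j powr - \<sigma>) \<le> (real m powr (1 - \<sigma>) - real n powr (1 - \<sigma>)) / (\<sigma> - 1)"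
    using True
  proof (induction n rule: dec_induct)
    case (step n)
    have "{m<..Suc n} = insert (Suc n) {m<..n}" using step by auto
    hence "(\<Sum>j\<in>{m<..Suc n}. real j powr - \<sigma>) = real (Suc n) powr - \<sigma> + (\<Sum>j\<in>{m<..n}. real j powr - \<sigma>)" by simp
    also have "\<dots> \<le> (real n powr (1 - \<sigma>) - real (Suc n) powr (1 - \<sigma>)) / (\<sigma> - 1) + (real m powr (1 - \<sigma>) - real n powr (1 - \<sigma>)) / (\<sigma> - 1)"
      using powr_neg_le_telescope[OF \<sigma>, of "Suc n"] step assms(2) by (intro add_mono) auto
    also have "\<dots> = (real m powr (1 - \<sigma>) - real (Suc n) powr (1 - \<sigma>)) / (\<sigma> - 1)"
      by (simp add: diff_divide_distrib)
    finally show ?case .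
  qed simp
  also have "\<dots> \<le> real m powr (1 - \<sigma>) / (\<sigma> - 1)" using \<sigma> by (intro divide_right_mono) auto
  finally show ?thesis .
qed (use \<sigma> in simp)

lemma sum_powr_initial_nat:
  fixes \<gamma> :: real assumes \<gamma>: "0 < \<gamma>" "\<gamma> < 1"
  shows "(\<Sum>j\<in>{1..n}. real j powr - \<gamma>) \<le> real n powr (1 - \<gamma>) / (1 - \<gamma>)"
proof (induction n)
  case (Suc n)
  let ?a = "1 - \<gamma>"
  have "real n powr ?a \<le> real (Suc n) powr ?a - ?a * real (Suc n) powr - \<gamma>"
  proof (cases "n = 0")
    case True thus ?thesis using \<gamma> by simp
  next
    case False
    define y where "y = real n / real (Suc n)"
    have y: "y > 0" using False by (simp add: y_def)
    \<comment> \<open>Weighted arithmetic-geometric mean of y and 1 with weights 1 - \<gamma> and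
      \<gamma>; this is the concavity of the power 1 - \<gamma>.\<close>
    have "y powr ?a * 1 powr \<gamma> \<le> ?a * y + \<gamma> * 1"
      using \<gamma> y by (intro Youngs_inequality_0) auto
    hence i1: "real (Suc n) powr ?a * y powr ?a \<le> real (Suc n) powr ?a * (?a * y + \<gamma>)" by (intro mult_left_mono) auto
    have i2: "real (Suc n) powr ?a * y powr ?a = real n powr ?a"
      unfolding y_def using False by (simp add: powr_divide)
    have i3: "?a * y + \<gamma> = 1 - ?a / real (Suc n)" by (simp add: y_def field_simps)
    have i4: "real (Suc n) powr ?a * (1 - ?a / real (Suc n)) = real (Suc n) powr ?a - ?a * real (Suc n) powr - \<gamma>"
    proof -
      have e: "real (Suc n) powr ?a = real (Suc n) * real (Suc n) powr - \<gamma>"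
        by (simp add: powr_diff powr_minus divide_inverse)
      have "N * P * (1 - a / N) = N * P - a * P" if "N \<noteq> 0" for N P a :: real
        using that by (simp add: field_simps)
      from this[of "real (Suc n)"] show ?thesis unfolding e by simp
    qed
    show ?thesis using i1 unfolding i2 i3 i4 .
  qed
  hence "real (Suc n) powr - \<gamma> \<le> (real (Suc n) powr ?a - real n powr ?a) / ?a"
    using \<gamma> by (simp add: field_simps)
  hence "(\<Sum>j\<in>{1..Suc n}. real j powr - \<gamma>) \<le> real n powr ?a / ?a + (real (Suc n) powr ?a - real n powr ?a) / ?a"
    using Suc by simp
  thus ?case by (simp add: diff_divide_distrib)
qed simp

text \<open>Each distance to n is attained at most twice, once on either side.\<close>

lemma sum_int_abs_le:
  fixes g :: "nat \<Rightarrow> real"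
  assumes J: "finite J" and K: "finite K" "\<And>j. j \<in> J \<Longrightarrow> nat \<bar>j - n\<bar> \<in> K" and g: "\<And>k. k \<in> K \<Longrightarrow> g k \<ge> 0"
  shows "(\<Sum>j\<in>J. g (nat \<bar>j - n\<bar>)) \<le> 2 * (\<Sum>k\<in>K. g k)"
proof -
  have *: "(\<Sum>j\<in>I. g (nat \<bar>j - n\<bar>)) \<le> (\<Sum>k\<in>K. g k)" if I: "I \<subseteq> J" "inj_on (\<lambda>j. nat \<bar>j - n\<bar>) I" for I
  proof -
    have "(\<Sum>j\<in>I. g (nat \<bar>j - n\<bar>)) = (\<Sum>k\<in>(\<lambda>j. nat \<bar>j - n\<bar>) ` I. g k)"
      using sum.reindex[OF I(2), of g] by simp
    also have "\<dots> \<le> (\<Sum>k\<in>K. g k)" using I K g by (intro sum_mono2) auto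
    finally show ?thesis .
  qed
  have "(\<Sum>j\<in>J. g (nat \<bar>j - n\<bar>)) = (\<Sum>j\<in>{j\<in>J. n \<le> j}. g (nat \<bar>j - n\<bar>)) + (\<Sum>j\<in>{j\<in>J. j < n}. g (nat \<bar>j - n\<bar>))"
    using J by (subst sum.union_disjoint[symmetric]) (auto intro!: sum.cong)
  also have "\<dots> \<le> (\<Sum>k\<in>K. g k) + (\<Sum>k\<in>K. g k)"
    by (intro add_mono *) (auto simp: inj_on_def)
  finally show ?thesis by simp
qed

text \<open>The value 1 on the diagonal makes \<open>h * gap n n\<close> the grid step.\<close>

definition gap :: "int \<Rightarrow> int \<Rightarrow> real" where "gap n m = max 1 \<bar>real_of_int (n - m)\<bar>"

lemma gap_pos: "gap n m > 0" by (auto simp: gap_def)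
lemma gap_commute: "gap n m = gap m n" by (auto simp: gap_def)
lemma gap_nat: "gap n m = max 1 (real (nat \<bar>m - n\<bar>))" by (auto simp: gap_def)

text \<open>One factor 2 counts the two sides of the diagonal; 2 powr (\<sigma> - 1) pays for
  replacing a real cut \<rho> \<ge> 1 by its floor, which is at least \<rho> / 2.\<close>

definition tail_const :: "real \<Rightarrow> real" where "tail_const \<sigma> = 2 * 2 powr (\<sigma> - 1) / (\<sigma> - 1)"

lemma tail_const_pos: "\<sigma> > 1 \<Longrightarrow> tail_const \<sigma> > 0" by (simp add: tail_const_def)

lemma sum_gap_tail:
  fixes \<sigma> \<rho> :: real assumes \<sigma>: "\<sigma> > 1" and \<rho>: "\<rho> \<ge> 1" and N: "finite N"
  shows "(\<Sum>m\<in>{m\<in>N. gap n m > \<rho>}. gap n m powr - \<sigma>) \<le> tail_const \<sigma> * \<rho> powr (1 - \<sigma>)"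
proof -
  define k where "k = nat \<lfloor>\<rho>\<rfloor>"
  have "k \<ge> 1" "real k \<le> \<rho>" "\<rho> < real k + 1"
    using \<rho> unfolding k_def by linarith+
  moreover from this have "\<rho> / 2 \<le> real k" by linarith
  ultimately have k: "k \<ge> 1" "real k \<le> \<rho>" "\<rho> < real k + 1" "\<rho> / 2 \<le> real k" by blast+
  let ?J = "{m\<in>N. gap n m > \<rho>}"
  define L where "L = Max (insert 0 ((\<lambda>m. nat \<bar>m - n\<bar>) ` N))"
  have L: "nat \<bar>m - n\<bar> \<le> L" if "m \<in> N" for m unfolding L_def using that N by (intro Max_ge) auto
  have "(\<Sum>m\<in>?J. gap n m powr - \<sigma>) = (\<Sum>m\<in>?J. real (nat \<bar>m - n\<bar>) powr - \<sigma>)"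
    using \<rho> by (intro sum.cong refl) (auto simp: gap_def abs_minus_commute)
  also have "\<dots> \<le> 2 * (\<Sum>j\<in>{k<..L}. real j powr - \<sigma>)"
  proof (rule sum_int_abs_le)
    show "nat \<bar>j - n\<bar> \<in> {k<..L}" if "j \<in> ?J" for j
    proof -
      have "real (nat \<bar>j - n\<bar>) > real k" using that k \<rho> by (auto simp: gap_def)
      thus ?thesis using that L[of j] by auto
    qed
  qed (use N in auto)
  also have "\<dots> \<le> 2 * (real k powr (1 - \<sigma>) / (\<sigma> - 1))"
    using sum_powr_tail_nat[OF \<sigma> k(1), of L] by simp
  also have "\<dots> \<le> 2 * ((\<rho> / 2) powr (1 - \<sigma>) / (\<sigma> - 1))"
    using k \<rho> \<sigma> by (intro mult_left_mono divide_right_mono powr_mono2') auto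
  also have "(\<rho> / 2) powr (1 - \<sigma>) = \<rho> powr (1 - \<sigma>) * 2 powr (\<sigma> - 1)"
    using \<rho> by (simp add: powr_divide powr_diff)
  finally show ?thesis by (simp add: tail_const_def mult_ac)
qed

lemma sum_gap_near:
  fixes \<gamma> R :: real assumes \<gamma>: "0 < \<gamma>" "\<gamma> < 1" and R: "R \<ge> 1" and N: "finite N"
  shows "(\<Sum>m\<in>{m\<in>N. gap n m \<le> R}. gap n m powr - \<gamma>) \<le> (2 + 2 / (1 - \<gamma>)) * R powr (1 - \<gamma>)"
proof -
  define k where "k = nat \<lfloor>R\<rfloor>"
  have k: "k \<ge> 1" "real k \<le> R" "R < real k + 1" using R unfolding k_def by linarith+
  let ?J = "{m\<in>N. gap n m \<le> R}"
  have "(\<Sum>m\<in>?J. gap n m powr - \<gamma>) \<le> 2 * (\<Sum>j\<in>{0..k}. max 1 (real j) powr - \<gamma>)"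
    unfolding gap_nat
  proof (rule sum_int_abs_le)
    show "nat \<bar>j - n\<bar> \<in> {0..k}" if "j \<in> {m \<in> N. max 1 (real (nat \<bar>m - n\<bar>)) \<le> R}" for j
    proof -
      have "real (nat \<bar>j - n\<bar>) \<le> R" using that by auto
      hence "real (nat \<bar>j - n\<bar>) < real k + 1" using k by linarith
      thus ?thesis by simp
    qed
  qed (use N in auto)
  also have "{0..k} = insert 0 {1..k}" by auto
  \<comment> \<open>Index 0 is the diagonal, where \<open>gap\<close> is 1; its contribution 1 is
    absorbed by R powr (1 - \<gamma>) \<ge> 1.\<close>
  also have "(\<Sum>j\<in>insert 0 {1..k}. max 1 (real j) powr - \<gamma>) = 1 + (\<Sum>j\<in>{1..k}. real j powr - \<gamma>)"
    by (simp add: sum.insert_if max_def)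
  also have "\<dots> \<le> R powr (1 - \<gamma>) + R powr (1 - \<gamma>) / (1 - \<gamma>)"
  proof (rule add_mono)
    show "1 \<le> R powr (1 - \<gamma>)" using R \<gamma> by (intro ge_one_powr_ge_zero) auto
    have "(\<Sum>j\<in>{1..k}. real j powr - \<gamma>) \<le> real k powr (1 - \<gamma>) / (1 - \<gamma>)" by (rule sum_powr_initial_nat[OF \<gamma>])
    also have "\<dots> \<le> R powr (1 - \<gamma>) / (1 - \<gamma>)" using k \<gamma> by (intro divide_right_mono powr_mono2) auto
    finally show "(\<Sum>j\<in>{1..k}. real j powr - \<gamma>) \<le> R powr (1 - \<gamma>) / (1 - \<gamma>)" .
  qed
  finally show ?thesis by (simp add: algebra_simps)
qed

lemma card_gap_near:
  assumes R: "R \<ge> 1" and N: "finite N"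
  shows "real (card {m\<in>N. gap n m \<le> R}) \<le> 4 * R"
proof -
  define k where "k = nat \<lfloor>R\<rfloor>"
  have k: "k \<ge> 1" "real k \<le> R" "R < real k + 1" using R unfolding k_def by linarith+
  have "(\<Sum>m\<in>{m\<in>N. gap n m \<le> R}. (\<lambda>_. 1::real) (nat \<bar>m - n\<bar>)) \<le> 2 * (\<Sum>j\<in>{0..k}. 1)"
    unfolding gap_nat
  proof (rule sum_int_abs_le)
    show "nat \<bar>j - n\<bar> \<in> {0..k}" if "j \<in> {m \<in> N. max 1 (real (nat \<bar>m - n\<bar>)) \<le> R}" for j
    proof -
      have "real (nat \<bar>j - n\<bar>) \<le> R" using that by auto
      hence "real (nat \<bar>j - n\<bar>) < real k + 1" using k by linarith
      thus ?thesis by simp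
    qed
  qed (use N in auto)
  thus ?thesis using k by simp
qed

text \<open>Cauchy-Schwarz over the pairs (i, j) with sqrt (k i j) given to each factor. A common
  bound S for rows and columns fits the symmetric kernels below.\<close>

lemma Schur_test:
  fixes k :: "'i \<Rightarrow> 'j \<Rightarrow> real"
  assumes k: "\<And>i j. i \<in> I \<Longrightarrow> j \<in> J \<Longrightarrow> k i j \<ge> 0"
    and r: "\<And>i. i \<in> I \<Longrightarrow> (\<Sum>j\<in>J. k i j) \<le> S" and c: "\<And>j. j \<in> J \<Longrightarrow> (\<Sum>i\<in>I. k i j) \<le> S"
    and S: "S \<ge> 0"
  shows "(\<Sum>i\<in>I. \<Sum>j\<in>J. k i j * x i * y j) \<le> S * sqrt (\<Sum>i\<in>I. (x i)\<^sup>2) * sqrt (\<Sum>j\<in>J. (y j)\<^sup>2)"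
proof -
  let ?P = "I \<times> J"
  let ?a = "\<lambda>p. sqrt (k (fst p) (snd p)) * x (fst p)" and ?b = "\<lambda>p. sqrt (k (fst p) (snd p)) * y (snd p)"
  have "(\<Sum>i\<in>I. \<Sum>j\<in>J. k i j * x i * y j) = (\<Sum>p\<in>?P. ?a p * ?b p)"
    unfolding sum.cartesian_product
    by (intro sum.cong refl) (auto simp: k real_sqrt_mult_self mult_ac)
  also have "\<dots> \<le> sqrt ((\<Sum>p\<in>?P. (?a p)\<^sup>2) * (\<Sum>p\<in>?P. (?b p)\<^sup>2))"
    by (rule real_le_rsqrt) (rule Cauchy_Schwarz_ineq_sum)
  also have "\<dots> \<le> sqrt ((S * (\<Sum>i\<in>I. (x i)\<^sup>2)) * (S * (\<Sum>j\<in>J. (y j)\<^sup>2)))"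
  proof (rule real_sqrt_le_mono, rule mult_mono)
    have "(\<Sum>p\<in>?P. (?a p)\<^sup>2) = (\<Sum>i\<in>I. \<Sum>j\<in>J. k i j * (x i)\<^sup>2)"
      unfolding sum.cartesian_product by (intro sum.cong refl) (auto simp: k power_mult_distrib)
    also have "\<dots> = (\<Sum>i\<in>I. (\<Sum>j\<in>J. k i j) * (x i)\<^sup>2)" by (simp add: sum_distrib_right)
    also have "\<dots> \<le> (\<Sum>i\<in>I. S * (x i)\<^sup>2)" by (intro sum_mono mult_right_mono r) auto
    finally show "(\<Sum>p\<in>?P. (?a p)\<^sup>2) \<le> S * (\<Sum>i\<in>I. (x i)\<^sup>2)" by (simp add: sum_distrib_left)
    have "(\<Sum>p\<in>?P. (?b p)\<^sup>2) = (\<Sum>i\<in>I. \<Sum>j\<in>J. k i j * (y j)\<^sup>2)"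
      unfolding sum.cartesian_product by (intro sum.cong refl) (auto simp: k power_mult_distrib)
    also have "\<dots> = (\<Sum>j\<in>J. \<Sum>i\<in>I. k i j * (y j)\<^sup>2)" by (rule sum.swap)
    also have "\<dots> = (\<Sum>j\<in>J. (\<Sum>i\<in>I. k i j) * (y j)\<^sup>2)" by (simp add: sum_distrib_right)
    also have "\<dots> \<le> (\<Sum>j\<in>J. S * (y j)\<^sup>2)" by (intro sum_mono mult_right_mono c) auto
    finally show "(\<Sum>p\<in>?P. (?b p)\<^sup>2) \<le> S * (\<Sum>j\<in>J. (y j)\<^sup>2)" by (simp add: sum_distrib_left)
  qed (use S in \<open>auto intro!: sum_nonneg mult_nonneg_nonneg\<close>)
  also have "\<dots> = S * sqrt (\<Sum>i\<in>I. (x i)\<^sup>2) * sqrt (\<Sum>j\<in>J. (y j)\<^sup>2)"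
    using S by (simp add: real_sqrt_mult mult_ac) 
  finally show ?thesis .
qed

text \<open>Moving the centre from s0 to its floor changes distances by at most 1 and costs the
  factor 2 powr \<delta>; the rest is a geometric series on each side.\<close>

lemma sum_geometric_int:
  fixes \<delta> s0 :: real assumes \<delta>: "\<delta> > 0" and J: "finite J"
  shows "(\<Sum>j\<in>J. 2 powr (- \<delta> * \<bar>real_of_int j - s0\<bar>)) \<le> 2 powr \<delta> * (2 / (1 - 2 powr - \<delta>))"
proof -
  define n where "n = \<lfloor>s0\<rfloor>"
  define x :: real where "x = 2 powr - \<delta>"
  have x: "0 < x" "x < 1" using \<delta> by (auto simp: x_def powr_less_one)
  define L where "L = Max (insert 0 ((\<lambda>m. nat \<bar>m - n\<bar>) ` J))"
  have L: "nat \<bar>m - n\<bar> \<le> L" if "m \<in> J" for m unfolding L_def using that J by (intro Max_ge) auto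
  have "(\<Sum>j\<in>J. 2 powr (- \<delta> * \<bar>real_of_int j - s0\<bar>)) \<le> (\<Sum>j\<in>J. 2 powr \<delta> * x ^ nat \<bar>j - n\<bar>)"
  proof (rule sum_mono)
    fix j
    have "\<bar>real_of_int j - s0\<bar> \<ge> real (nat \<bar>j - n\<bar>) - 1" unfolding n_def by linarith
    hence "\<delta> * \<bar>real_of_int j - s0\<bar> \<ge> \<delta> * (real (nat \<bar>j - n\<bar>) - 1)" using \<delta> by (intro mult_left_mono) auto
    hence "- \<delta> * \<bar>real_of_int j - s0\<bar> \<le> \<delta> + (- \<delta>) * real (nat \<bar>j - n\<bar>)" by (simp add: algebra_simps)
    hence "2 powr (- \<delta> * \<bar>real_of_int j - s0\<bar>) \<le> 2 powr (\<delta> + (- \<delta>) * real (nat \<bar>j - n\<bar>))"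
      by (intro powr_mono) auto
    also have "\<dots> = 2 powr \<delta> * x ^ nat \<bar>j - n\<bar>"
      unfolding powr_add x_def by (subst powr_realpow[symmetric]) (auto simp: powr_powr)
    finally show "2 powr (- \<delta> * \<bar>real_of_int j - s0\<bar>) \<le> 2 powr \<delta> * x ^ nat \<bar>j - n\<bar>" .
  qed
  also have "\<dots> = 2 powr \<delta> * (\<Sum>j\<in>J. x ^ nat \<bar>j - n\<bar>)" by (simp add: sum_distrib_left)
  also have "(\<Sum>j\<in>J. x ^ nat \<bar>j - n\<bar>) \<le> 2 * (\<Sum>k\<in>{..L}. x ^ k)"
    using L x J by (intro sum_int_abs_le) auto
  also have "(\<Sum>k\<in>{..L}. x ^ k) \<le> 1 / (1 - x)"
    using x sum_le_suminf[of "\<lambda>k. x ^ k" "{..L}"] suminf_geometric[of x] summable_geometric[of x] by auto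
  finally show ?thesis by (simp add: x_def)
qed

text \<open>Because \<alpha> + \<beta> = 1/2, the two exponentials cross at s0 = - 2 * log 2 D,
  where both equal D powr (2 * \<alpha>). Away from s0 the minimum decays at rate \<alpha> on one
  side and \<beta> on the other.\<close>

lemma sum_min_exponentials:
  fixes \<alpha> \<beta> D :: real assumes \<alpha>: "\<alpha> > 0" and \<beta>: "\<beta> > 0" and \<alpha>\<beta>: "\<alpha> + \<beta> = 1/2" and D: "D > 0" and J: "finite J"
  shows "(\<Sum>s\<in>J. min (2 powr (- real_of_int s * \<alpha>)) (D * 2 powr (real_of_int s * \<beta>)))
    \<le> (2 powr min \<alpha> \<beta> * (2 / (1 - 2 powr - min \<alpha> \<beta>))) * D powr (2 * \<alpha>)"
proof -
  define s0 where "s0 = - 2 * log 2 D"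
  define \<delta> where "\<delta> = min \<alpha> \<beta>"
  have Ds: "D = 2 powr (- s0 / 2)" using D by (simp add: s0_def)
  have D2: "D powr (2 * \<alpha>) = 2 powr (- s0 * \<alpha>)" unfolding Ds powr_powr by simp
  have "(\<Sum>s\<in>J. min (2 powr (- real_of_int s * \<alpha>)) (D * 2 powr (real_of_int s * \<beta>)))
    \<le> (\<Sum>s\<in>J. 2 powr (- s0 * \<alpha>) * 2 powr (- \<delta> * \<bar>real_of_int s - s0\<bar>))"
  proof (rule sum_mono)
    fix s :: int
    show "min (2 powr (- real_of_int s * \<alpha>)) (D * 2 powr (real_of_int s * \<beta>)) \<le> 2 powr (- s0 * \<alpha>) * 2 powr (- \<delta> * \<bar>real_of_int s - s0\<bar>)"
    proof (cases "real_of_int s \<ge> s0")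
      case True
      have "\<delta> * (real_of_int s - s0) \<le> \<alpha> * (real_of_int s - s0)" using True by (intro mult_right_mono) (auto simp: \<delta>_def)
      hence "2 powr (- real_of_int s * \<alpha>) \<le> 2 powr (- s0 * \<alpha> + - \<delta> * \<bar>real_of_int s - s0\<bar>)"
        using True by (intro powr_mono) (auto simp: algebra_simps)
      thus ?thesis by (simp only: powr_add min.coboundedI1)
    next
      case False
      have "\<delta> * (s0 - real_of_int s) \<le> \<beta> * (s0 - real_of_int s)" using False by (intro mult_right_mono) (auto simp: \<delta>_def)
      moreover have "s0 / 2 = s0 * \<alpha> + s0 * \<beta>" using \<alpha>\<beta> by (metis distrib_left mult.right_neutral times_divide_eq_right)
      ultimately have "2 powr (- s0 / 2 + real_of_int s * \<beta>) \<le> 2 powr (- s0 * \<alpha> + - \<delta> * \<bar>real_of_int s - s0\<bar>)"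
        using False by (intro powr_mono) (auto simp: algebra_simps)
      thus ?thesis unfolding Ds by (simp only: powr_add min.coboundedI2)
    qed
  qed
  also have "\<dots> = 2 powr (- s0 * \<alpha>) * (\<Sum>s\<in>J. 2 powr (- \<delta> * \<bar>real_of_int s - s0\<bar>))" by (simp add: sum_distrib_left)
  also have "\<dots> \<le> 2 powr (- s0 * \<alpha>) * (2 powr \<delta> * (2 / (1 - 2 powr - \<delta>)))"
    using \<alpha> \<beta> by (intro mult_left_mono sum_geometric_int J) (auto simp: \<delta>_def)
  finally show ?thesis unfolding D2 by (simp add: \<delta>_def mult_ac)
qed

text \<open>The embedding of l^p into l^2: every entry is at most the l^p norm X, and a square
  splits into the powers p and 2 - p.\<close>

lemma sum_squares_le_powr:
  fixes x :: "'i \<Rightarrow> real" assumes p: "0 < p" "p \<le> 2" and I: "finite I" and x: "\<And>i. i \<in> I \<Longrightarrow> x i \<ge> 0"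
  shows "(\<Sum>i\<in>I. (x i)\<^sup>2) \<le> (\<Sum>i\<in>I. x i powr p) powr (2 / p)"
proof -
  define X where "X = (\<Sum>i\<in>I. x i powr p) powr (1 / p)"
  have S: "(\<Sum>i\<in>I. x i powr p) \<ge> 0" by (intro sum_nonneg) auto
  have Xp: "X powr p = (\<Sum>i\<in>I. x i powr p)" using p S by (simp add: X_def powr_powr)
  have X2: "X powr 2 = (\<Sum>i\<in>I. x i powr p) powr (2 / p)" by (simp add: X_def powr_powr)
  have xX: "x i \<le> X" if "i \<in> I" for i
  proof -
    have "x i powr p \<le> (\<Sum>i\<in>I. x i powr p)" using that I by (intro member_le_sum) auto
    hence "(x i powr p) powr (1 / p) \<le> X" unfolding X_def using p by (intro powr_mono2) auto
    thus ?thesis using p x[OF that] by (simp add: powr_powr)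
  qed
  have "(\<Sum>i\<in>I. (x i)\<^sup>2) \<le> (\<Sum>i\<in>I. x i powr p * X powr (2 - p))"
  proof (rule sum_mono)
    fix i assume i: "i \<in> I"
    show "(x i)\<^sup>2 \<le> x i powr p * X powr (2 - p)"
    proof (cases "x i = 0")
      case False
      hence pos: "x i > 0" using x[OF i] by simp
      have "(x i)\<^sup>2 = x i powr p * x i powr (2 - p)"
        using pos by (simp flip: powr_add add: powr_numeral)
      also have "\<dots> \<le> x i powr p * X powr (2 - p)"
        using pos p xX[OF i] by (intro mult_left_mono powr_mono2) auto
      finally show ?thesis .
    qed simp
  qed
  also have "\<dots> = X powr p * X powr (2 - p)" by (simp add: Xp sum_distrib_right)
  also have "\<dots> = X powr 2" by (simp flip: powr_add)
  finally show ?thesis by (simp add: X2)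
qed

section \<open>Discrete Hardy-Littlewood-Sobolev inequality\<close>

text \<open>Twice, by symmetry, the near constant of \<open>sum_gap_near\<close> plus the far
  constant obtained from Young's inequality.\<close>

definition HLS_const :: "real \<Rightarrow> real" where
  "HLS_const \<gamma> = 2 * ((2 + 2 / (1 - \<gamma>)) + (1 + tail_const 2))"

lemma HLS_const_pos: "0 < \<gamma> \<Longrightarrow> \<gamma> < 1 \<Longrightarrow> HLS_const \<gamma> > 0"
  using tail_const_pos[of 2] by (auto simp: HLS_const_def intro!: add_pos_pos)

text \<open>Only the pairs with \<open>x m \<le> x n\<close> matter, by symmetry. For these the kernel is split at distance
  \<open>R = x n powr - p\<close>; near terms are bounded by \<open>x m \<le> x n\<close>, far terms by Young's inequality.\<close>

lemma discrete_HLS_normalised: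
  fixes x :: "int \<Rightarrow> real"
  assumes \<gamma>: "0 < \<gamma>" "\<gamma> < 1" and N: "finite N" and x: "\<And>n. n \<in> N \<Longrightarrow> x n \<ge> 0"
    and p: "p = 2 / (2 - \<gamma>)" and S: "(\<Sum>n\<in>N. x n powr p) \<le> 1"
  shows "(\<Sum>n\<in>N. \<Sum>m\<in>N. x n * x m * gap n m powr - \<gamma>) \<le> HLS_const \<gamma>"
proof -
  define K where "K = (2 + 2 / (1 - \<gamma>)) + (1 + tail_const 2)"
  have K0: "K \<ge> 0" using HLS_const_pos[OF \<gamma>] by (simp add: K_def HLS_const_def)
  \<comment> \<open>With R = x n powr - p, the exponent identities \<open>e1\<close> and
    \<open>e2\<close> turn the near and the far bound into multiples of the same power x n powr (p -
    1).\<close>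
  have pp: "p > 1" using \<gamma> by (simp add: p)
  have e1: "1 - p * (1 - \<gamma>) = p - 1" and e2: "p * (\<gamma> / 2) = p - 1" using \<gamma> by (auto simp: p field_simps)
  \<comment> \<open>Hence R \<ge> 1, as required by the sums over \<open>gap\<close>.\<close>
  have x1: "x n \<le> 1" if "n \<in> N" for n
  proof (rule ccontr)
    assume "\<not> x n \<le> 1"
    hence "1 < x n powr p" using pp powr_less_mono2[of p 1 "x n"] by simp
    also have "\<dots> \<le> (\<Sum>n\<in>N. x n powr p)" using that N by (intro member_le_sum) auto
    finally show False using S by simp
  qed
  have main: "(\<Sum>m\<in>{m\<in>N. x m \<le> x n}. x m * gap n m powr - \<gamma>) \<le> K * x n powr (p - 1)" if n: "n \<in> N" and xn: "x n > 0" for n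
  proof -
    define R where "R = x n powr - p"
    have R: "R \<ge> 1" using xn x1[OF n] pp unfolding R_def by (simp add: powr_minus field_simps powr_le1)
    let ?A = "{m\<in>N. x m \<le> x n}"
    have near: "(\<Sum>m\<in>{m\<in>?A. gap n m \<le> R}. x m * gap n m powr - \<gamma>) \<le> (2 + 2 / (1 - \<gamma>)) * x n powr (p - 1)"
    proof -
      have "(\<Sum>m\<in>{m\<in>?A. gap n m \<le> R}. x m * gap n m powr - \<gamma>) \<le> (\<Sum>m\<in>{m\<in>?A. gap n m \<le> R}. x n * gap n m powr - \<gamma>)"
        by (intro sum_mono mult_right_mono) auto
      also have "\<dots> = x n * (\<Sum>m\<in>{m\<in>?A. gap n m \<le> R}. gap n m powr - \<gamma>)" by (simp add: sum_distrib_left)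
      also have "\<dots> \<le> x n * ((2 + 2 / (1 - \<gamma>)) * R powr (1 - \<gamma>))"
        using xn N by (intro mult_left_mono sum_gap_near \<gamma> R) auto
      also have "x n * ((2 + 2 / (1 - \<gamma>)) * R powr (1 - \<gamma>)) = (2 + 2 / (1 - \<gamma>)) * (x n powr 1 * x n powr (- p * (1 - \<gamma>)))"
        using xn by (simp add: R_def powr_powr)
      also have "x n powr 1 * x n powr (- p * (1 - \<gamma>)) = x n powr (p - 1)"
        unfolding powr_add[symmetric] e1[symmetric] by simp
      finally show ?thesis .
    qed
    have far: "(\<Sum>m\<in>{m\<in>?A. gap n m > R}. x m * gap n m powr - \<gamma>) \<le> (1 + tail_const 2) * x n powr (p - 1)"
    proof -
      \<comment> \<open>Young's inequality with the conjugate exponents p and 2 / \<gamma>. The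
        factor R powr (\<gamma> / 2) in \<open>b\<close> is chosen so that b powr (2 / \<gamma>) = R
        * gap powr - 2, whose sum beyond R is bounded by a constant.\<close>
      have t: "x m * gap n m powr - \<gamma> \<le> R powr - (\<gamma> / 2) * (x m powr p + R * gap n m powr - 2)" if m: "m \<in> N" for m
      proof -
        define b where "b = R powr (\<gamma> / 2) * gap n m powr - \<gamma>"
        have "x m * b \<le> x m powr p / p + b powr (2 / \<gamma>) / (2 / \<gamma>)"
          by (rule Youngs_inequality) (use \<gamma> pp x[OF m] in \<open>auto simp: b_def p field_simps\<close>)
        also have "\<dots> \<le> x m powr p + b powr (2 / \<gamma>)"
          using pp \<gamma> by (intro add_mono) (auto simp: divide_le_eq mult_le_cancel_left1 intro!: mult_left_mono)
        also have "b powr (2 / \<gamma>) = R * gap n m powr - 2"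
          using R \<gamma> gap_pos[of n m] unfolding b_def by (simp add: powr_mult powr_powr)
        finally have "R powr - (\<gamma> / 2) * (x m * b) \<le> R powr - (\<gamma> / 2) * (x m powr p + R * gap n m powr - 2)"
          by (intro mult_left_mono) auto
        moreover have "R powr - (\<gamma> / 2) * (x m * b) = x m * gap n m powr - \<gamma> * (R powr - (\<gamma> / 2) * R powr (\<gamma> / 2))"
          by (simp add: b_def mult_ac)
        moreover have "R powr - (\<gamma> / 2) * R powr (\<gamma> / 2) = 1" using R by (simp flip: powr_add)
        ultimately show ?thesis by simp
      qed
      have "(\<Sum>m\<in>{m\<in>?A. gap n m > R}. x m * gap n m powr - \<gamma>) \<le> (\<Sum>m\<in>{m\<in>N. gap n m > R}. R powr - (\<gamma> / 2) * (x m powr p + R * gap n m powr - 2))"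
      proof (rule order_trans[OF sum_mono sum_mono2])
        show "x m * gap n m powr - \<gamma> \<le> R powr - (\<gamma> / 2) * (x m powr p + R * gap n m powr - 2)" if "m \<in> {m\<in>?A. gap n m > R}" for m
          using t that by auto
      qed (use N R in auto)
      also have "\<dots> = R powr - (\<gamma> / 2) * ((\<Sum>m\<in>{m\<in>N. gap n m > R}. x m powr p) + R * (\<Sum>m\<in>{m\<in>N. gap n m > R}. gap n m powr - 2))"
        by (simp add: sum_distrib_left sum.distrib distrib_left)
      also have "\<dots> \<le> R powr - (\<gamma> / 2) * (1 + R * (tail_const 2 * R powr (1 - 2)))"
      proof (intro mult_left_mono add_mono)
        have "(\<Sum>m\<in>{m\<in>N. gap n m > R}. x m powr p) \<le> (\<Sum>m\<in>N. x m powr p)" using N by (intro sum_mono2) auto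
        thus "(\<Sum>m\<in>{m\<in>N. gap n m > R}. x m powr p) \<le> 1" using S by simp
        show "(\<Sum>m\<in>{m\<in>N. gap n m > R}. gap n m powr - 2) \<le> tail_const 2 * R powr (1 - 2)" by (rule sum_gap_tail) (use R N in auto)
      qed (use R in auto)
      also have "R * (tail_const 2 * R powr (1 - 2)) = tail_const 2" using R by (simp add: powr_minus field_simps)
      also have "R powr - (\<gamma> / 2) = x n powr (p - 1)" unfolding R_def powr_powr e2[symmetric] by simp
      finally show ?thesis by (simp add: mult_ac)
    qed
    have "(\<Sum>m\<in>?A. x m * gap n m powr - \<gamma>) = (\<Sum>m\<in>{m\<in>?A. gap n m \<le> R}. x m * gap n m powr - \<gamma>) + (\<Sum>m\<in>{m\<in>?A. gap n m > R}. x m * gap n m powr - \<gamma>)"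
      using N by (subst sum.union_disjoint[symmetric]) (auto intro!: sum.cong)
    thus ?thesis using near far by (simp add: K_def algebra_simps)
  qed
  let ?T = "\<lambda>n m. x n * x m * gap n m powr - \<gamma>"
  have half: "(\<Sum>n\<in>N. \<Sum>m\<in>N. if x m \<le> x n then ?T n m else 0) \<le> K"
  proof -
    have "(\<Sum>m\<in>N. if x m \<le> x n then ?T n m else 0) \<le> K * x n powr p" if n: "n \<in> N" for n
    proof -
      have "(\<Sum>m\<in>N. if x m \<le> x n then ?T n m else 0) = (\<Sum>m\<in>{m\<in>N. x m \<le> x n}. ?T n m)"
        using N by (simp add: sum.inter_filter)
      also have "\<dots> = x n * (\<Sum>m\<in>{m\<in>N. x m \<le> x n}. x m * gap n m powr - \<gamma>)"
        by (simp add: sum_distrib_left mult_ac)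
      also have "\<dots> \<le> K * x n powr p"
      proof (cases "x n = 0")
        case False
        hence pos: "x n > 0" using x[OF n] by simp
        have "x n * (\<Sum>m\<in>{m\<in>N. x m \<le> x n}. x m * gap n m powr - \<gamma>) \<le> x n powr 1 * (K * x n powr (p - 1))"
          using mult_left_mono[OF main[OF n pos], of "x n"] pos by simp
        also have "\<dots> = K * (x n powr 1 * x n powr (p - 1))" by (simp add: mult_ac)
        also have "x n powr 1 * x n powr (p - 1) = x n powr p" by (subst powr_add[symmetric]) simp
        finally show ?thesis .
      qed (use K0 in simp)
      finally show ?thesis .
    qed
    hence "(\<Sum>n\<in>N. \<Sum>m\<in>N. if x m \<le> x n then ?T n m else 0) \<le> (\<Sum>n\<in>N. K * x n powr p)" by (rule sum_mono)
    also have "\<dots> = K * (\<Sum>n\<in>N. x n powr p)" by (simp add: sum_distrib_left)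
    also have "\<dots> \<le> K" using S K0 by (simp add: mult_left_le)
    finally show ?thesis .
  qed
  \<comment> \<open>Pairs with x m = x n are counted in both halves, hence only an
    inequality.\<close>
  have "(\<Sum>n\<in>N. \<Sum>m\<in>N. ?T n m) \<le> (\<Sum>n\<in>N. \<Sum>m\<in>N. (if x m \<le> x n then ?T n m else 0) + (if x n \<le> x m then ?T m n else 0))"
    using x by (intro sum_mono) (auto simp: gap_commute mult_ac intro!: mult_nonneg_nonneg)
  also have "\<dots> = (\<Sum>n\<in>N. \<Sum>m\<in>N. if x m \<le> x n then ?T n m else 0) + (\<Sum>n\<in>N. \<Sum>m\<in>N. if x n \<le> x m then ?T m n else 0)"
    by (simp add: sum.distrib)
  also have "(\<Sum>n\<in>N. \<Sum>m\<in>N. if x n \<le> x m then ?T m n else 0) = (\<Sum>m\<in>N. \<Sum>n\<in>N. if x n \<le> x m then ?T m n else 0)"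
    by (rule sum.swap)
  finally show ?thesis using half by (simp add: HLS_const_def K_def)
qed

lemma discrete_HLS:
  fixes f :: "int \<Rightarrow> real"
  assumes \<gamma>: "0 < \<gamma>" "\<gamma> < 1" and N: "finite N" and f: "\<And>n. n \<in> N \<Longrightarrow> f n \<ge> 0"
    and p: "p = 2 / (2 - \<gamma>)"
  shows "(\<Sum>n\<in>N. \<Sum>m\<in>N. f n * f m * gap n m powr - \<gamma>) \<le> HLS_const \<gamma> * (\<Sum>n\<in>N. f n powr p) powr (2 / p)"
proof (cases "(\<Sum>n\<in>N. f n powr p) = 0")
  case True
  hence "f n powr p = 0" if "n \<in> N" for n using that N by (simp add: sum_nonneg_eq_0_iff)
  hence "f n = 0" if "n \<in> N" for n using that by simp
  thus ?thesis using True by simp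
next
  case False
  define S where "S = (\<Sum>n\<in>N. f n powr p)"
  have S: "S > 0" using False sum_nonneg[of N "\<lambda>n. f n powr p"] by (simp add: S_def less_le)
  have pp: "p > 0" using \<gamma> by (simp add: p)
  define X where "X = S powr (1 / p)"
  have X: "X > 0" "X powr p = S" "X\<^sup>2 = S powr (2 / p)"
    using S pp by (auto simp: X_def powr_powr power2_eq_square simp flip: powr_add)
  have "(\<Sum>n\<in>N. \<Sum>m\<in>N. (f n / X) * (f m / X) * gap n m powr - \<gamma>) \<le> HLS_const \<gamma>"
  proof (rule discrete_HLS_normalised[OF \<gamma> N _ p])
    have "(\<Sum>n\<in>N. (f n / X) powr p) = (\<Sum>n\<in>N. f n powr p) / X powr p"
      using f X by (simp add: powr_divide sum_divide_distrib)
    thus "(\<Sum>n\<in>N. (f n / X) powr p) \<le> 1" using X S by (simp add: S_def)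
  qed (use f X in auto)
  moreover have "(\<Sum>n\<in>N. \<Sum>m\<in>N. (f n / X) * (f m / X) * gap n m powr - \<gamma>) = (\<Sum>n\<in>N. \<Sum>m\<in>N. f n * f m * gap n m powr - \<gamma>) / X\<^sup>2"
    by (simp add: sum_divide_distrib power2_eq_square)
  ultimately show ?thesis using X S by (simp add: S_def[symmetric] pos_divide_le_eq)
qed

lemma nsq_sum_le:
  assumes "\<And>i. i \<in> I \<Longrightarrow> f i \<in> L2"
  shows "nsq (\<lambda>x. \<Sum>i\<in>I. f i x) \<le> (\<Sum>i\<in>I. \<Sum>j\<in>I. cmod (ip (f i) (f j)))"
proof -
  have "nsq (\<lambda>x. \<Sum>i\<in>I. f i x) \<le> cmod (\<Sum>i\<in>I. \<Sum>j\<in>I. ip (f i) (f j))"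
    using nsq_sum[of I f] assms complex_Re_le_cmod[of "\<Sum>i\<in>I. \<Sum>j\<in>I. ip (f i) (f j)"] by simp
  also have "\<dots> \<le> (\<Sum>i\<in>I. \<Sum>j\<in>I. cmod (ip (f i) (f j)))"
    by (intro order_trans[OF norm_sum] sum_mono norm_sum)
  finally show ?thesis .
qed

text \<open>A bootstrap on b = h * (\<Sum>n\<in>N. F n powr p). Duality with \<psi> and the
  Hardy-Littlewood-Sobolev bound for the norm of the sum of all U n give b^2 \<le> K * b powr (2 -
  \<gamma>), and b can be cancelled because the grid is finite. The powers of h fit since h^2 * h
  powr - \<gamma> = h powr (2 / p).\<close>

lemma TTstar_HLS:
  fixes U :: "int \<Rightarrow> 'a::euclidean_space \<Rightarrow> complex"
  assumes \<gamma>: "0 < \<gamma>" "\<gamma> < 1" and p: "p = 2 / (2 - \<gamma>)" and h: "h > 0" and N: "finite N"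
    and U: "\<And>n. n \<in> N \<Longrightarrow> U n \<in> L2" and F: "\<And>n. n \<in> N \<Longrightarrow> F n \<ge> 0" and A: "A \<ge> 0"
    and ipU: "\<And>n m. n \<in> N \<Longrightarrow> m \<in> N \<Longrightarrow> cmod (ip (U n) (U m)) \<le> A * F n * F m * (h * gap n m) powr - \<gamma>"
    and \<psi>: "\<psi> \<in> L2" and B: "h * (\<Sum>n\<in>N. F n powr p) \<le> h * (\<Sum>n\<in>N. Re (ip \<psi> (U n)))"
  shows "h * (\<Sum>n\<in>N. F n powr p) \<le> (HLS_const \<gamma> * A * nsq \<psi>) powr (1 / \<gamma>)"
proof -
  define S where "S = (\<Sum>n\<in>N. F n powr p)"
  have S: "S \<ge> 0" by (simp add: S_def sum_nonneg)
  have p2: "2 / p = 2 - \<gamma>" and pp: "p > 0" using \<gamma> by (auto simp: p)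
  let ?W = "\<lambda>x. \<Sum>n\<in>N. U n x"
  have W: "?W \<in> L2" by (rule L2_sum) (rule U)
  have "nsq ?W \<le> (\<Sum>n\<in>N. \<Sum>m\<in>N. A * F n * F m * (h * gap n m) powr - \<gamma>)"
    by (intro order_trans[OF nsq_sum_le] sum_mono U ipU)
  also have "\<dots> = A * h powr - \<gamma> * (\<Sum>n\<in>N. \<Sum>m\<in>N. F n * F m * gap n m powr - \<gamma>)"
    using h by (simp add: sum_distrib_left powr_mult gap_pos less_imp_le mult_ac)
  also have "\<dots> \<le> A * h powr - \<gamma> * (HLS_const \<gamma> * S powr (2 / p))"
    unfolding S_def by (intro mult_left_mono discrete_HLS \<gamma> N F p mult_nonneg_nonneg A) auto
  finally have nW: "nsq ?W \<le> A * h powr - \<gamma> * (HLS_const \<gamma> * S powr (2 / p))" .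
  have "h * (\<Sum>n\<in>N. Re (ip \<psi> (U n))) = h * Re (ip \<psi> ?W)"
    by (subst ip_sum_right) (auto simp: U \<psi>)
  also have "\<dots> \<le> h * (sqrt (nsq \<psi>) * sqrt (nsq ?W))"
    using order_trans[OF complex_Re_le_cmod ip_Cauchy_Schwarz[OF \<psi> W]] h by (intro mult_left_mono) auto
  also have "\<dots> \<le> h * (sqrt (nsq \<psi>) * sqrt (A * h powr - \<gamma> * (HLS_const \<gamma> * S powr (2 / p))))"
    using h nW by (intro mult_left_mono) auto
  also have "\<dots> = sqrt (h\<^sup>2 * (nsq \<psi> * (A * h powr - \<gamma> * (HLS_const \<gamma> * S powr (2 / p)))))"
    using h by (simp add: real_sqrt_mult)
  also have "h\<^sup>2 * (nsq \<psi> * (A * h powr - \<gamma> * (HLS_const \<gamma> * S powr (2 / p)))) = (HLS_const \<gamma> * A * nsq \<psi>) * (h * S) powr (2 / p)"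
  proof -
    have "h\<^sup>2 * h powr - \<gamma> = h powr (2 / p)" unfolding p2 using h by (simp add: powr_diff powr_minus divide_inverse powr_numeral)
    hence "h\<^sup>2 * h powr - \<gamma> * S powr (2 / p) = (h * S) powr (2 / p)" using h S by (simp add: powr_mult)
    thus ?thesis by (simp add: mult_ac)
  qed
  finally have main: "h * S \<le> sqrt (HLS_const \<gamma> * A * nsq \<psi> * (h * S) powr (2 / p))"
    using B by (simp add: S_def)
  define b where "b = h * S"
  define K where "K = HLS_const \<gamma> * A * nsq \<psi>"
  have K: "K \<ge> 0" using HLS_const_pos[OF \<gamma>] A by (simp add: K_def)
  have b0: "b \<ge> 0" using h S by (simp add: b_def)
  have "b \<le> K powr (1 / \<gamma>)"
  proof (cases "b = 0")
    case False
    hence b: "b > 0" using b0 by simp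
    have "b\<^sup>2 \<le> K * b powr (2 - \<gamma>)"
      using power_mono[OF main[folded b_def K_def] b0, of 2] K unfolding p2 by simp
    also have "b powr (2 - \<gamma>) = b\<^sup>2 / b powr \<gamma>" using b by (simp add: powr_diff powr_numeral)
    finally have "b powr \<gamma> \<le> K" using b by (simp add: field_simps)
    hence "(b powr \<gamma>) powr (1 / \<gamma>) \<le> K powr (1 / \<gamma>)" using \<gamma> by (intro powr_mono2) auto
    thus ?thesis using \<gamma> b by (simp add: powr_powr)
  qed simp
  thus ?thesis by (simp add: b_def K_def S_def)
qed

section \<open>The endpoint bilinear estimate\<close>

text \<open>The far and the near contribution, in this order.\<close>

definition endpoint_const :: "real \<Rightarrow> real" where
  "endpoint_const \<sigma> = tail_const \<sigma> + sqrt (4 * (4 + tail_const \<sigma>))"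

lemma endpoint_const_nonneg: "\<sigma> > 1 \<Longrightarrow> endpoint_const \<sigma> \<ge> 0"
  using tail_const_pos[of \<sigma>] by (auto simp: endpoint_const_def)

lemma powr_ratio:
  fixes x y :: real assumes "x > 0" "y > 0"
  shows "(x / y) powr (1 - \<sigma>) = x powr (1 - \<sigma>) * y powr (\<sigma> - 1)"
proof -
  have "(x / y) powr (1 - \<sigma>) = x powr (1 - \<sigma>) / y powr (1 - \<sigma>)" using assms by (intro powr_divide)
  thus ?thesis using powr_minus[of y "1 - \<sigma>"] by (simp add: divide_inverse)
qed

text \<open>Schur test for the kernel gap powr - \<sigma> cut off below R / h, whose row sums are of
  order (R / h) powr (1 - \<sigma>). All powers of h collapse to a single h, the weight of a Riemann
  sum.\<close>

lemma endpoint_bilinear_far: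
  fixes V W :: "int \<Rightarrow> 'a::euclidean_space \<Rightarrow> complex"
  assumes \<sigma>: "\<sigma> > 1" and h: "h > 0" and hR: "h \<le> R" and N: "finite N"
    and f: "\<And>n. f n \<ge> 0" and g: "\<And>n. g n \<ge> 0" and A: "A \<ge> 0" and D: "D \<ge> 0"
    and VW: "\<And>n m. n \<in> N \<Longrightarrow> m \<in> N \<Longrightarrow> n \<noteq> m \<Longrightarrow> cmod (ip (V n) (W m)) \<le> A * f n * g m * ((h * gap n m) powr - \<sigma> * D)"
  shows "h\<^sup>2 * (\<Sum>m\<in>N. \<Sum>n\<in>{n\<in>N. gap n m > R / h}. cmod (ip (V n) (W m)))
     \<le> A * tail_const \<sigma> * (R powr (1 - \<sigma>) * D) * (h * (sqrt (\<Sum>n\<in>N. (f n)\<^sup>2) * sqrt (\<Sum>n\<in>N. (g n)\<^sup>2)))"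
proof -
  let ?\<rho> = "R / h"
  have \<rho>: "?\<rho> \<ge> 1" using h hR by simp
  define k where "k n m = (if gap n m > ?\<rho> then gap n m powr - \<sigma> else 0)" for n m
  have kc: "k n m = k m n" for n m by (simp add: k_def gap_commute)
  have ks: "(\<Sum>m\<in>N. k n m) \<le> tail_const \<sigma> * ?\<rho> powr (1 - \<sigma>)" for n
  proof -
    have "(\<Sum>m\<in>N. k n m) = (\<Sum>m\<in>{m\<in>N. gap n m > ?\<rho>}. gap n m powr - \<sigma>)"
      using N by (simp add: k_def sum.inter_filter)
    thus ?thesis using sum_gap_tail[OF \<sigma> \<rho> N, of n] by simp
  qed
  have "(\<Sum>m\<in>N. \<Sum>n\<in>{n\<in>N. gap n m > ?\<rho>}. cmod (ip (V n) (W m))) \<le> (\<Sum>m\<in>N. \<Sum>n\<in>N. (A * h powr - \<sigma> * D) * (k n m * f n * g m))"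
  proof (rule sum_mono)
    fix m assume m: "m \<in> N"
    have "(\<Sum>n\<in>{n\<in>N. gap n m > ?\<rho>}. cmod (ip (V n) (W m))) \<le> (\<Sum>n\<in>{n\<in>N. gap n m > ?\<rho>}. (A * h powr - \<sigma> * D) * (k n m * f n * g m))"
    proof (rule sum_mono)
      fix n assume n: "n \<in> {n\<in>N. gap n m > ?\<rho>}"
      hence "n \<noteq> m" using \<rho> by (auto simp: gap_def)
      hence "cmod (ip (V n) (W m)) \<le> A * f n * g m * ((h * gap n m) powr - \<sigma> * D)" using n m by (intro VW) auto
      also have "\<dots> = (A * h powr - \<sigma> * D) * (k n m * f n * g m)"
        using n h gap_pos[of n m] by (simp add: k_def powr_mult mult_ac)
      finally show "cmod (ip (V n) (W m)) \<le> (A * h powr - \<sigma> * D) * (k n m * f n * g m)" .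
    qed
    also have "\<dots> \<le> (\<Sum>n\<in>N. (A * h powr - \<sigma> * D) * (k n m * f n * g m))"
      using N A D f g by (intro sum_mono2) (auto simp: k_def intro!: mult_nonneg_nonneg)
    finally show "(\<Sum>n\<in>{n\<in>N. gap n m > ?\<rho>}. cmod (ip (V n) (W m))) \<le> (\<Sum>n\<in>N. (A * h powr - \<sigma> * D) * (k n m * f n * g m))" .
  qed
  also have "\<dots> = (A * h powr - \<sigma> * D) * (\<Sum>n\<in>N. \<Sum>m\<in>N. k n m * f n * g m)"
    by (subst sum.swap) (simp add: sum_distrib_left)
  also have "\<dots> \<le> (A * h powr - \<sigma> * D) * ((tail_const \<sigma> * ?\<rho> powr (1 - \<sigma>)) * sqrt (\<Sum>n\<in>N. (f n)\<^sup>2) * sqrt (\<Sum>n\<in>N. (g n)\<^sup>2))"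
  proof (rule mult_left_mono[OF Schur_test])
    show "(\<Sum>i\<in>N. k i j) \<le> tail_const \<sigma> * ?\<rho> powr (1 - \<sigma>)" for j using ks[of j] by (simp add: kc[of _ j])
    show "tail_const \<sigma> * ?\<rho> powr (1 - \<sigma>) \<ge> 0" using tail_const_pos[OF \<sigma>] by simp
  qed (use A D ks in \<open>auto simp: k_def\<close>)
  finally have "h\<^sup>2 * (\<Sum>m\<in>N. \<Sum>n\<in>{n\<in>N. gap n m > ?\<rho>}. cmod (ip (V n) (W m))) \<le> h\<^sup>2 * \<dots>"
    using h by (intro mult_left_mono) auto
  also have "h\<^sup>2 * ((A * h powr - \<sigma> * D) * ((tail_const \<sigma> * ?\<rho> powr (1 - \<sigma>)) * sqrt (\<Sum>n\<in>N. (f n)\<^sup>2) * sqrt (\<Sum>n\<in>N. (g n)\<^sup>2)))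
    = A * tail_const \<sigma> * ((h\<^sup>2 * h powr - \<sigma> * ?\<rho> powr (1 - \<sigma>)) * D) * (sqrt (\<Sum>n\<in>N. (f n)\<^sup>2) * sqrt (\<Sum>n\<in>N. (g n)\<^sup>2))"
    by (simp add: mult_ac)
  also have "h\<^sup>2 * h powr - \<sigma> * ?\<rho> powr (1 - \<sigma>) = h * R powr (1 - \<sigma>)"
  proof -
    have "h\<^sup>2 * h powr - \<sigma> * ?\<rho> powr (1 - \<sigma>) = (h powr 2 * h powr - \<sigma> * h powr (\<sigma> - 1)) * R powr (1 - \<sigma>)"
      using h hR by (subst powr_ratio) (auto simp: mult_ac)
    also have "h powr 2 * h powr - \<sigma> * h powr (\<sigma> - 1) = h"
      unfolding powr_add[symmetric] using h by simp
    finally show ?thesis .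
  qed
  finally show ?thesis by (simp add: mult_ac)
qed

text \<open>The pairings are bounded by 1 / X for time differences up to X and by dispersion beyond.
  This kernel has integral of order 1 in time, so its row sums on the grid are of order 1 / h,
  whatever X and the set M are.\<close>

lemma endpoint_window:
  fixes V :: "int \<Rightarrow> 'a::euclidean_space \<Rightarrow> complex"
  assumes \<sigma>: "\<sigma> > 1" and h: "h > 0" and hX: "h \<le> X" and M: "finite M"
    and V: "\<And>n. n \<in> M \<Longrightarrow> V n \<in> L2" and f: "\<And>n. f n \<ge> 0" and A: "A \<ge> 0"
    and V1: "\<And>n. n \<in> M \<Longrightarrow> nsq (V n) \<le> A * (f n)\<^sup>2 / X"
    and V2: "\<And>n m. n \<in> M \<Longrightarrow> m \<in> M \<Longrightarrow> n \<noteq> m \<Longrightarrow> cmod (ip (V n) (V m)) \<le> A * f n * f m * ((h * gap n m) powr - \<sigma> * X powr (\<sigma> - 1))"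
  shows "nsq (\<lambda>x. \<Sum>n\<in>M. V n x) \<le> A * ((4 + tail_const \<sigma>) / h) * (\<Sum>n\<in>M. (f n)\<^sup>2)"
proof -
  have X: "X > 0" using h hX by simp
  have \<rho>: "X / h \<ge> 1" using h hX by simp
  define k where "k n m = (if gap n m \<le> X / h then 1 / X else h powr - \<sigma> * X powr (\<sigma> - 1) * gap n m powr - \<sigma>)" for n m
  have kc: "k n m = k m n" for n m by (simp add: k_def gap_commute)
  have k0: "k n m \<ge> 0" for n m using X by (simp add: k_def)
  have ks: "(\<Sum>m\<in>M. k n m) \<le> (4 + tail_const \<sigma>) / h" for n
  proof -
    have "(\<Sum>m\<in>M. k n m) = (\<Sum>m\<in>{m\<in>M. gap n m \<le> X / h}. k n m) + (\<Sum>m\<in>{m\<in>M. gap n m > X / h}. k n m)"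
      using M by (subst sum.union_disjoint[symmetric]) (auto intro!: sum.cong)
    also have "(\<Sum>m\<in>{m\<in>M. gap n m \<le> X / h}. k n m) = real (card {m\<in>M. gap n m \<le> X / h}) * (1 / X)"
      by (simp add: k_def)
    also have "\<dots> \<le> 4 * (X / h) * (1 / X)"
      using card_gap_near[OF \<rho> M, of n] X by (intro mult_right_mono) auto
    also have "4 * (X / h) * (1 / X) = 4 / h" using X by simp
    also have "(\<Sum>m\<in>{m\<in>M. gap n m > X / h}. k n m) = (h powr - \<sigma> * X powr (\<sigma> - 1)) * (\<Sum>m\<in>{m\<in>M. gap n m > X / h}. gap n m powr - \<sigma>)"
      unfolding sum_distrib_left by (intro sum.cong refl) (auto simp: k_def)
    also have "\<dots> \<le> (h powr - \<sigma> * X powr (\<sigma> - 1)) * (tail_const \<sigma> * (X / h) powr (1 - \<sigma>))"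
      by (intro mult_left_mono sum_gap_tail \<sigma> \<rho> M) auto
    also have "\<dots> = tail_const \<sigma> * (h powr - \<sigma> * h powr (\<sigma> - 1)) * (X powr (\<sigma> - 1) * X powr (1 - \<sigma>))"
      unfolding powr_ratio[OF X h] by (simp add: mult_ac)
    also have "h powr - \<sigma> * h powr (\<sigma> - 1) = 1 / h" unfolding powr_add[symmetric] using h by (simp add: powr_minus_divide)
    also have "X powr (\<sigma> - 1) * X powr (1 - \<sigma>) = 1" using X by (simp flip: powr_add)
    finally show ?thesis by (simp add: add_divide_distrib)
  qed
  have bd: "cmod (ip (V n) (V m)) \<le> A * (k n m * f n * f m)" if nm: "n \<in> M" "m \<in> M" for n m
  proof (cases "gap n m \<le> X / h")
    case True
    have "cmod (ip (V n) (V m)) \<le> sqrt (nsq (V n)) * sqrt (nsq (V m))" by (intro ip_Cauchy_Schwarz V nm)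
    also have "\<dots> \<le> sqrt (A * (f n)\<^sup>2 / X) * sqrt (A * (f m)\<^sup>2 / X)"
      by (intro mult_mono real_sqrt_le_mono V1 nm) (use A X in auto)
    also have "\<dots> = (sqrt A * sqrt A) * (1 / (sqrt X * sqrt X)) * f n * f m" using f by (simp add: real_sqrt_mult real_sqrt_divide)
    also have "\<dots> = A * (k n m * f n * f m)" using True A X by (simp add: k_def)
    finally show ?thesis .
  next
    case False
    hence "n \<noteq> m" using \<rho> by (auto simp: gap_def)
    from V2[OF nm this] show ?thesis using False h gap_pos[of n m] by (simp add: k_def powr_mult mult_ac)
  qed
  have "nsq (\<lambda>x. \<Sum>n\<in>M. V n x) \<le> (\<Sum>n\<in>M. \<Sum>m\<in>M. A * (k n m * f n * f m))"
    by (intro order_trans[OF nsq_sum_le] sum_mono V bd)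
  also have "\<dots> = A * (\<Sum>n\<in>M. \<Sum>m\<in>M. k n m * f n * f m)" by (simp add: sum_distrib_left)
  also have "\<dots> \<le> A * (((4 + tail_const \<sigma>) / h) * sqrt (\<Sum>n\<in>M. (f n)\<^sup>2) * sqrt (\<Sum>n\<in>M. (f n)\<^sup>2))"
  proof (rule mult_left_mono[OF Schur_test A])
    show "(\<Sum>i\<in>M. k i j) \<le> (4 + tail_const \<sigma>) / h" for j using ks[of j] by (simp add: kc[of _ j])
    show "(4 + tail_const \<sigma>) / h \<ge> 0" using tail_const_pos[OF \<sigma>] h by simp
  qed (use ks k0 in auto)
  also have "\<dots> = A * ((4 + tail_const \<sigma>) / h) * (sqrt (\<Sum>n\<in>M. (f n)\<^sup>2) * sqrt (\<Sum>n\<in>M. (f n)\<^sup>2))"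
    by (simp only: mult.assoc)
  also have "sqrt (\<Sum>n\<in>M. (f n)\<^sup>2) * sqrt (\<Sum>n\<in>M. (f n)\<^sup>2) = (\<Sum>n\<in>M. (f n)\<^sup>2)"
    by (simp add: sum_nonneg)
  finally show ?thesis .
qed

text \<open>Each W m meets the sum of the V n over a window of length R as one vector, estimated by
  \<open>endpoint_window\<close>. Every n lies in at most 4 * R / h windows, which produces R, while
  the L2 bound of W produces 1 / Y.\<close>

lemma endpoint_bilinear_near:
  fixes V W :: "int \<Rightarrow> 'a::euclidean_space \<Rightarrow> complex"
  assumes \<sigma>: "\<sigma> > 1" and h: "h > 0" and hX: "h \<le> X" and hR: "h \<le> R" and Y: "Y > 0" and N: "finite N"
    and V: "\<And>n. n \<in> N \<Longrightarrow> V n \<in> L2" and W: "\<And>n. n \<in> N \<Longrightarrow> W n \<in> L2"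
    and f: "\<And>n. f n \<ge> 0" and g: "\<And>n. g n \<ge> 0" and A: "A \<ge> 0"
    and V1: "\<And>n. n \<in> N \<Longrightarrow> nsq (V n) \<le> A * (f n)\<^sup>2 / X"
    and W1: "\<And>n. n \<in> N \<Longrightarrow> nsq (W n) \<le> A * (g n)\<^sup>2 / Y"
    and V2: "\<And>n m. n \<in> N \<Longrightarrow> m \<in> N \<Longrightarrow> n \<noteq> m \<Longrightarrow> cmod (ip (V n) (V m)) \<le> A * f n * f m * ((h * gap n m) powr - \<sigma> * X powr (\<sigma> - 1))"
  shows "h\<^sup>2 * (\<Sum>m\<in>N. cmod (ip (\<lambda>x. \<Sum>n\<in>{n\<in>N. gap n m \<le> R / h}. V n x) (W m)))
     \<le> A * sqrt (4 * (4 + tail_const \<sigma>)) * sqrt (R / Y) * (h * (sqrt (\<Sum>n\<in>N. (f n)\<^sup>2) * sqrt (\<Sum>n\<in>N. (g n)\<^sup>2)))"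
proof -
  let ?C = "4 + tail_const \<sigma>"
  have C: "?C > 0" using tail_const_pos[OF \<sigma>] by simp
  have R: "R > 0" using h hR by simp
  have \<rho>: "R / h \<ge> 1" using h hR by simp
  define G where "G m = (\<Sum>n\<in>{n\<in>N. gap n m \<le> R / h}. (f n)\<^sup>2)" for m
  have G0: "G m \<ge> 0" for m by (simp add: G_def sum_nonneg)
  have 1: "cmod (ip (\<lambda>x. \<Sum>n\<in>{n\<in>N. gap n m \<le> R / h}. V n x) (W m)) \<le> A * sqrt (?C / (h * Y)) * (sqrt (G m) * g m)" if m: "m \<in> N" for m
  proof -
    have "nsq (\<lambda>x. \<Sum>n\<in>{n\<in>N. gap n m \<le> R / h}. V n x) \<le> A * (?C / h) * G m"
      unfolding G_def by (rule endpoint_window[OF \<sigma> h hX]) (use N V f A V1 V2 in auto)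
    hence "cmod (ip (\<lambda>x. \<Sum>n\<in>{n\<in>N. gap n m \<le> R / h}. V n x) (W m)) \<le> sqrt (A * (?C / h) * G m) * sqrt (A * (g m)\<^sup>2 / Y)"
      using m V W by (intro order_trans[OF ip_Cauchy_Schwarz] mult_mono real_sqrt_le_mono W1 L2_sum) (auto simp: A G0 C h less_imp_le)
    also have "\<dots> = (sqrt A * sqrt A) * sqrt (?C / (h * Y)) * (sqrt (G m) * g m)"
      using g h Y by (simp add: real_sqrt_mult real_sqrt_divide)
    finally show ?thesis using A by simp
  qed
  have "(\<Sum>m\<in>N. sqrt (G m) * g m) \<le> sqrt ((\<Sum>m\<in>N. (sqrt (G m))\<^sup>2) * (\<Sum>m\<in>N. (g m)\<^sup>2))"
    by (rule real_le_rsqrt) (rule Cauchy_Schwarz_ineq_sum)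
  also have "(\<Sum>m\<in>N. (sqrt (G m))\<^sup>2) = (\<Sum>m\<in>N. G m)" using G0 by simp
  also have "sqrt ((\<Sum>m\<in>N. G m) * (\<Sum>m\<in>N. (g m)\<^sup>2)) \<le> sqrt ((4 * (R / h) * (\<Sum>n\<in>N. (f n)\<^sup>2)) * (\<Sum>m\<in>N. (g m)\<^sup>2))"
  proof (intro real_sqrt_le_mono mult_right_mono)
    have "(\<Sum>m\<in>N. G m) = (\<Sum>m\<in>N. \<Sum>n\<in>N. if gap n m \<le> R / h then (f n)\<^sup>2 else 0)"
      unfolding G_def using N by (simp add: sum.inter_filter)
    also have "\<dots> = (\<Sum>n\<in>N. \<Sum>m\<in>N. if gap n m \<le> R / h then (f n)\<^sup>2 else 0)" by (rule sum.swap)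
    also have "\<dots> = (\<Sum>n\<in>N. real (card {m\<in>N. gap n m \<le> R / h}) * (f n)\<^sup>2)"
      using N by (simp add: sum.inter_filter[symmetric])
    also have "\<dots> \<le> (\<Sum>n\<in>N. (4 * (R / h)) * (f n)\<^sup>2)"
      by (intro sum_mono mult_right_mono card_gap_near \<rho> N) auto
    finally show "(\<Sum>m\<in>N. G m) \<le> 4 * (R / h) * (\<Sum>n\<in>N. (f n)\<^sup>2)" by (simp add: sum_distrib_left)
  qed (simp add: sum_nonneg)
  finally have 2: "(\<Sum>m\<in>N. sqrt (G m) * g m) \<le> sqrt (4 * (R / h)) * (sqrt (\<Sum>n\<in>N. (f n)\<^sup>2) * sqrt (\<Sum>m\<in>N. (g m)\<^sup>2))"
    by (simp only: real_sqrt_mult mult.assoc)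
  have "(\<Sum>m\<in>N. cmod (ip (\<lambda>x. \<Sum>n\<in>{n\<in>N. gap n m \<le> R / h}. V n x) (W m))) \<le> (\<Sum>m\<in>N. A * sqrt (?C / (h * Y)) * (sqrt (G m) * g m))"
    by (rule sum_mono) (rule 1)
  also have "\<dots> = A * sqrt (?C / (h * Y)) * (\<Sum>m\<in>N. sqrt (G m) * g m)" by (simp add: sum_distrib_left)
  also have "\<dots> \<le> A * sqrt (?C / (h * Y)) * (sqrt (4 * (R / h)) * (sqrt (\<Sum>n\<in>N. (f n)\<^sup>2) * sqrt (\<Sum>m\<in>N. (g m)\<^sup>2)))"
    using A C h Y by (intro mult_left_mono[OF 2]) auto
  finally have "h\<^sup>2 * (\<Sum>m\<in>N. cmod (ip (\<lambda>x. \<Sum>n\<in>{n\<in>N. gap n m \<le> R / h}. V n x) (W m))) \<le> h\<^sup>2 * \<dots>"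
    using h by (intro mult_left_mono) auto
  also have "h\<^sup>2 * (A * sqrt (?C / (h * Y)) * (sqrt (4 * (R / h)) * (sqrt (\<Sum>n\<in>N. (f n)\<^sup>2) * sqrt (\<Sum>m\<in>N. (g m)\<^sup>2))))
    = A * (h\<^sup>2 * (sqrt (?C / (h * Y)) * sqrt (4 * (R / h)))) * (sqrt (\<Sum>n\<in>N. (f n)\<^sup>2) * sqrt (\<Sum>m\<in>N. (g m)\<^sup>2))"
    by (simp add: mult_ac)
  also have "h\<^sup>2 * (sqrt (?C / (h * Y)) * sqrt (4 * (R / h))) = h * (sqrt (4 * ?C) * sqrt (R / Y))"
  proof -
    have "sqrt (?C / (h * Y)) * sqrt (4 * (R / h)) = sqrt ((4 * ?C) * (R / Y) / (h * h))"
      unfolding real_sqrt_mult[symmetric] by (simp add: field_simps)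
    also have "\<dots> = sqrt (4 * ?C) * sqrt (R / Y) / h"
      using h by (simp only: real_sqrt_divide real_sqrt_mult) simp
    finally show ?thesis using h by (simp only: power2_eq_square) simp
  qed
  finally show ?thesis by (simp add: mult_ac)
qed

text \<open>Here \<open>V\<close> and \<open>W\<close> live on the time scales \<open>X \<le> Y\<close>. Time differences beyond
  \<open>R = X powr (1 / 4) * Y powr (3 / 4)\<close> are controlled by dispersion, shorter ones by the \<open>L2\<close> bound of \<open>W\<close>; both gain a power of \<open>X / Y\<close>.\<close>

lemma endpoint_bilinear:
  fixes V W :: "int \<Rightarrow> 'a::euclidean_space \<Rightarrow> complex"
  assumes \<sigma>: "\<sigma> > 1" and h: "h > 0" and hX: "h \<le> X" and XY: "X \<le> Y" and N: "finite N"
    and V: "\<And>n. n \<in> N \<Longrightarrow> V n \<in> L2" and W: "\<And>n. n \<in> N \<Longrightarrow> W n \<in> L2"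
    and f: "\<And>n. f n \<ge> 0" and g: "\<And>n. g n \<ge> 0" and A: "A \<ge> 0"
    and V1: "\<And>n. n \<in> N \<Longrightarrow> nsq (V n) \<le> A * (f n)\<^sup>2 / X"
    and W1: "\<And>n. n \<in> N \<Longrightarrow> nsq (W n) \<le> A * (g n)\<^sup>2 / Y"
    and V2: "\<And>n m. n \<in> N \<Longrightarrow> m \<in> N \<Longrightarrow> n \<noteq> m \<Longrightarrow> cmod (ip (V n) (V m)) \<le> A * f n * f m * ((h * gap n m) powr - \<sigma> * X powr (\<sigma> - 1))"
    and VW: "\<And>n m. n \<in> N \<Longrightarrow> m \<in> N \<Longrightarrow> n \<noteq> m \<Longrightarrow> cmod (ip (V n) (W m)) \<le> A * f n * g m * ((h * gap n m) powr - \<sigma> * (X * Y) powr ((\<sigma> - 1) / 2))"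
    and \<epsilon>: "\<epsilon> = min ((\<sigma> - 1) / 4) (1 / 8)"
  shows "h\<^sup>2 * cmod (\<Sum>n\<in>N. \<Sum>m\<in>N. ip (V n) (W m))
     \<le> A * endpoint_const \<sigma> * (X / Y) powr \<epsilon> * (h * (sqrt (\<Sum>n\<in>N. (f n)\<^sup>2) * sqrt (\<Sum>n\<in>N. (g n)\<^sup>2)))"
proof -
  have X: "X > 0" and Y: "Y > 0" using h hX XY by auto
  \<comment> \<open>In logarithmic variables the comparisons between powers of X, Y and R become
    linear.\<close>
  define x where "x = ln X" define y where "y = ln Y"
  have Xx: "X = exp x" and Yy: "Y = exp y" using X Y by (auto simp: x_def y_def)
  have xy: "x \<le> y" using XY X Y by (simp add: x_def y_def)
  define R where "R = exp ((x + 3 * y) / 4)"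
  have XR: "X \<le> R" unfolding R_def Xx using xy by simp
  have hR: "h \<le> R" using hX XR by simp
  let ?n = "h * (sqrt (\<Sum>n\<in>N. (f n)\<^sup>2) * sqrt (\<Sum>n\<in>N. (g n)\<^sup>2))"
  \<comment> \<open>R is the geometric mean of sqrt (X * Y), beyond which dispersion gains, and Y,
    below which the window estimate gains. The gains are (X / Y) to the powers (\<sigma> - 1) / 4
    and 1 / 8.\<close>
  have \<epsilon>1: "\<epsilon> \<le> (\<sigma> - 1) / 4" "\<epsilon> \<le> 1 / 8" unfolding \<epsilon> by (rule min.cobounded1 min.cobounded2)+
  have n0: "?n \<ge> 0" using h by (auto intro!: mult_nonneg_nonneg sum_nonneg)
  have e1: "R powr (1 - \<sigma>) * (X * Y) powr ((\<sigma> - 1) / 2) \<le> (X / Y) powr \<epsilon>"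
  proof -
    have "R powr (1 - \<sigma>) * (X * Y) powr ((\<sigma> - 1) / 2) = exp ((x - y) * ((\<sigma> - 1) / 4))"
      unfolding R_def Xx Yy by (simp add: powr_def flip: exp_add) (simp add: field_simps)
    also have "\<dots> \<le> exp ((x - y) * \<epsilon>)" unfolding exp_le_cancel_iff using xy \<epsilon>1 by (intro mult_left_mono_neg) auto
    also have "\<dots> = (X / Y) powr \<epsilon>" unfolding Xx Yy by (simp add: powr_def mult.commute flip: exp_diff)
    finally show ?thesis .
  qed
  have e2: "sqrt (R / Y) \<le> (X / Y) powr \<epsilon>"
  proof -
    have "sqrt (R / Y) = exp ((x - y) * (1 / 8))"
    proof (rule real_sqrt_unique)
      show "(exp ((x - y) * (1 / 8)))\<^sup>2 = R / Y"
        unfolding R_def Yy power2_eq_square by (simp flip: exp_add exp_diff)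
    qed simp
    also have "\<dots> \<le> exp ((x - y) * \<epsilon>)" unfolding exp_le_cancel_iff using xy \<epsilon>1 by (intro mult_left_mono_neg) auto
    also have "\<dots> = (X / Y) powr \<epsilon>" unfolding Xx Yy by (simp add: powr_def mult.commute flip: exp_diff)
    finally show ?thesis .
  qed
  have far: "h\<^sup>2 * (\<Sum>m\<in>N. \<Sum>n\<in>{n\<in>N. gap n m > R / h}. cmod (ip (V n) (W m))) \<le> A * tail_const \<sigma> * (X / Y) powr \<epsilon> * ?n"
    by (rule order_trans[OF endpoint_bilinear_far[OF \<sigma> h hR N f g A _ VW]])
      (use e1 A n0 tail_const_pos[OF \<sigma>] in \<open>auto intro!: mult_right_mono mult_left_mono\<close>)
  have near: "h\<^sup>2 * (\<Sum>m\<in>N. cmod (ip (\<lambda>x. \<Sum>n\<in>{n\<in>N. gap n m \<le> R / h}. V n x) (W m))) \<le> A * sqrt (4 * (4 + tail_const \<sigma>)) * (X / Y) powr \<epsilon> * ?n"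
  proof (rule order_trans[OF endpoint_bilinear_near[OF \<sigma> h hX hR Y N V W f g A V1 W1 V2]])
    show "A * sqrt (4 * (4 + tail_const \<sigma>)) * sqrt (R / Y) * ?n \<le> A * sqrt (4 * (4 + tail_const \<sigma>)) * (X / Y) powr \<epsilon> * ?n"
      by (intro mult_right_mono mult_left_mono e2 n0) (use A tail_const_pos[OF \<sigma>] in auto)
  qed
  \<comment> \<open>The near terms stay inside one inner product; only the far terms are estimated
    one by one.\<close>
  have split: "(\<Sum>n\<in>N. ip (V n) (W m)) = ip (\<lambda>x. \<Sum>n\<in>{n\<in>N. gap n m \<le> R / h}. V n x) (W m) + (\<Sum>n\<in>{n\<in>N. gap n m > R / h}. ip (V n) (W m))" if m: "m \<in> N" for m
  proof -
    have "(\<Sum>n\<in>N. ip (V n) (W m)) = (\<Sum>n\<in>{n\<in>N. gap n m \<le> R / h}. ip (V n) (W m)) + (\<Sum>n\<in>{n\<in>N. gap n m > R / h}. ip (V n) (W m))"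
      using N by (subst sum.union_disjoint[symmetric]) (auto intro!: sum.cong)
    thus ?thesis using V W m by (subst ip_sum_left) auto
  qed
  have "cmod (\<Sum>n\<in>N. \<Sum>m\<in>N. ip (V n) (W m)) = cmod (\<Sum>m\<in>N. \<Sum>n\<in>N. ip (V n) (W m))" by (subst sum.swap) simp
  also have "\<dots> \<le> (\<Sum>m\<in>N. cmod (ip (\<lambda>x. \<Sum>n\<in>{n\<in>N. gap n m \<le> R / h}. V n x) (W m)) + (\<Sum>n\<in>{n\<in>N. gap n m > R / h}. cmod (ip (V n) (W m))))"
  proof (rule order_trans[OF norm_sum], rule sum_mono)
    fix m assume m: "m \<in> N"
    show "cmod (\<Sum>n\<in>N. ip (V n) (W m)) \<le> cmod (ip (\<lambda>x. \<Sum>n\<in>{n\<in>N. gap n m \<le> R / h}. V n x) (W m)) + (\<Sum>n\<in>{n\<in>N. gap n m > R / h}. cmod (ip (V n) (W m)))"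
      unfolding split[OF m] by (intro order_trans[OF norm_triangle_ineq] add_left_mono norm_sum)
  qed
  finally have "h\<^sup>2 * cmod (\<Sum>n\<in>N. \<Sum>m\<in>N. ip (V n) (W m)) \<le> h\<^sup>2 * (\<Sum>m\<in>N. cmod (ip (\<lambda>x. \<Sum>n\<in>{n\<in>N. gap n m \<le> R / h}. V n x) (W m)) + (\<Sum>n\<in>{n\<in>N. gap n m > R / h}. cmod (ip (V n) (W m))))"
    by (intro mult_left_mono) auto
  also have "\<dots> = h\<^sup>2 * (\<Sum>m\<in>N. cmod (ip (\<lambda>x. \<Sum>n\<in>{n\<in>N. gap n m \<le> R / h}. V n x) (W m))) + h\<^sup>2 * (\<Sum>m\<in>N. \<Sum>n\<in>{n\<in>N. gap n m > R / h}. cmod (ip (V n) (W m)))"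
    by (simp only: sum.distrib distrib_left)
  also have "\<dots> \<le> A * sqrt (4 * (4 + tail_const \<sigma>)) * (X / Y) powr \<epsilon> * ?n + A * tail_const \<sigma> * (X / Y) powr \<epsilon> * ?n"
    by (intro add_mono near far)
  also have "\<dots> = A * endpoint_const \<sigma> * (X / Y) powr \<epsilon> * ?n" by (simp add: endpoint_const_def algebra_simps)
  finally show ?thesis .
qed

section \<open>Summation over atoms\<close>

text \<open>The bound of \<open>sum_geometric_int\<close>: the price of one two-sided geometric
  sum.\<close>

definition geo_const :: "real \<Rightarrow> real" where "geo_const \<delta> = 2 powr \<delta> * (2 / (1 - 2 powr - \<delta>))"

lemma geo_const_pos: "\<delta> > 0 \<Longrightarrow> geo_const \<delta> > 0"
  by (simp add: geo_const_def powr_less_one)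

text \<open>Almost orthogonality. The sums over n for two scales m and l pair with decay 2 powr (-
  \<delta> * |m - l|), because X / Y = 2 powr ((m - l) / \<sigma>) for m \<le> l, which is also
  where the division by \<sigma> in \<delta> comes from. A Schur test in (m, l) then leaves only the
  squares.\<close>

lemma endpoint_TTstar:
  fixes V :: "int \<Rightarrow> int \<Rightarrow> 'a::euclidean_space \<Rightarrow> complex"
  assumes \<sigma>: "\<sigma> > 1" and h: "h > 0" and N: "finite N" and Ms: "finite Ms"
    and hM: "\<And>m. m \<in> Ms \<Longrightarrow> h \<le> 2 powr (real_of_int m / \<sigma>)"
    and V: "\<And>n m. n \<in> N \<Longrightarrow> m \<in> Ms \<Longrightarrow> V n m \<in> L2" and f: "\<And>n m. f n m \<ge> 0" and A: "A \<ge> 0"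
    and V1: "\<And>n m. n \<in> N \<Longrightarrow> m \<in> Ms \<Longrightarrow> nsq (V n m) \<le> A * (f n m)\<^sup>2 / 2 powr (real_of_int m / \<sigma>)"
    and V2: "\<And>n n' m l. n \<in> N \<Longrightarrow> n' \<in> N \<Longrightarrow> m \<in> Ms \<Longrightarrow> l \<in> Ms \<Longrightarrow> n \<noteq> n' \<Longrightarrow> cmod (ip (V n m) (V n' l))
       \<le> A * f n m * f n' l * ((h * gap n n') powr - \<sigma> * (2 powr (real_of_int m / \<sigma>) * 2 powr (real_of_int l / \<sigma>)) powr ((\<sigma> - 1) / 2))"
    and \<delta>: "\<delta> = min ((\<sigma> - 1) / 4) (1 / 8) / \<sigma>"
  shows "h\<^sup>2 * nsq (\<lambda>x. \<Sum>n\<in>N. \<Sum>m\<in>Ms. V n m x) \<le> A * (endpoint_const \<sigma> * geo_const \<delta>) * (h * (\<Sum>n\<in>N. \<Sum>m\<in>Ms. (f n m)\<^sup>2))"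
proof -
  let ?X = "\<lambda>m. 2 powr (real_of_int m / \<sigma>)"
  define \<epsilon> where "\<epsilon> = min ((\<sigma> - 1) / 4) (1 / 8)"
  have d0: "\<delta> > 0" using \<sigma> by (simp add: \<delta>)
  define y where "y m = sqrt (\<Sum>n\<in>N. (f n m)\<^sup>2)" for m
  have sq: "(?X m * ?X m) powr ((\<sigma> - 1) / 2) = ?X m powr (\<sigma> - 1)" for m
  proof -
    have "(?X m * ?X m) powr ((\<sigma> - 1) / 2) = ?X m powr ((\<sigma> - 1) / 2) * ?X m powr ((\<sigma> - 1) / 2)" by (rule powr_mult)
    also have "\<dots> = ?X m powr ((\<sigma> - 1) / 2 + (\<sigma> - 1) / 2)" by (rule powr_add[symmetric])
    finally show ?thesis by (simp only: field_sum_of_halves)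
  qed
  have le: "h\<^sup>2 * cmod (\<Sum>n\<in>N. \<Sum>n'\<in>N. ip (V n m) (V n' l)) \<le> A * endpoint_const \<sigma> * (2 powr (- \<delta> * \<bar>real_of_int m - real_of_int l\<bar>)) * (h * (y m * y l))"
    if ml: "m \<in> Ms" "l \<in> Ms" "m \<le> l" for m l
  proof -
    have "?X m / ?X l = 2 powr ((real_of_int m - real_of_int l) / \<sigma>)"
      unfolding powr_diff[symmetric] by (simp add: diff_divide_distrib)
    hence "(?X m / ?X l) powr \<epsilon> = 2 powr ((real_of_int m - real_of_int l) / \<sigma> * \<epsilon>)"
      by (simp only: powr_powr)
    also have "(real_of_int m - real_of_int l) / \<sigma> * \<epsilon> = - \<delta> * \<bar>real_of_int m - real_of_int l\<bar>"
    proof -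
      have "\<bar>real_of_int m - real_of_int l\<bar> = - (real_of_int m - real_of_int l)" using ml(3) by simp
      moreover have "\<delta> = \<epsilon> / \<sigma>" by (simp add: \<delta> \<epsilon>_def)
      ultimately show ?thesis by (simp add: algebra_simps diff_divide_distrib)
    qed
    finally have "(?X m / ?X l) powr \<epsilon> = 2 powr (- \<delta> * \<bar>real_of_int m - real_of_int l\<bar>)" .
    moreover have "h\<^sup>2 * cmod (\<Sum>n\<in>N. \<Sum>n'\<in>N. ip (V n m) (V n' l)) \<le> A * endpoint_const \<sigma> * (?X m / ?X l) powr \<epsilon> * (h * (y m * y l))"
      unfolding y_def
    proof (rule endpoint_bilinear[OF \<sigma> h hM[OF ml(1)] _ N _ _ f f A])
      show "?X m \<le> ?X l" using ml \<sigma> by (intro powr_mono divide_right_mono) auto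
      show "cmod (ip (V n m) (V n' m)) \<le> A * f n m * f n' m * ((h * gap n n') powr - \<sigma> * ?X m powr (\<sigma> - 1))" if "n \<in> N" "n' \<in> N" "n \<noteq> n'" for n n'
        using V2[of n n' m m] that ml by (simp add: sq)
    qed (use V V1 V2 ml in \<open>auto simp: \<epsilon>_def\<close>)
    ultimately show ?thesis by simp
  qed
  let ?U = "\<lambda>m x. \<Sum>n\<in>N. V n m x"
  have U: "?U m \<in> L2" if "m \<in> Ms" for m using V that by (intro L2_sum) auto
  have ipU: "ip (?U m) (?U l) = (\<Sum>n\<in>N. \<Sum>n'\<in>N. ip (V n m) (V n' l))" if "m \<in> Ms" "l \<in> Ms" for m l
    using V U that by (subst ip_sum_left) (auto intro!: sum.cong simp: ip_sum_right)
  have all: "h\<^sup>2 * cmod (ip (?U m) (?U l)) \<le> A * endpoint_const \<sigma> * h * (2 powr (- \<delta> * \<bar>real_of_int m - real_of_int l\<bar>) * y m * y l)" if ml: "m \<in> Ms" "l \<in> Ms" for m l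
  proof (cases "m \<le> l")
    case True
    thus ?thesis using le[OF ml True] ml by (simp add: ipU mult_ac)
  next
    case False
    have "cmod (ip (?U m) (?U l)) = cmod (ip (?U l) (?U m))" by (subst ip_commute) simp
    thus ?thesis using le[OF ml(2,1)] False ml by (simp add: ipU mult_ac abs_minus_commute)
  qed
  have "nsq (\<lambda>x. \<Sum>n\<in>N. \<Sum>m\<in>Ms. V n m x) = nsq (\<lambda>x. \<Sum>m\<in>Ms. ?U m x)" by (subst sum.swap) simp
  also have "\<dots> \<le> (\<Sum>m\<in>Ms. \<Sum>l\<in>Ms. cmod (ip (?U m) (?U l)))" by (rule nsq_sum_le) (rule U)
  finally have "h\<^sup>2 * nsq (\<lambda>x. \<Sum>n\<in>N. \<Sum>m\<in>Ms. V n m x) \<le> h\<^sup>2 * (\<Sum>m\<in>Ms. \<Sum>l\<in>Ms. cmod (ip (?U m) (?U l)))"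
    by (intro mult_left_mono) auto
  also have "\<dots> = (\<Sum>m\<in>Ms. \<Sum>l\<in>Ms. h\<^sup>2 * cmod (ip (?U m) (?U l)))" by (simp add: sum_distrib_left)
  also have "\<dots> \<le> (\<Sum>m\<in>Ms. \<Sum>l\<in>Ms. A * endpoint_const \<sigma> * h * (2 powr (- \<delta> * \<bar>real_of_int m - real_of_int l\<bar>) * y m * y l))"
    by (intro sum_mono all)
  also have "\<dots> = A * endpoint_const \<sigma> * h * (\<Sum>m\<in>Ms. \<Sum>l\<in>Ms. 2 powr (- \<delta> * \<bar>real_of_int m - real_of_int l\<bar>) * y m * y l)"
    by (simp add: sum_distrib_left)
  also have "\<dots> \<le> A * endpoint_const \<sigma> * h * (geo_const \<delta> * sqrt (\<Sum>m\<in>Ms. (y m)\<^sup>2) * sqrt (\<Sum>m\<in>Ms. (y m)\<^sup>2))"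
  proof (rule mult_left_mono[OF Schur_test])
    show "(\<Sum>i\<in>Ms. 2 powr (- \<delta> * \<bar>real_of_int i - real_of_int j\<bar>)) \<le> geo_const \<delta>" for j
      unfolding geo_const_def by (rule sum_geometric_int[OF d0 Ms])
    show "(\<Sum>j\<in>Ms. 2 powr (- \<delta> * \<bar>real_of_int i - real_of_int j\<bar>)) \<le> geo_const \<delta>" for i
      unfolding geo_const_def abs_minus_commute[of "real_of_int i"] by (rule sum_geometric_int[OF d0 Ms])
    show "A * endpoint_const \<sigma> * h \<ge> 0" using A h endpoint_const_nonneg[OF \<sigma>] by simp
  qed (use geo_const_pos[OF d0] in auto)
  also have "\<dots> = A * endpoint_const \<sigma> * h * (geo_const \<delta> * (sqrt (\<Sum>m\<in>Ms. (y m)\<^sup>2) * sqrt (\<Sum>m\<in>Ms. (y m)\<^sup>2)))"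
    by (simp only: mult.assoc)
  also have "sqrt (\<Sum>m\<in>Ms. (y m)\<^sup>2) * sqrt (\<Sum>m\<in>Ms. (y m)\<^sup>2) = (\<Sum>m\<in>Ms. (y m)\<^sup>2)" by (simp add: sum_nonneg)
  also have "(\<Sum>m\<in>Ms. (y m)\<^sup>2) = (\<Sum>m\<in>Ms. \<Sum>n\<in>N. (f n m)\<^sup>2)" by (simp add: y_def sum_nonneg)
  also have "\<dots> = (\<Sum>n\<in>N. \<Sum>m\<in>Ms. (f n m)\<^sup>2)" by (rule sum.swap)
  finally show ?thesis by (simp add: mult_ac)
qed

text \<open>If S stands for the r-th power of an L^r norm, these are the coefficients of the
  extremiser in the duality for L^q in time and L^r in space: the pairing returns norm^q and the
  dual norm is norm^(q - 1). The factor 2 powr (m * (1 - 1 / r)) is the L^(r / (r - 1)) norm of an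
  atom of measure 2^m.\<close>

lemma dual_weights:
  fixes c :: "int \<Rightarrow> real" and Ms :: "int set"
  assumes r: "r > 2" and q: "q \<ge> 2" and Ms: "finite Ms" and c: "\<And>m. m \<in> Ms \<Longrightarrow> c m \<ge> 0"
    and S: "S = (\<Sum>m\<in>Ms. c m powr r * 2 powr real_of_int m)"
  shows "(\<Sum>m\<in>Ms. S powr ((q - r) / r) * c m powr (r - 1) * (c m * 2 powr real_of_int m)) = S powr (q / r)"
    and "(\<Sum>m\<in>Ms. (S powr ((q - r) / r) * c m powr (r - 1) * 2 powr (real_of_int m * (1 - 1 / r)))\<^sup>2) \<le> (S powr ((q - 1) / r))\<^sup>2"
proof -
  have S0: "S \<ge> 0" unfolding S by (intro sum_nonneg) auto
  have "c m powr (r - 1) * c m = c m powr r" if "m \<in> Ms" for m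
    using c[OF that] by (cases "c m = 0") (auto simp: powr_diff)
  hence "(\<Sum>m\<in>Ms. S powr ((q - r) / r) * c m powr (r - 1) * (c m * 2 powr real_of_int m)) = S powr ((q - r) / r) * S"
    unfolding S sum_distrib_left by (intro sum.cong refl) (simp add: mult_ac)
  also have "\<dots> = S powr (q / r)"
  proof (cases "S = 0")
    case False
    hence "S powr ((q - r) / r) * S = S powr ((q - r) / r + 1)" using S0 by (simp add: powr_add)
    also have "(q - r) / r + 1 = q / r" using r by (simp add: field_simps)
    finally show ?thesis .
  qed simp
  finally show "(\<Sum>m\<in>Ms. S powr ((q - r) / r) * c m powr (r - 1) * (c m * 2 powr real_of_int m)) = S powr (q / r)" .
  \<comment> \<open>The conjugate exponent of r. It is below 2 as r > 2, so the l^p norm of the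
    coefficients controls their l^2 norm.\<close>
  define p where "p = r / (r - 1)"
  have p: "0 < p" "p \<le> 2" using r by (auto simp: p_def field_simps)
  have p1: "(r - 1) * p = r" "(1 - 1 / r) * p = 1" using r by (auto simp: p_def field_simps)
  have pw: "(S powr ((q - r) / r) * c m powr (r - 1) * 2 powr (real_of_int m * (1 - 1 / r))) powr p = S powr ((q - r) / r * p) * (c m powr r * 2 powr real_of_int m)" if "m \<in> Ms" for m
  proof -
    have "(real_of_int m * (1 - 1 / r)) * p = real_of_int m" using p1 by (simp only: mult.assoc mult_1_right)
    thus ?thesis by (simp only: powr_mult powr_powr p1 mult.assoc)
  qed
  have "(\<Sum>m\<in>Ms. (S powr ((q - r) / r) * c m powr (r - 1) * 2 powr (real_of_int m * (1 - 1 / r)))\<^sup>2)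
    \<le> (\<Sum>m\<in>Ms. (S powr ((q - r) / r) * c m powr (r - 1) * 2 powr (real_of_int m * (1 - 1 / r))) powr p) powr (2 / p)"
    by (rule sum_squares_le_powr[OF p Ms]) simp
  also have "(\<Sum>m\<in>Ms. (S powr ((q - r) / r) * c m powr (r - 1) * 2 powr (real_of_int m * (1 - 1 / r))) powr p) = S powr ((q - r) / r * p) * S"
    unfolding S sum_distrib_left[symmetric] using pw[unfolded S] by (simp add: sum_distrib_left[symmetric])
  also have "(S powr ((q - r) / r * p) * S) powr (2 / p) = (S powr ((q - 1) / r))\<^sup>2"
  proof (cases "S = 0")
    case False
    hence "S powr ((q - r) / r * p) * S = S powr ((q - r) / r * p + 1)" using S0 by (simp add: powr_add)
    hence "(S powr ((q - r) / r * p) * S) powr (2 / p) = S powr (((q - r) / r * p + 1) * (2 / p))" by (simp add: powr_powr)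
    also have "((q - r) / r * p + 1) * (2 / p) = (q - 1) / r + (q - 1) / r"
      using r by (simp add: p_def field_simps)
    finally show ?thesis by (simp only: powr_add power2_eq_square)
  qed simp
  finally show "(\<Sum>m\<in>Ms. (S powr ((q - r) / r) * c m powr (r - 1) * 2 powr (real_of_int m * (1 - 1 / r)))\<^sup>2) \<le> (S powr ((q - 1) / r))\<^sup>2" .
qed

text \<open>\<open>a n m\<close> is the adjoint evolution of an atom of measure about \<open>2 ^ m\<close> at time \<open>h * n\<close>, and \<open>c n m\<close> a
  lower bound for the solution on that atom; both are 0 if there is none.\<close>

locale atoms =
  fixes \<sigma> h A :: real and N Ms :: "int set"
    and a :: "int \<Rightarrow> int \<Rightarrow> 'a::euclidean_space \<Rightarrow> complex" and c :: "int \<Rightarrow> int \<Rightarrow> real"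
    and \<psi> :: "'a \<Rightarrow> complex"
  assumes h: "h > 0" and finite_N: "finite N" and finite_Ms: "finite Ms"
    and hM: "\<And>m. m \<in> Ms \<Longrightarrow> h powr \<sigma> \<le> 2 powr real_of_int m"
    and A: "A \<ge> 0" and \<psi>: "\<psi> \<in> L2" and a_L2: "\<And>n m. a n m \<in> L2" and c: "\<And>n m. c n m \<ge> 0"
    and nsq_a: "\<And>n m. nsq (a n m) \<le> A * 2 powr real_of_int m"
    and ip_a: "\<And>n n' m l. n \<noteq> n' \<Longrightarrow> cmod (ip (a n m) (a n' l)) \<le> A * ((h * gap n n') powr - \<sigma> * (2 powr real_of_int m * 2 powr real_of_int l))"
    and ip_\<psi>: "\<And>n m. c n m * 2 powr real_of_int m \<le> Re (ip \<psi> (a n m))"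
begin

text \<open>Height^r times measure, summed over the scales: the stand-in for the r-th power of the
  L^r norm at time h * n.\<close>

definition S :: "real \<Rightarrow> int \<Rightarrow> real" where "S r n = (\<Sum>m\<in>Ms. c n m powr r * 2 powr real_of_int m)"

text \<open>\<open>g\<close> is the dual coefficient, \<open>f\<close> its size measured in the dual
  L^r norm, and \<open>V\<close> the resulting piece of the dual function after the adjoint
  evolution.\<close>

definition g :: "real \<Rightarrow> real \<Rightarrow> int \<Rightarrow> int \<Rightarrow> real" where "g q r n m = S r n powr ((q - r) / r) * c n m powr (r - 1)"
definition f :: "real \<Rightarrow> real \<Rightarrow> int \<Rightarrow> int \<Rightarrow> real" where "f q r n m = g q r n m * 2 powr (real_of_int m * (1 - 1 / r))"
definition V :: "real \<Rightarrow> real \<Rightarrow> int \<Rightarrow> int \<Rightarrow> 'a \<Rightarrow> complex" where "V q r n m = (\<lambda>x. of_real (g q r n m) * a n m x)"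

lemma g_nonneg: "g q r n m \<ge> 0" and f_nonneg: "f q r n m \<ge> 0" by (auto simp: g_def f_def)
lemma V_L2: "V q r n m \<in> L2" unfolding V_def by (intro L2_cmult a_L2)

text \<open>Relative to \<open>f\<close>, the L2 bound decays as m grows, whereas the dispersive
  bound in \<open>ip_V\<close> increases with m; both summations over scales use this
  opposition.\<close>

lemma nsq_V:
  shows "nsq (V q r n m) \<le> A * (f q r n m)\<^sup>2 * 2 powr (- real_of_int m * (1 - 2 / r))"
proof -
  have "nsq (V q r n m) \<le> (g q r n m)\<^sup>2 * (A * 2 powr real_of_int m)"
    unfolding V_def nsq_cmult using mult_left_mono[OF nsq_a[of n m], of "(g q r n m)\<^sup>2"] by simp
  also have "2 powr real_of_int m = (2 powr (real_of_int m * (1 - 1 / r)))\<^sup>2 * 2 powr (- real_of_int m * (1 - 2 / r))"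
    unfolding power2_eq_square powr_add[symmetric] by (simp add: algebra_simps)
  finally show ?thesis by (simp add: f_def power_mult_distrib mult_ac)
qed

lemma ip_V_eq: "ip (V q r n m) (V q r n' l) = of_real (g q r n m * g q r n' l) * ip (a n m) (a n' l)"
  by (simp add: V_def ip_cmult_left ip_cmult_right)

lemma ip_V:
  assumes "n \<noteq> n'"
  shows "cmod (ip (V q r n m) (V q r n' l)) \<le> A * f q r n m * f q r n' l * ((h * gap n n') powr - \<sigma> * (2 powr (real_of_int m / r) * 2 powr (real_of_int l / r)))"
proof -
  have "cmod (ip (V q r n m) (V q r n' l)) = (g q r n m * g q r n' l) * cmod (ip (a n m) (a n' l))"
    unfolding ip_V_eq by (simp add: norm_mult abs_of_nonneg g_nonneg)
  also have "\<dots> \<le> (g q r n m * g q r n' l) * (A * ((h * gap n n') powr - \<sigma> * (2 powr real_of_int m * 2 powr real_of_int l)))"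
    by (intro mult_left_mono ip_a assms mult_nonneg_nonneg g_nonneg)
  also have "2 powr real_of_int m * 2 powr real_of_int l = (2 powr (real_of_int m * (1 - 1 / r)) * 2 powr (real_of_int l * (1 - 1 / r))) * (2 powr (real_of_int m / r) * 2 powr (real_of_int l / r))"
    unfolding powr_add[symmetric] by (simp add: algebra_simps)
  finally show ?thesis by (simp add: f_def mult_ac)
qed

lemma Re_ip_V:
  assumes "r > 2" "q \<ge> 2"
  shows "S r n powr (q / r) \<le> Re (ip \<psi> (\<lambda>x. \<Sum>m\<in>Ms. V q r n m x))"
proof -
  have "S r n powr (q / r) = (\<Sum>m\<in>Ms. g q r n m * (c n m * 2 powr real_of_int m))"
    unfolding g_def using dual_weights(1)[OF assms finite_Ms c S_def] by simp
  also have "\<dots> \<le> (\<Sum>m\<in>Ms. g q r n m * Re (ip \<psi> (a n m)))"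
    by (intro sum_mono mult_left_mono ip_\<psi> g_nonneg)
  also have "\<dots> = (\<Sum>m\<in>Ms. Re (ip \<psi> (V q r n m)))"
    by (simp add: V_def ip_cmult_right)
  also have "\<dots> = Re (ip \<psi> (\<lambda>x. \<Sum>m\<in>Ms. V q r n m x))"
    by (subst ip_sum_right) (auto simp: V_L2 \<psi>)
  finally show ?thesis .
qed

lemma sum_f: "r > 2 \<Longrightarrow> q \<ge> 2 \<Longrightarrow> (\<Sum>m\<in>Ms. (f q r n m)\<^sup>2) \<le> (S r n powr ((q - 1) / r))\<^sup>2"
  unfolding f_def g_def by (rule dual_weights(2)[OF _ _ finite_Ms c S_def])

text \<open>This r satisfies 1 - 2 / r = 1 / \<sigma> and 1 / r = (\<sigma> - 1) / (2 * \<sigma>),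
  which turns \<open>nsq_V\<close> and \<open>ip_V\<close> into the hypotheses of
  \<open>endpoint_TTstar\<close> with time scales 2 powr (m / \<sigma>). Duality bounds B^2 by a
  constant times B.\<close>

lemma endpoint_estimate:
  assumes \<sigma>: "\<sigma> > 1" and r: "r = 2 * \<sigma> / (\<sigma> - 1)" and \<delta>: "\<delta> = min ((\<sigma> - 1) / 4) (1 / 8) / \<sigma>"
  shows "h * (\<Sum>n\<in>N. S r n powr (2 / r)) \<le> endpoint_const \<sigma> * geo_const \<delta> * A * nsq \<psi>"
proof -
  have r2: "r > 2" using \<sigma> by (simp add: r field_simps)
  have r1: "1 - 2 / r = 1 / \<sigma>" "1 / r = (\<sigma> - 1) / (2 * \<sigma>)" using \<sigma> by (auto simp: r field_simps)
  let ?V = "V 2 r" and ?f = "f 2 r"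
  let ?W = "\<lambda>x. \<Sum>n\<in>N. \<Sum>m\<in>Ms. ?V n m x"
  define K where "K = endpoint_const \<sigma> * geo_const \<delta>"
  have d0: "\<delta> > 0" using \<sigma> by (simp add: \<delta>)
  have K: "K \<ge> 0" using endpoint_const_nonneg[OF \<sigma>] geo_const_pos[OF d0] by (simp add: K_def)
  have WL: "?W \<in> L2" by (intro L2_sum V_L2)
  define B where "B = h * (\<Sum>n\<in>N. S r n powr (2 / r))"
  have B0: "B \<ge> 0" using h by (auto simp: B_def intro!: mult_nonneg_nonneg sum_nonneg)
  have "h\<^sup>2 * nsq ?W \<le> A * (endpoint_const \<sigma> * geo_const \<delta>) * (h * (\<Sum>n\<in>N. \<Sum>m\<in>Ms. (?f n m)\<^sup>2))"
  proof (rule endpoint_TTstar[OF \<sigma> h finite_N finite_Ms _ V_L2 f_nonneg A _ _ \<delta>])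
    show "h \<le> 2 powr (real_of_int m / \<sigma>)" if "m \<in> Ms" for m
    proof -
      have "(h powr \<sigma>) powr (1 / \<sigma>) \<le> (2 powr real_of_int m) powr (1 / \<sigma>)" using hM[OF that] \<sigma> by (intro powr_mono2) auto
      thus ?thesis using h \<sigma> by (simp add: powr_powr)
    qed
    show "nsq (?V n m) \<le> A * (?f n m)\<^sup>2 / 2 powr (real_of_int m / \<sigma>)" for n m
      using nsq_V[of 2 r n m] unfolding r1 by (simp add: powr_minus divide_inverse)
    fix n n' m l assume "n \<noteq> (n'::int)"
    from ip_V[OF this, of 2 r m l]
    show "cmod (ip (?V n m) (?V n' l)) \<le> A * ?f n m * ?f n' l * ((h * gap n n') powr - \<sigma> * (2 powr (real_of_int m / \<sigma>) * 2 powr (real_of_int l / \<sigma>)) powr ((\<sigma> - 1) / 2))"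
    proof -
      have "(2 powr (real_of_int m / \<sigma>) * 2 powr (real_of_int l / \<sigma>)) powr ((\<sigma> - 1) / 2) = 2 powr (real_of_int m * (1 / r)) * 2 powr (real_of_int l * (1 / r))"
        unfolding r1 powr_mult powr_powr by (simp add: field_simps)
      thus ?thesis using \<open>cmod (ip (?V n m) (?V n' l)) \<le> _\<close> by simp
    qed
  qed
  also have "h * (\<Sum>n\<in>N. \<Sum>m\<in>Ms. (?f n m)\<^sup>2) \<le> B"
    unfolding B_def
  proof (intro mult_left_mono sum_mono)
    show "(\<Sum>m\<in>Ms. (?f n m)\<^sup>2) \<le> S r n powr (2 / r)" for n
      using sum_f[OF r2, of 2 n] by (simp add: power2_eq_square powr_add[symmetric])
  qed (use h in auto)
  finally have W: "h\<^sup>2 * nsq ?W \<le> A * K * B" unfolding K_def using A K[unfolded K_def] by (simp add: mult_left_mono)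
  have "B \<le> h * (\<Sum>n\<in>N. Re (ip \<psi> (\<lambda>x. \<Sum>m\<in>Ms. ?V n m x)))"
    unfolding B_def using h by (intro mult_left_mono sum_mono Re_ip_V r2) auto
  also have "\<dots> = h * Re (ip \<psi> ?W)"
    by (subst ip_sum_right) (auto intro!: L2_sum V_L2 \<psi>)
  also have "\<dots> \<le> h * (sqrt (nsq \<psi>) * sqrt (nsq ?W))"
    using order_trans[OF complex_Re_le_cmod ip_Cauchy_Schwarz[OF \<psi> WL]] h by (intro mult_left_mono) auto
  finally have "B\<^sup>2 \<le> (h * (sqrt (nsq \<psi>) * sqrt (nsq ?W)))\<^sup>2" using B0 by (intro power_mono) auto
  also have "\<dots> = nsq \<psi> * (h\<^sup>2 * nsq ?W)" by (simp add: power_mult_distrib)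
  also have "\<dots> \<le> nsq \<psi> * (A * K * B)" by (intro mult_left_mono W) auto
  finally have "B * B \<le> (K * A * nsq \<psi>) * B" by (simp add: power2_eq_square mult_ac)
  hence "B \<le> K * A * nsq \<psi>"
    using B0 K A by (cases "B = 0") (auto simp: mult_le_cancel_right)
  thus ?thesis by (simp add: B_def K_def mult_ac)
qed

text \<open>Interpolation by hand: for two fixed times the pairings of scales m and l are bounded by
  the smaller of the L2 and the dispersive bound, a function \<open>w\<close> of m + l alone. By
  \<open>sum_min_exponentials\<close> its row sums are of the order of the interpolated decay (h *
  gap n n') powr - \<gamma>. A Schur test in (m, l) gives the hypothesis of
  \<open>TTstar_HLS\<close>.\<close>

lemma nonendpoint_estimate:
  assumes r: "r > 2" and \<gamma>: "\<gamma> = 2 * \<sigma> * (1 / 2 - 1 / r)" "0 < \<gamma>" "\<gamma> < 1" and q: "q = 2 / \<gamma>"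
  shows "h * (\<Sum>n\<in>N. S r n powr (q / r)) \<le> (HLS_const \<gamma> * (A * geo_const (min (1 / 2 - 1 / r) (1 / r))) * nsq \<psi>) powr (q / 2)"
proof -
  define \<alpha> where "\<alpha> = 1 / 2 - 1 / r"
  define \<beta> where "\<beta> = 1 / r"
  have ab: "\<alpha> > 0" "\<beta> > 0" "\<alpha> + \<beta> = 1 / 2" using r by (auto simp: \<alpha>_def \<beta>_def field_simps)
  have q2: "q \<ge> 2" using \<gamma> by (simp add: q field_simps)
  define p where "p = 2 / (2 - \<gamma>)"
  have pq: "(q - 1) * p = q" using \<gamma> by (simp add: p_def q field_simps)
  let ?V = "V q r" and ?f = "f q r"
  define U where "U n = (\<lambda>x. \<Sum>m\<in>Ms. ?V n m x)" for n
  define F where "F n = S r n powr ((q - 1) / r)" for n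
  have UL: "U n \<in> L2" for n unfolding U_def by (intro L2_sum V_L2)
  have Fp: "F n powr p = S r n powr (q / r)" for n
    unfolding F_def powr_powr using pq by (simp add: field_simps)
  define G where "G = geo_const (min \<alpha> \<beta>)"
  have G0: "G > 0" unfolding G_def using ab by (intro geo_const_pos) auto
  have ipU: "cmod (ip (U n) (U n')) \<le> (A * G) * F n * F n' * (h * gap n n') powr - \<gamma>" for n n'
  proof -
    define D where "D = (h * gap n n') powr - \<sigma>"
    have hg: "h * gap n n' > 0" using h gap_pos[of n n'] by simp
    have D: "D > 0" unfolding D_def powr_gt_zero using hg by (metis less_irrefl)
    define w where "w m l = min (2 powr (- real_of_int (m + l) * \<alpha>)) (D * 2 powr (real_of_int (m + l) * \<beta>))" for m l
    have w0: "w m l \<ge> 0" for m l using D by (simp add: w_def)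
    have bV: "cmod (ip (?V n m) (?V n' l)) \<le> A * (w m l * ?f n m * ?f n' l)" if ml: "m \<in> Ms" "l \<in> Ms" for m l
    proof -
      have sq: "sqrt (2 powr (- real_of_int m * (1 - 2 / r))) = 2 powr (- real_of_int m * \<alpha>)" for m
      proof (rule real_sqrt_unique)
        have e: "1 - 2 / r = \<alpha> + \<alpha>" by (simp add: \<alpha>_def)
        show "(2 powr (- real_of_int m * \<alpha>))\<^sup>2 = 2 powr (- real_of_int m * (1 - 2 / r))"
          unfolding e power2_eq_square powr_add[symmetric] by (simp only: distrib_left)
      qed simp
      have "cmod (ip (?V n m) (?V n' l)) \<le> sqrt (nsq (?V n m)) * sqrt (nsq (?V n' l))" by (intro ip_Cauchy_Schwarz V_L2)
      also have "\<dots> \<le> sqrt (A * (?f n m)\<^sup>2 * 2 powr (- real_of_int m * (1 - 2 / r))) * sqrt (A * (?f n' l)\<^sup>2 * 2 powr (- real_of_int l * (1 - 2 / r)))"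
        using A by (intro mult_mono real_sqrt_le_mono nsq_V) auto
      also have "\<dots> = (sqrt A * sqrt A) * ((2 powr (- real_of_int m * \<alpha>) * 2 powr (- real_of_int l * \<alpha>)) * ?f n m * ?f n' l)"
        unfolding real_sqrt_mult sq by (simp add: abs_of_nonneg f_nonneg)
      also have "2 powr (- real_of_int m * \<alpha>) * 2 powr (- real_of_int l * \<alpha>) = 2 powr (- real_of_int (m + l) * \<alpha>)"
        unfolding powr_add[symmetric] by (simp add: algebra_simps)
      finally have b1: "cmod (ip (?V n m) (?V n' l)) \<le> A * (2 powr (- real_of_int (m + l) * \<alpha>) * ?f n m * ?f n' l)" using A by simp
      have b2: "cmod (ip (?V n m) (?V n' l)) \<le> A * (D * 2 powr (real_of_int (m + l) * \<beta>) * ?f n m * ?f n' l)"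
      proof (cases "n = n'")
        case False
        have "2 powr (real_of_int m / r) * 2 powr (real_of_int l / r) = 2 powr (real_of_int (m + l) * \<beta>)"
          unfolding powr_add[symmetric] \<beta>_def by (simp add: add_divide_distrib)
        thus ?thesis using ip_V[OF False, of q r m l] by (simp add: D_def mult_ac)
      next
        \<comment> \<open>Equal times: by \<open>hM\<close> both 2^m and 2^l are at least h powr
          \<sigma>, so the L2 bound already implies the dispersive one with time difference
          h.\<close>
        case True
        have D': "D = h powr - \<sigma>" using True by (simp add: D_def gap_def)
        have "(h powr \<sigma>)\<^sup>2 \<le> 2 powr real_of_int m * 2 powr real_of_int l"
          unfolding power2_eq_square by (intro mult_mono hM ml) auto
        hence "sqrt ((h powr \<sigma>)\<^sup>2) \<le> sqrt (2 powr real_of_int (m + l))" by (intro real_sqrt_le_mono) (simp add: powr_add)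
        hence "h powr \<sigma> \<le> 2 powr (real_of_int (m + l) * (1 / 2))" by (simp add: powr_half_sqrt[symmetric] powr_powr)
        hence "inverse (2 powr (real_of_int (m + l) * (1 / 2))) \<le> inverse (h powr \<sigma>)" using h by (intro le_imp_inverse_le) auto
        hence "2 powr (- (real_of_int (m + l) * (1 / 2))) \<le> D" by (simp add: D' powr_minus)
        hence z: "2 powr (- (real_of_int (m + l) * (1 / 2))) * 2 powr (real_of_int (m + l) * \<beta>) \<le> D * 2 powr (real_of_int (m + l) * \<beta>)"
          by (intro mult_right_mono) auto
        have e: "2 powr (- (real_of_int (m + l) * (1 / 2))) * 2 powr (real_of_int (m + l) * \<beta>) = 2 powr (- real_of_int (m + l) * \<alpha>)"
          unfolding powr_add[symmetric] ab(3)[symmetric] by (simp add: algebra_simps)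
        have "A * (2 powr (- real_of_int (m + l) * \<alpha>) * ?f n m * ?f n' l) \<le> A * (D * 2 powr (real_of_int (m + l) * \<beta>) * ?f n m * ?f n' l)"
          by (intro mult_left_mono mult_right_mono f_nonneg A z[unfolded e])
        thus ?thesis using b1 by linarith
      qed
      show ?thesis using b1 b2 by (auto simp: w_def min_def)
    qed
    have ws: "(\<Sum>l\<in>Ms. w m l) \<le> G * (h * gap n n') powr - \<gamma>" for m
    proof -
      have "(\<Sum>l\<in>Ms. w m l) = (\<Sum>s\<in>(\<lambda>l. m + l) ` Ms. min (2 powr (- real_of_int s * \<alpha>)) (D * 2 powr (real_of_int s * \<beta>)))"
        unfolding w_def by (subst sum.reindex) (simp_all add: inj_on_def comp_def del: of_int_add)
      also have "\<dots> \<le> G * D powr (2 * \<alpha>)"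
        unfolding G_def geo_const_def by (rule sum_min_exponentials[OF ab D]) (simp add: finite_Ms)
      also have "D powr (2 * \<alpha>) = (h * gap n n') powr - \<gamma>"
        unfolding D_def powr_powr \<gamma>(1) \<alpha>_def by (simp add: algebra_simps)
      finally show ?thesis .
    qed
    have wc: "w m l = w l m" for m l by (simp add: w_def add.commute)
    have "ip (U n) (U n') = (\<Sum>m\<in>Ms. \<Sum>l\<in>Ms. ip (?V n m) (?V n' l))"
      unfolding U_def by (subst ip_sum_left) (auto intro!: V_L2 L2_sum sum.cong simp: ip_sum_right V_L2)
    hence "cmod (ip (U n) (U n')) \<le> (\<Sum>m\<in>Ms. \<Sum>l\<in>Ms. cmod (ip (?V n m) (?V n' l)))"
      by (simp add: order_trans[OF norm_sum] sum_mono norm_sum)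
    also have "\<dots> \<le> (\<Sum>m\<in>Ms. \<Sum>l\<in>Ms. A * (w m l * ?f n m * ?f n' l))" by (intro sum_mono bV)
    also have "\<dots> = A * (\<Sum>m\<in>Ms. \<Sum>l\<in>Ms. w m l * ?f n m * ?f n' l)" by (simp add: sum_distrib_left)
    also have "\<dots> \<le> A * ((G * (h * gap n n') powr - \<gamma>) * sqrt (\<Sum>m\<in>Ms. (?f n m)\<^sup>2) * sqrt (\<Sum>m\<in>Ms. (?f n' m)\<^sup>2))"
    proof (rule mult_left_mono[OF Schur_test A])
      show "(\<Sum>i\<in>Ms. w i j) \<le> G * (h * gap n n') powr - \<gamma>" for j
        using ws[of j] by (simp only: wc[of _ j])
    qed (use ws w0 G0 in auto)
    also have "\<dots> \<le> A * ((G * (h * gap n n') powr - \<gamma>) * F n * F n')"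
    proof -
      have "sqrt (\<Sum>m\<in>Ms. (?f n m)\<^sup>2) \<le> F n" for n
        using real_sqrt_le_mono[OF sum_f[OF r q2, of n]] by (simp add: F_def)
      thus ?thesis using A G0 by (intro mult_left_mono mult_mono mult_nonneg_nonneg) (auto simp: F_def intro!: sum_nonneg)
    qed
    finally show ?thesis by (simp add: mult_ac)
  qed
  have "h * (\<Sum>n\<in>N. F n powr p) \<le> (HLS_const \<gamma> * (A * G) * nsq \<psi>) powr (1 / \<gamma>)"
  proof (rule TTstar_HLS[OF \<gamma>(2,3) p_def h finite_N UL _ _ ipU \<psi>])
    show "h * (\<Sum>n\<in>N. F n powr p) \<le> h * (\<Sum>n\<in>N. Re (ip \<psi> (U n)))"
      unfolding Fp U_def using h by (intro mult_left_mono sum_mono Re_ip_V r q2) auto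
  qed (use A G0 in \<open>auto simp: F_def\<close>)
  thus ?thesis by (simp add: Fp G_def \<alpha>_def \<beta>_def q)
qed

end

text \<open>For r = \<infinity> the dual functions are normalised in L1 and there is one of them per
  time, so no sum over scales occurs and the dispersive decay \<sigma> < 1 enters
  \<open>TTstar_HLS\<close> directly.\<close>

lemma sup_estimate:
  fixes a :: "int \<Rightarrow> 'a::euclidean_space \<Rightarrow> complex"
  assumes \<sigma>: "0 < \<sigma>" "\<sigma> < 1" and q: "q = 2 / \<sigma>" and h: "h > 0" and N: "finite N"
    and A: "A \<ge> 0" and \<psi>: "\<psi> \<in> L2" and a: "\<And>n. a n \<in> L2" and c: "\<And>n. c n \<ge> 0"
    and nsq_a: "\<And>n. nsq (a n) \<le> A * h powr - \<sigma>"
    and ip_a: "\<And>n n'. n \<noteq> n' \<Longrightarrow> cmod (ip (a n) (a n')) \<le> A * (h * gap n n') powr - \<sigma>"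
    and ip_\<psi>: "\<And>n. c n \<le> Re (ip \<psi> (a n))"
  shows "h * (\<Sum>n\<in>N. c n powr q) \<le> (HLS_const \<sigma> * A * nsq \<psi>) powr (q / 2)"
proof -
  define p where "p = 2 / (2 - \<sigma>)"
  have pq: "(q - 1) * p = q" using \<sigma> by (simp add: p_def q field_simps)
  have q2: "q > 2" using \<sigma> by (simp add: q field_simps)
  define F where "F n = c n powr (q - 1)" for n
  have Fp: "F n powr p = c n powr q" for n by (simp add: F_def powr_powr pq)
  define U where "U n = (\<lambda>x. of_real (F n) * a n x)" for n
  have F0: "F n \<ge> 0" for n by (simp add: F_def)
  have "h * (\<Sum>n\<in>N. F n powr p) \<le> (HLS_const \<sigma> * A * nsq \<psi>) powr (1 / \<sigma>)"
  proof (rule TTstar_HLS[OF \<sigma> p_def h N _ F0 A _ \<psi>])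
    show "U n \<in> L2" for n unfolding U_def by (intro L2_cmult a)
    show "cmod (ip (U n) (U m)) \<le> A * F n * F m * (h * gap n m) powr - \<sigma>" for n m
    proof -
      have "cmod (ip (a n) (a m)) \<le> A * (h * gap n m) powr - \<sigma>"
      proof (cases "n = m")
        case True
        thus ?thesis using nsq_a[of n] by (simp add: ip_self gap_def)
      qed (rule ip_a)
      hence "F n * F m * cmod (ip (a n) (a m)) \<le> F n * F m * (A * (h * gap n m) powr - \<sigma>)"
        by (intro mult_left_mono mult_nonneg_nonneg F0)
      thus ?thesis by (simp add: U_def ip_cmult_left ip_cmult_right norm_mult abs_of_nonneg F0 mult_ac)
    qed
    show "h * (\<Sum>n\<in>N. F n powr p) \<le> h * (\<Sum>n\<in>N. Re (ip \<psi> (U n)))"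
    proof (intro mult_left_mono sum_mono)
      fix n
      have "c n powr q = F n * c n"
        unfolding F_def using c[of n] q2 by (cases "c n = 0") (auto simp: powr_diff)
      hence "F n powr p = F n * c n" by (simp only: Fp)
      also have "\<dots> \<le> F n * Re (ip \<psi> (a n))" by (intro mult_left_mono ip_\<psi> F0)
      also have "\<dots> = Re (ip \<psi> (U n))" by (simp add: U_def ip_cmult_right)
      finally show "F n powr p \<le> Re (ip \<psi> (U n))" .
    qed (use h in auto)
  qed
  thus ?thesis by (simp add: Fp q)
qed

section \<open>Level sets and mixed norms\<close>

lemma enn_rpow_ennreal: "x \<ge> 0 \<Longrightarrow> enn_rpow (ennreal x) p = ennreal (x powr p)"
  by (simp add: enn_rpow_def)

lemma enn_rpow_mono:
  assumes "x \<le> y" "p \<ge> 0" shows "enn_rpow x p \<le> enn_rpow y p"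
proof (cases "y = top")
  case False
  then obtain b where b: "y = ennreal b" "b \<ge> 0" by (cases y) auto
  then obtain a where a: "x = ennreal a" "a \<ge> 0" using assms(1) by (cases x) (auto simp: top_unique)
  show ?thesis using assms a b by (simp add: enn_rpow_ennreal ennreal_leI powr_mono2)
qed (simp add: enn_rpow_def)

lemma enn_rpow_rpow: "enn_rpow (enn_rpow x p) s = enn_rpow x (p * s)"
proof (cases "x = top")
  case False
  then obtain a where a: "x = ennreal a" "a \<ge> 0" by (cases x) auto
  thus ?thesis by (simp add: enn_rpow_ennreal powr_powr)
qed (simp add: enn_rpow_def)

text \<open>Inverting the power turns the bounds for all i into one bound for the supremum, which
  replaces continuity of \<open>enn_rpow\<close>.\<close>

lemma enn_rpow_SUP_le:
  assumes s: "s > 0" and x: "x \<le> (SUP i\<in>I. ennreal (X i))" and X: "\<And>i. i \<in> I \<Longrightarrow> X i \<ge> 0"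
    and L: "\<And>i. i \<in> I \<Longrightarrow> ennreal (X i powr s) \<le> L"
  shows "enn_rpow x s \<le> L"
proof (cases "L = top")
  case False
  then obtain l where l: "L = ennreal l" "l \<ge> 0" by (cases L) auto
  have "X i \<le> l powr (1 / s)" if "i \<in> I" for i
  proof -
    have "X i powr s \<le> l" using L[OF that] l by simp
    hence "(X i powr s) powr (1 / s) \<le> l powr (1 / s)" using s by (intro powr_mono2) auto
    thus ?thesis using s X[OF that] by (simp add: powr_powr)
  qed
  hence "(SUP i\<in>I. ennreal (X i)) \<le> ennreal (l powr (1 / s))" by (intro SUP_least ennreal_leI)
  hence "enn_rpow x s \<le> enn_rpow (ennreal (l powr (1 / s))) s" using x s by (intro enn_rpow_mono) auto
  also have "\<dots> = L" using l s by (simp add: enn_rpow_ennreal powr_powr)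
  finally show ?thesis .
qed simp

lemma lp_norm_L2:
  assumes "v \<in> L2" shows "lp_norm lborel 2 (\<lambda>x. ennreal (cmod (v x))) = ennreal (sqrt (nsq v))"
proof -
  have "(\<integral>\<^sup>+ x. ennreal ((cmod (v x))\<^sup>2) \<partial>lborel) = ennreal (nsq v)"
    unfolding nsq_def using L2_integrable[OF assms] by (intro nn_integral_eq_integral) auto
  moreover have "real_of_ereal 2 = 2" by simp
  moreover have "(2::ereal) \<noteq> \<infinity>" by simp
  ultimately show ?thesis unfolding lp_norm_def
    by (simp add: enn_rpow_ennreal powr_half_sqrt)
qed

section \<open>Distribution functions at dyadic heights and their semicontinuity\<close>

definition lev :: "('a::euclidean_space \<Rightarrow> complex) \<Rightarrow> int \<Rightarrow> 'a set" where
  "lev v k = {x. 2 powr real_of_int k < cmod (v x)}"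

definition mu :: "('a::euclidean_space \<Rightarrow> complex) \<Rightarrow> int \<Rightarrow> real" where
  "mu v k = measure lborel (lev v k)"

lemma mu_nonneg [simp]: "mu v k \<ge> 0" by (simp add: mu_def)

lemma Chebyshev_L2:
  assumes v: "v \<in> L2" and \<eta>: "\<eta> > 0"
  shows "{x. \<eta> < cmod (v x)} \<in> sets borel" "emeasure lborel {x. \<eta> < cmod (v x)} < \<infinity>"
    "\<eta>\<^sup>2 * measure lborel {x. \<eta> < cmod (v x)} \<le> nsq v"
proof -
  have [measurable]: "v \<in> borel_measurable borel" by (rule L2_measurable[OF v])
  let ?E = "{x. \<eta> < cmod (v x)}"
  show E: "?E \<in> sets borel" by measurable
  have b: "indicator ?E x \<le> (1 / \<eta>\<^sup>2) * (cmod (v x))\<^sup>2" for x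
    using \<eta> power_mono[of \<eta> "cmod (v x)" 2] by (auto simp: indicator_def field_simps)
  have i: "integrable lborel (\<lambda>x. (1 / \<eta>\<^sup>2) * (cmod (v x))\<^sup>2)" using L2_integrable[OF v] by (rule integrable_mult_right)
  have I: "integrable lborel (indicat_real ?E)"
  proof (rule Bochner_Integration.integrable_bound[OF i])
    show "AE x in lborel. norm (indicat_real ?E x) \<le> norm ((1 / \<eta>\<^sup>2) * (cmod (v x))\<^sup>2)"
      using b by (intro AE_I2) (simp add: abs_mult)
  qed (use E in simp)
  thus "emeasure lborel ?E < \<infinity>" using E by (simp add: integrable_indicator_iff)
  have "measure lborel ?E = (LINT x|lborel. indicat_real ?E x)" using E by simp
  also have "\<dots> \<le> (LINT x|lborel. (1 / \<eta>\<^sup>2) * (cmod (v x))\<^sup>2)" by (rule integral_mono[OF I i]) (rule b)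
  also have "\<dots> = (1 / \<eta>\<^sup>2) * nsq v" by (simp add: nsq_def)
  finally show "\<eta>\<^sup>2 * measure lborel ?E \<le> nsq v" using \<eta> by (simp add: field_simps)
qed

lemma lev_measurable: "v \<in> L2 \<Longrightarrow> lev v k \<in> sets borel"
  and emeasure_lev: "v \<in> L2 \<Longrightarrow> emeasure lborel (lev v k) = ennreal (mu v k)"
proof -
  assume v: "v \<in> L2"
  have p: "2 powr real_of_int k > (0::real)" by simp
  show "lev v k \<in> sets borel" unfolding lev_def by (rule Chebyshev_L2[OF v p])
  have "emeasure lborel (lev v k) < \<infinity>" unfolding lev_def by (rule Chebyshev_L2[OF v p])
  thus "emeasure lborel (lev v k) = ennreal (mu v k)" unfolding mu_def by (intro emeasure_eq_ennreal_measure) auto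
qed

text \<open>Where |v| exceeds 2 * 2^k, either |v'| or |v - v'| exceeds 2^k; Chebyshev bounds the
  second set. One dyadic level is the price of passing to a nearby function.\<close>

lemma mu_perturb:
  assumes v: "v \<in> L2" and v': "v' \<in> L2"
  shows "mu v (k + 1) \<le> mu v' k + nsq (\<lambda>x. v x - v' x) / (2 powr real_of_int k)\<^sup>2"
proof -
  let ?\<eta> = "2 powr real_of_int k :: real"
  have \<eta>: "?\<eta> > 0" by simp
  let ?D = "{x. ?\<eta> < cmod (v x - v' x)}"
  note D = Chebyshev_L2[OF L2_diff[OF v v'] \<eta>]
  have sub: "lev v (k + 1) \<subseteq> lev v' k \<union> ?D"
  proof
    fix x assume "x \<in> lev v (k + 1)"
    hence "2 * ?\<eta> < cmod (v x)" by (simp add: lev_def powr_add)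
    thus "x \<in> lev v' k \<union> ?D" using norm_triangle_ineq[of "v x - v' x" "v' x"] by (auto simp: lev_def)
  qed
  have "emeasure lborel (lev v (k + 1)) \<le> emeasure lborel (lev v' k \<union> ?D)"
    by (rule emeasure_mono[OF sub]) (use sets.Un[OF lev_measurable[OF v', of k] D(1)] in simp)
  also have "\<dots> \<le> emeasure lborel (lev v' k) + emeasure lborel ?D"
    by (rule emeasure_subadditive) (simp_all add: D(1) lev_measurable[OF v'])
  also have "emeasure lborel ?D = ennreal (measure lborel ?D)"
    by (rule emeasure_eq_ennreal_measure) (use D(2) in \<open>simp add: less_top\<close>)
  finally have "ennreal (mu v (k + 1)) \<le> ennreal (mu v' k) + ennreal (measure lborel ?D)"
    unfolding emeasure_lev[OF v] emeasure_lev[OF v'] .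
  hence "ennreal (mu v (k + 1)) \<le> ennreal (mu v' k + measure lborel ?D)"
    by (simp only: ennreal_plus[OF mu_nonneg measure_nonneg])
  hence "mu v (k + 1) \<le> mu v' k + measure lborel ?D"
    by (simp only: ennreal_le_iff[OF add_nonneg_nonneg[OF mu_nonneg measure_nonneg]])
  moreover have "measure lborel ?D \<le> nsq (\<lambda>x. v x - v' x) / ?\<eta>\<^sup>2"
    using D(3) \<eta> by (simp add: pos_le_divide_eq mult.commute)
  ultimately show ?thesis by linarith
qed

text \<open>Lower semicontinuity up to one level and a factor 2. The second conclusion says that
  level k eventually passes the vanishing threshold \<delta>, hence is
  \<open>active\<close>.\<close>

lemma mu_lsc:
  assumes v: "v \<in> L2" and s: "\<And>j. s j \<in> L2" and lim: "(\<lambda>j. nsq (\<lambda>x. v x - s j x)) \<longlonglongrightarrow> 0"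
    and \<delta>: "\<delta> \<longlonglongrightarrow> (0::real)" and pos: "mu v (k + 1) > 0"
  shows "\<forall>\<^sub>F j in sequentially. mu v (k + 1) \<le> 2 * mu (s j) k \<and> \<delta> j \<le> mu (s j) k"
proof -
  let ?\<eta> = "(2 powr real_of_int k :: real)\<^sup>2"
  have "?\<eta> > 0" by simp
  hence "\<forall>\<^sub>F j in sequentially. nsq (\<lambda>x. v x - s j x) < mu v (k + 1) / 2 * ?\<eta>"
    using lim pos by (intro order_tendstoD(2)) auto
  moreover have "\<forall>\<^sub>F j in sequentially. \<delta> j < mu v (k + 1) / 2" using \<delta> pos by (intro order_tendstoD(2)) auto
  ultimately show ?thesis
  proof eventually_elim
    case (elim j)
    have "nsq (\<lambda>x. v x - s j x) / ?\<eta> \<le> mu v (k + 1) / 2" using elim(1) \<open>?\<eta> > 0\<close> by (simp add: pos_divide_le_eq)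
    thus ?case using mu_perturb[OF v s, of k j] elim(2) by (intro conjI) linarith+
  qed
qed

text \<open>The threshold will be \<open>\<delta> = h powr \<sigma>\<close>, which keeps the time scale of every atom above the grid step \<open>h\<close>.\<close>

definition active :: "nat \<Rightarrow> real \<Rightarrow> ('a::euclidean_space \<Rightarrow> complex) \<Rightarrow> int set" where
  "active K \<delta> v = {k \<in> {- int K..int K}. \<delta> \<le> mu v k}"

lemma finite_active [simp]: "finite (active K \<delta> v)"
  by (rule finite_subset[of _ "{- int K..int K}"]) (auto simp: active_def)

text \<open>A discretised L^r norm restricted to the active levels. For r = \<infinity> it is the
  highest active level, with value 0 if there is none.\<close>

definition level_norm :: "ereal \<Rightarrow> nat \<Rightarrow> real \<Rightarrow> ('a::euclidean_space \<Rightarrow> complex) \<Rightarrow> real" where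
  "level_norm r K \<delta> v = (if r = \<infinity> then (if active K \<delta> v = {} then 0 else 2 powr real_of_int (Max (active K \<delta> v)))
     else (\<Sum>k\<in>active K \<delta> v. 2 powr (real_of_int k * real_of_ereal r) * mu v k) powr (1 / real_of_ereal r))"

lemma level_norm_nonneg: "level_norm r K \<delta> v \<ge> 0" by (simp add: level_norm_def)

lemma exists_dyadic: assumes "y > (0::real)" shows "\<exists>k::int. 2 powr real_of_int k < y \<and> y \<le> 2 * 2 powr real_of_int k"
proof -
  define k where "k = \<lceil>log 2 y\<rceil> - 1"
  have "real_of_int k < log 2 y" "log 2 y \<le> real_of_int k + 1" unfolding k_def by linarith+
  hence "2 powr real_of_int k < 2 powr log 2 y" "2 powr log 2 y \<le> 2 powr (real_of_int k + 1)" by auto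
  thus ?thesis using assms by (auto simp: powr_add intro!: exI[of _ k])
qed

text \<open>Layer-cake sums over finitely many levels, each compared with s j by
  \<open>mu_lsc\<close>. In 4 powr r one factor 2 comes from dyadic rounding of |v| and one from the
  shift by a level; the remaining 2 comes from \<open>mu_lsc\<close>.\<close>

lemma level_norm_lsc_finite:
  fixes v :: "'a::euclidean_space \<Rightarrow> complex"
  assumes v: "v \<in> L2" and s: "\<And>j. s j \<in> L2" and lim: "(\<lambda>j. nsq (\<lambda>x. v x - s j x)) \<longlonglongrightarrow> 0"
    and \<delta>: "\<delta> \<longlonglongrightarrow> (0::real)" and K: "filterlim K at_top sequentially" and q: "q > 0" and r: "r > 0"
  shows "enn_rpow (lp_norm lborel (ereal r) (\<lambda>x. ennreal (cmod (v x)))) q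
    \<le> liminf (\<lambda>j. ennreal ((2 * 4 powr r) powr (q / r) * level_norm (ereal r) (K j) (\<delta> j) (s j) powr q))"
proof -
  define I where "I = (\<integral>\<^sup>+ x. ennreal (cmod (v x) powr r) \<partial>lborel)"
  have lp: "enn_rpow (lp_norm lborel (ereal r) (\<lambda>x. ennreal (cmod (v x)))) q = enn_rpow I (q / r)"
    by (simp add: lp_norm_def enn_rpow_rpow I_def enn_rpow_ennreal)
  define X where "X n = 4 powr r * (\<Sum>k\<in>{- int n..int n}. 2 powr (real_of_int k * r) * mu v (k + 1))" for n
  have X0: "X n \<ge> 0" for n by (auto simp: X_def intro!: mult_nonneg_nonneg sum_nonneg)
  have [measurable]: "v \<in> borel_measurable borel" by (rule L2_measurable[OF v])
  note [measurable] = lev_measurable[OF v]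
  define F where "F n x = 4 powr r * (\<Sum>k\<in>{- int n..int n}. 2 powr (real_of_int k * r) * indicator (lev v (k + 1)) x)" for n :: nat and x
  have F0: "F n x \<ge> 0" for n x by (auto simp: F_def intro!: mult_nonneg_nonneg sum_nonneg)
  have Xint: "(\<integral>\<^sup>+ x. ennreal (F n x) \<partial>lborel) = ennreal (X n)" for n
  proof -
    have i: "integrable lborel (\<lambda>x. 2 powr (real_of_int k * r) * indicat_real (lev v (k + 1)) x)" for k
      using lev_measurable[OF v, of "k + 1"] emeasure_lev[OF v, of "k + 1"]
      by (intro integrable_mult_right integrable_real_indicator) auto
    have "integrable lborel (F n)" unfolding F_def by (intro integrable_mult_right Bochner_Integration.integrable_sum i)
    hence "(\<integral>\<^sup>+ x. ennreal (F n x) \<partial>lborel) = ennreal (LINT x|lborel. F n x)"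
      by (rule nn_integral_eq_integral) (intro AE_I2 F0)
    also have "(LINT x|lborel. F n x) = 4 powr r * (\<Sum>k\<in>{- int n..int n}. LINT x|lborel. 2 powr (real_of_int k * r) * indicat_real (lev v (k + 1)) x)"
    proof -
      have "(LINT x|lborel. (\<Sum>k\<in>{- int n..int n}. 2 powr (real_of_int k * r) * indicat_real (lev v (k + 1)) x))
        = (\<Sum>k\<in>{- int n..int n}. LINT x|lborel. 2 powr (real_of_int k * r) * indicat_real (lev v (k + 1)) x)"
        by (rule Bochner_Integration.integral_sum) (rule i)
      thus ?thesis unfolding F_def by (simp only: integral_mult_right_zero[of _ "4 powr r"])
    qed
    also have "\<dots> = X n"
      unfolding X_def mu_def using lev_measurable[OF v] by simp
    finally show ?thesis .
  qed
  have le: "I \<le> (SUP n. ennreal (X n))"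
  proof -
    have "ennreal (cmod (v x) powr r) \<le> (SUP n. ennreal (F n x))" for x
    proof (cases "v x = 0")
      case False
      then obtain k where k: "2 powr real_of_int k < cmod (v x)" "cmod (v x) \<le> 2 * 2 powr real_of_int k"
        using exists_dyadic[of "cmod (v x)"] by auto
      let ?n = "nat \<bar>k - 1\<bar>"
      have "cmod (v x) powr r \<le> (4 * 2 powr real_of_int (k - 1)) powr r"
        using k r by (intro powr_mono2) (auto simp: powr_diff)
      also have "\<dots> = 4 powr r * (2 powr (real_of_int (k - 1) * r) * indicator (lev v (k - 1 + 1)) x)"
        using k(1) by (simp add: powr_mult powr_powr lev_def)
      also have "\<dots> \<le> F ?n x" unfolding F_def
        by (intro mult_left_mono member_le_sum[of "k - 1" "{- int ?n..int ?n}" "\<lambda>k. 2 powr (real_of_int k * r) * indicator (lev v (k + 1)) x"]) auto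
      finally have "ennreal (cmod (v x) powr r) \<le> ennreal (F ?n x)" by (rule ennreal_leI)
      also have "\<dots> \<le> (SUP n. ennreal (F n x))" by (rule SUP_upper) simp
      finally show ?thesis .
    qed (use r in simp)
    hence "I \<le> (\<integral>\<^sup>+ x. (SUP n. ennreal (F n x)) \<partial>lborel)" unfolding I_def by (intro nn_integral_mono)
    also have "\<dots> = (SUP n. \<integral>\<^sup>+ x. ennreal (F n x) \<partial>lborel)"
    proof (rule nn_integral_monotone_convergence_SUP)
      show "incseq (\<lambda>n x. ennreal (F n x))"
        unfolding F_def by (intro incseq_SucI le_funI ennreal_leI mult_left_mono sum_mono2) auto
      show "(\<lambda>x. ennreal (F n x)) \<in> borel_measurable lborel" for n unfolding F_def by measurable
    qed
    finally show ?thesis by (simp add: Xint)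
  qed
  show ?thesis unfolding lp
  proof (rule enn_rpow_SUP_le[OF _ le X0])
    fix n
    have "\<forall>\<^sub>F j in sequentially. X n \<le> (2 * 4 powr r) * (\<Sum>k\<in>active (K j) (\<delta> j) (s j). 2 powr (real_of_int k * r) * mu (s j) k)"
    proof -
      have 1: "\<forall>\<^sub>F j in sequentially. mu v (k + 1) > 0 \<longrightarrow> mu v (k + 1) \<le> 2 * mu (s j) k \<and> \<delta> j \<le> mu (s j) k" for k
      proof (cases "mu v (k + 1) > 0")
        case True
        from mu_lsc[OF v s lim \<delta> True] show ?thesis by eventually_elim auto
      qed auto
      have "\<forall>\<^sub>F j in sequentially. \<forall>k\<in>{- int n..int n}. mu v (k + 1) > 0 \<longrightarrow> mu v (k + 1) \<le> 2 * mu (s j) k \<and> \<delta> j \<le> mu (s j) k"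
        using 1 by (intro eventually_ball_finite) auto
      moreover have "\<forall>\<^sub>F j in sequentially. n \<le> K j" using K by (simp add: filterlim_at_top)
      ultimately show ?thesis
      proof eventually_elim
        case (elim j)
        \<comment> \<open>Levels of measure zero contribute nothing; the finitely many others are
          active for s j by now.\<close>
        let ?P = "{k\<in>{- int n..int n}. mu v (k + 1) > 0}"
        have sub: "?P \<subseteq> active (K j) (\<delta> j) (s j)" using elim by (auto simp: active_def)
        have "(\<Sum>k\<in>{- int n..int n}. 2 powr (real_of_int k * r) * mu v (k + 1)) = (\<Sum>k\<in>?P. 2 powr (real_of_int k * r) * mu v (k + 1))"
        proof (rule sum.mono_neutral_right)
          show "\<forall>k\<in>{- int n..int n} - ?P. 2 powr (real_of_int k * r) * mu v (k + 1) = 0"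
          proof
            fix k assume "k \<in> {- int n..int n} - ?P"
            hence "\<not> 0 < mu v (k + 1)" by blast
            hence "mu v (k + 1) = 0" using mu_nonneg[of v "k + 1"] by linarith
            thus "2 powr (real_of_int k * r) * mu v (k + 1) = 0" by simp
          qed
        qed auto
        also have "\<dots> \<le> (\<Sum>k\<in>?P. 2 powr (real_of_int k * r) * (2 * mu (s j) k))"
        proof (rule sum_mono)
          fix k assume "k \<in> ?P"
          hence "mu v (k + 1) \<le> 2 * mu (s j) k" using elim(1) by blast
          thus "2 powr (real_of_int k * r) * mu v (k + 1) \<le> 2 powr (real_of_int k * r) * (2 * mu (s j) k)"
            by (rule mult_left_mono) simp
        qed
        also have "\<dots> \<le> (\<Sum>k\<in>active (K j) (\<delta> j) (s j). 2 powr (real_of_int k * r) * (2 * mu (s j) k))"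
          by (rule sum_mono2[OF finite_active sub]) simp
        also have "\<dots> = 2 * (\<Sum>k\<in>active (K j) (\<delta> j) (s j). 2 powr (real_of_int k * r) * mu (s j) k)"
          by (simp add: sum_distrib_left mult_ac)
        finally have "4 powr r * (\<Sum>k\<in>{- int n..int n}. 2 powr (real_of_int k * r) * mu v (k + 1))
          \<le> 4 powr r * (2 * (\<Sum>k\<in>active (K j) (\<delta> j) (s j). 2 powr (real_of_int k * r) * mu (s j) k))"
          by (rule mult_left_mono) simp
        thus ?case unfolding X_def by (simp only: mult.assoc mult.left_commute[of 2])
      qed
    qed
    hence "\<forall>\<^sub>F j in sequentially. ennreal (X n powr (q / r)) \<le> ennreal ((2 * 4 powr r) powr (q / r) * level_norm (ereal r) (K j) (\<delta> j) (s j) powr q)"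
    proof eventually_elim
      case (elim j)
      have "X n powr (q / r) \<le> ((2 * 4 powr r) * (\<Sum>k\<in>active (K j) (\<delta> j) (s j). 2 powr (real_of_int k * r) * mu (s j) k)) powr (q / r)"
        using elim X0 q r by (intro powr_mono2) auto
      also have "\<dots> = (2 * 4 powr r) powr (q / r) * (\<Sum>k\<in>active (K j) (\<delta> j) (s j). 2 powr (real_of_int k * r) * mu (s j) k) powr (q / r)"
        by (rule powr_mult)
      also have "(\<Sum>k\<in>active (K j) (\<delta> j) (s j). 2 powr (real_of_int k * r) * mu (s j) k) powr (q / r) = level_norm (ereal r) (K j) (\<delta> j) (s j) powr q"
        by (simp add: level_norm_def powr_powr)
      finally show ?case by (rule ennreal_leI)
    qed
    thus "ennreal (X n powr (q / r)) \<le> liminf (\<lambda>j. ennreal ((2 * 4 powr r) powr (q / r) * level_norm (ereal r) (K j) (\<delta> j) (s j) powr q))"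
      by (rule Liminf_bounded)
  qed (use q r in auto)
qed

text \<open>Outside the union of the countably many null superlevel sets, |v| is at most 4 times a
  level k with mu v (k + 1) > 0, and every such k is eventually active for s j.\<close>

lemma level_norm_lsc_infinite:
  fixes v :: "'a::euclidean_space \<Rightarrow> complex"
  assumes v: "v \<in> L2" and s: "\<And>j. s j \<in> L2" and lim: "(\<lambda>j. nsq (\<lambda>x. v x - s j x)) \<longlonglongrightarrow> 0"
    and \<delta>: "\<delta> \<longlonglongrightarrow> (0::real)" and K: "filterlim K at_top sequentially" and q: "q > 0"
  shows "enn_rpow (lp_norm lborel \<infinity> (\<lambda>x. ennreal (cmod (v x)))) q
    \<le> liminf (\<lambda>j. ennreal (4 powr q * level_norm \<infinity> (K j) (\<delta> j) (s j) powr q))" (is "_ \<le> ?L")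
proof (rule enn_rpow_SUP_le[OF q])
  let ?P = "{k. mu v (k + 1) > 0}"
  let ?X = "\<lambda>k. 4 * 2 powr real_of_int k"
  show "lp_norm lborel \<infinity> (\<lambda>x. ennreal (cmod (v x))) \<le> (SUP k\<in>?P. ennreal (?X k))"
  proof -
    have "AE x in lborel. \<forall>k. mu v (k + 1) = 0 \<longrightarrow> x \<notin> lev v (k + 1)"
      unfolding AE_all_countable
    proof
      fix k
      show "AE x in lborel. mu v (k + 1) = 0 \<longrightarrow> x \<notin> lev v (k + 1)"
      proof (cases "mu v (k + 1) = 0")
        case True
        hence "lev v (k + 1) \<in> null_sets lborel" using emeasure_lev[OF v, of "k + 1"] lev_measurable[OF v, of "k + 1"] by auto
        from AE_not_in[OF this] show ?thesis by eventually_elim auto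
      qed auto
    qed
    hence "AE x in lborel. ennreal (cmod (v x)) \<le> (SUP k\<in>?P. ennreal (?X k))"
    proof eventually_elim
      case (elim x)
      show ?case
      proof (cases "v x = 0")
        case False
        then obtain k where k: "2 powr real_of_int k < cmod (v x)" "cmod (v x) \<le> 2 * 2 powr real_of_int k"
          using exists_dyadic[of "cmod (v x)"] by auto
        have "x \<in> lev v ((k - 1) + 1)" using k by (simp add: lev_def)
        hence "mu v ((k - 1) + 1) \<noteq> 0" using elim by blast
        hence "k - 1 \<in> ?P" by (simp add: less_le)
        moreover have "ennreal (cmod (v x)) \<le> ennreal (?X (k - 1))" using k by (intro ennreal_leI) (simp add: powr_diff)
        ultimately show ?thesis by (meson SUP_upper2)
      qed simp
    qed
    thus ?thesis by (auto simp: lp_norm_def intro: Inf_lower)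
  qed
  fix k assume k: "k \<in> ?P"
  have "\<forall>\<^sub>F j in sequentially. mu v (k + 1) \<le> 2 * mu (s j) k \<and> \<delta> j \<le> mu (s j) k"
    using k by (intro mu_lsc v s lim \<delta>) auto
  moreover have "\<forall>\<^sub>F j in sequentially. nat \<bar>k\<bar> \<le> K j" using K by (simp add: filterlim_at_top)
  ultimately have "\<forall>\<^sub>F j in sequentially. ennreal (?X k powr q) \<le> ennreal (4 powr q * level_norm \<infinity> (K j) (\<delta> j) (s j) powr q)"
  proof eventually_elim
    case (elim j)
    have ka: "k \<in> active (K j) (\<delta> j) (s j)" using elim by (auto simp: active_def)
    hence "real_of_int k \<le> real_of_int (Max (active (K j) (\<delta> j) (s j)))" by (auto intro: Max_ge)
    hence "2 powr real_of_int k \<le> level_norm \<infinity> (K j) (\<delta> j) (s j)" using ka by (auto simp: level_norm_def)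
    hence "?X k powr q \<le> (4 * level_norm \<infinity> (K j) (\<delta> j) (s j)) powr q" using q by (intro powr_mono2) auto
    thus ?case by (intro ennreal_leI) (simp only: powr_mult)
  qed
  thus "ennreal (?X k powr q) \<le> ?L" by (rule Liminf_bounded)
qed simp

section \<open>Discrete Strichartz estimates\<close>

text \<open>The phase of v on a superlevel set, so that pairing v with its atom integrates |v|
  there.\<close>

definition atom :: "('a::euclidean_space \<Rightarrow> complex) \<Rightarrow> int \<Rightarrow> 'a \<Rightarrow> complex" where
  "atom v k x = indicator (lev v k) x * sgn (v x)"

lemma cmod_atom: "cmod (atom v k x) = indicator (lev v k) x"
  using powr_gt_zero[of 2 "real_of_int k"]
  by (auto simp: atom_def indicator_def norm_sgn lev_def norm_mult simp del: powr_gt_zero)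

lemma
  assumes v: "v \<in> L2"
  shows atom_integrable: "integrable lborel (atom v k)" and atom_L2: "atom v k \<in> L2"
    and L1_atom: "(LINT x|lborel. cmod (atom v k x)) = mu v k" and nsq_atom: "nsq (atom v k) = mu v k"
    and ip_atom: "2 powr real_of_int k * mu v k \<le> Re (ip v (atom v k))"
proof -
  note [measurable] = L2_measurable[OF v] lev_measurable[OF v, of k]
  have I: "integrable lborel (indicat_real (lev v k))"
    using lev_measurable[OF v, of k] emeasure_lev[OF v, of k] by (intro integrable_real_indicator) auto
  have m: "atom v k \<in> borel_measurable borel"
  proof -
    have "atom v k = (\<lambda>x. indicator (lev v k) x * (v x / of_real (cmod (v x))))"
      by (auto simp: atom_def sgn_eq)
    thus ?thesis by simp
  qed
  have Ii: "(LINT x|lborel. indicat_real (lev v k) x) = mu v k"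
    using lev_measurable[OF v, of k] by (simp add: mu_def)
  show ai: "integrable lborel (atom v k)"
    by (rule Bochner_Integration.integrable_bound[OF I]) (use m in \<open>auto simp: cmod_atom\<close>)
  have sq: "(cmod (atom v k x))\<^sup>2 = indicat_real (lev v k) x" for x by (simp add: cmod_atom indicator_def)
  show aL: "atom v k \<in> L2" unfolding L2_iff sq using m I by simp
  show "(LINT x|lborel. cmod (atom v k x)) = mu v k" unfolding cmod_atom Ii ..
  show "nsq (atom v k) = mu v k" unfolding nsq_def sq Ii ..
  have pt: "v x * cnj (atom v k x) = of_real (indicator (lev v k) x * cmod (v x))" for x
    by (simp add: atom_def indicator_def sgn_eq complex_norm_square[symmetric] power2_eq_square)
  have J: "integrable lborel (\<lambda>x. indicator (lev v k) x * cmod (v x))"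
    using integrable_Re[OF integrable_ip[OF v aL]] unfolding pt by simp
  have "ip v (atom v k) = of_real (LINT x|lborel. indicator (lev v k) x * cmod (v x))"
    unfolding ip_def pt by (rule integral_complex_of_real)
  hence "Re (ip v (atom v k)) = (LINT x|lborel. indicator (lev v k) x * cmod (v x))" by simp
  moreover have "(LINT x|lborel. 2 powr real_of_int k * indicat_real (lev v k) x) \<le> (LINT x|lborel. indicator (lev v k) x * cmod (v x))"
    by (rule integral_mono[OF integrable_mult_right[OF I] J]) (auto simp: indicator_def lev_def)
  ultimately show "2 powr real_of_int k * mu v k \<le> Re (ip v (atom v k))" by (simp add: mu_def)
qed

text \<open>The solution is specified at each time separately, through its transform in space; joint
  measurability in (t, x) is not part of the setting.\<close>

locale flow =
  fixes a :: "'a::euclidean_space" and M :: real and \<psi> :: "'a \<Rightarrow> complex" and u :: "real \<Rightarrow> 'a \<Rightarrow> complex"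
  assumes a: "norm a = 1" and \<psi>: "\<psi> \<in> L2" and supp: "AE \<xi> in lborel. \<bar>a \<bullet> \<xi>\<bar> > M \<longrightarrow> \<psi> \<xi> = 0"
    and u: "\<And>t. u t \<in> L2" and Fu: "\<And>t. fourier_L2 (u t) (\<lambda>\<xi>. cis (- t * (norm \<xi>)\<^sup>2) * \<psi> \<xi>)"
begin

definition \<sigma> :: real where "\<sigma> = (real DIM('a) - 1) / 2"
text \<open>One constant for the L2 bound \<open>nsq_P\<close> and the dispersive bound
  \<open>ip_P\<close>.\<close>

definition A :: real where "A = max ((2 * pi) ^ DIM('a)) (sqrt pi ^ (DIM('a) - 1) * sqrt (pi / 2))"
abbreviation "\<psi>' \<equiv> unweight M a \<psi>"
definition P :: "real \<Rightarrow> int \<Rightarrow> 'a \<Rightarrow> complex" where "P t k = adjoint_flow a t (atom (u t) k)"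

lemma A_pos: "A > 0" by (auto simp: A_def less_max_iff_disj)
lemma P_L2: "P t k \<in> L2" unfolding P_def by (intro adjoint_flow_L2 atom_L2 atom_integrable u)

lemma nsq_P: "nsq (P t k) \<le> A * mu (u t) k"
proof -
  have "nsq (P t k) \<le> (2 * pi) ^ DIM('a) * mu (u t) k"
    unfolding P_def using adjoint_flow_L2(2)[OF atom_integrable[OF u] atom_L2[OF u], of a t t k] by (simp add: nsq_atom[OF u])
  also have "\<dots> \<le> A * mu (u t) k" by (intro mult_right_mono) (auto simp: A_def)
  finally show ?thesis .
qed

lemma ip_P:
  assumes "t \<noteq> s"
  shows "cmod (ip (P t k) (P s l)) \<le> A * (\<bar>t - s\<bar> powr - \<sigma> * (mu (u t) k * mu (u s) l))"
proof -
  have ts: "\<bar>t - s\<bar> > 0" using assms by simp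
  have "sqrt (pi / \<bar>t - s\<bar>) ^ (DIM('a) - 1) = sqrt pi ^ (DIM('a) - 1) * \<bar>t - s\<bar> powr - \<sigma>"
  proof -
    have e: "sqrt \<bar>t - s\<bar> ^ (DIM('a) - 1) = \<bar>t - s\<bar> powr \<sigma>"
    proof -
      have "sqrt \<bar>t - s\<bar> ^ (DIM('a) - 1) = sqrt \<bar>t - s\<bar> powr real (DIM('a) - 1)" using ts by (subst powr_realpow) auto
      also have "\<dots> = \<bar>t - s\<bar> powr (1 / 2 * real (DIM('a) - 1))" by (simp add: powr_half_sqrt[symmetric] powr_powr)
      also have "1 / 2 * real (DIM('a) - 1) = \<sigma>" using DIM_positive[where 'a='a] by (simp add: \<sigma>_def of_nat_diff)
      finally show ?thesis .
    qed
    show ?thesis unfolding real_sqrt_divide power_divide e by (simp add: powr_minus divide_inverse)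
  qed
  hence "cmod (ip (P t k) (P s l)) \<le> (sqrt pi ^ (DIM('a) - 1) * sqrt (pi / 2)) * (\<bar>t - s\<bar> powr - \<sigma> * (mu (u t) k * mu (u s) l))"
    unfolding P_def using adjoint_flow_dispersive[OF atom_integrable[OF u] atom_L2[OF u] atom_integrable[OF u] atom_L2[OF u] a assms, of t k s l]
    by (simp add: L1_atom[OF u] mult_ac)
  also have "\<dots> \<le> A * (\<bar>t - s\<bar> powr - \<sigma> * (mu (u t) k * mu (u s) l))"
    by (intro mult_right_mono) (auto simp: A_def)
  finally show ?thesis .
qed

lemma \<psi>'_L2: "\<psi>' \<in> L2" by (rule unweight_L2[OF \<psi>])

text \<open>The phase of the atom makes the pairing at least height times measure, and the factor (2
  * pi)^d from Parseval only helps, being at least 1.\<close>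

lemma Re_ip_P: "2 powr real_of_int k * mu (u t) k \<le> Re (ip \<psi>' (P t k))"
proof -
  have e: "ip \<psi>' (P t k) = of_real ((2 * pi) ^ DIM('a)) * ip (u t) (atom (u t) k)"
    unfolding P_def using adjoint_flow_pairing[OF u Fu supp \<psi> atom_integrable[OF u] atom_L2[OF u]] by simp
  have b: "2 powr real_of_int k * mu (u t) k \<le> Re (ip (u t) (atom (u t) k))" by (rule ip_atom[OF u])
  moreover have "0 \<le> 2 powr real_of_int k * mu (u t) k" by simp
  moreover have "1 \<le> (2 * pi) ^ DIM('a)" using pi_gt3 by (intro one_le_power) linarith
  ultimately have "1 * (2 powr real_of_int k * mu (u t) k) \<le> (2 * pi) ^ DIM('a) * Re (ip (u t) (atom (u t) k))"
    by (intro mult_mono) auto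
  also have "\<dots> = Re (ip \<psi>' (P t k))" unfolding e Re_complex_of_real by simp
  finally show ?thesis by simp
qed

context
  fixes h :: real and K :: nat and N :: "int set"
  assumes h: "h > 0" and N: "finite N"
begin

definition v :: "int \<Rightarrow> 'a \<Rightarrow> complex" where "v n = u (h * real_of_int n)"
text \<open>Two indices are in play: k for the height of a superlevel set and m =
  \<open>cls n k\<close> for its measure, rounded up to a power of 2. Several heights may fall into
  one class.\<close>

definition cls :: "int \<Rightarrow> int \<Rightarrow> int" where "cls n k = \<lceil>log 2 (mu (v n) k)\<rceil>"
definition act :: "int \<Rightarrow> int set" where "act n = active K (h powr \<sigma>) (v n)"
definition Kc :: "int \<Rightarrow> int \<Rightarrow> int set" where "Kc n m = {k \<in> act n. cls n k = m}"
definition Ms :: "int set" where "Ms = {m \<in> (\<lambda>(n, k). cls n k) ` (N \<times> {- int K..int K}). h powr \<sigma> \<le> 2 powr real_of_int m}"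
definition ka :: "int \<Rightarrow> int \<Rightarrow> int" where "ka n m = Max (Kc n m)"
text \<open>Among the superlevel sets whose measure lies in \<open>(2 ^ (m - 1), 2 ^ m]\<close> only the highest one is used: its
  level dominates the geometric sum over the others.\<close>

definition avec :: "int \<Rightarrow> int \<Rightarrow> 'a \<Rightarrow> complex" where
  "avec n m = (if Kc n m = {} then (\<lambda>x. 0) else P (h * real_of_int n) (ka n m))"
text \<open>The measure of the chosen set exceeds 2^m / 2, so halving the height makes
  \<open>ct n m\<close> * 2^m a lower bound for the pairing.\<close>

definition ct :: "int \<Rightarrow> int \<Rightarrow> real" where
  "ct n m = (if Kc n m = {} then 0 else 2 powr real_of_int (ka n m) / 2)"

lemma finite_Kc: "finite (Kc n m)" by (simp add: Kc_def act_def)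

lemma mu_cls: assumes "k \<in> Kc n m" shows "mu (v n) k \<le> 2 powr real_of_int m" "2 powr real_of_int m \<le> 2 * mu (v n) k" "mu (v n) k > 0"
proof -
  have "0 < h powr \<sigma>" using h by simp
  also have "\<dots> \<le> mu (v n) k" using assms by (simp add: Kc_def act_def active_def)
  finally show pos: "mu (v n) k > 0" .
  have m: "m = \<lceil>log 2 (mu (v n) k)\<rceil>" using assms by (simp add: Kc_def cls_def)
  have 1: "log 2 (mu (v n) k) \<le> real_of_int m" "real_of_int m \<le> log 2 (mu (v n) k) + 1" unfolding m by linarith+
  have "2 powr log 2 (mu (v n) k) \<le> 2 powr real_of_int m" "2 powr real_of_int m \<le> 2 powr (log 2 (mu (v n) k) + 1)"
    using 1 by (auto intro: powr_mono)
  thus "mu (v n) k \<le> 2 powr real_of_int m" "2 powr real_of_int m \<le> 2 * mu (v n) k" using pos by (auto simp: powr_add)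
qed

lemma ka_in: "Kc n m \<noteq> {} \<Longrightarrow> ka n m \<in> Kc n m" unfolding ka_def by (intro Max_in finite_Kc)

lemma atoms_at: "atoms \<sigma> h A N Ms avec ct \<psi>'"
proof
  show "finite Ms" unfolding Ms_def using N by auto
  show "avec n m \<in> L2" for n m by (simp add: avec_def P_L2)
  show "0 \<le> ct n m" for n m by (simp add: ct_def)
  show "0 < h" "finite N" by (fact h N)+
  show "0 \<le> A" using A_pos by simp
  show "\<psi>' \<in> L2" by (rule \<psi>'_L2)
  show "h powr \<sigma> \<le> 2 powr real_of_int m" if "m \<in> Ms" for m using that by (simp add: Ms_def)
  show "nsq (avec n m) \<le> A * 2 powr real_of_int m" for n m
  proof (cases "Kc n m = {}")
    case True thus ?thesis using A_pos by (simp add: avec_def nsq_def)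
  next
    case False
    have "nsq (P (h * real_of_int n) (ka n m)) \<le> A * mu (v n) (ka n m)" unfolding v_def by (rule nsq_P)
    also have "\<dots> \<le> A * 2 powr real_of_int m" using mu_cls(1)[OF ka_in[OF False]] A_pos by (intro mult_left_mono) auto
    finally show ?thesis using False by (simp add: avec_def)
  qed
  show "ct n m * 2 powr real_of_int m \<le> Re (ip \<psi>' (avec n m))" for n m
  proof (cases "Kc n m = {}")
    case True thus ?thesis by (simp add: avec_def ct_def)
  next
    case False
    have "2 powr real_of_int (ka n m) / 2 * 2 powr real_of_int m \<le> 2 powr real_of_int (ka n m) / 2 * (2 * mu (v n) (ka n m))"
      by (intro mult_left_mono mu_cls(2)[OF ka_in[OF False]]) auto
    also have "\<dots> = 2 powr real_of_int (ka n m) * mu (v n) (ka n m)" by simp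
    also have "\<dots> \<le> Re (ip \<psi>' (P (h * real_of_int n) (ka n m)))" unfolding v_def by (rule Re_ip_P)
    finally show ?thesis using False by (simp add: avec_def ct_def)
  qed
  show "cmod (ip (avec n m) (avec n' l)) \<le> A * ((h * gap n n') powr - \<sigma> * (2 powr real_of_int m * 2 powr real_of_int l))" if "n \<noteq> n'" for n n' m l
  proof (cases "Kc n m = {} \<or> Kc n' l = {}")
    case True thus ?thesis using A_pos by (auto simp: avec_def)
  next
    case False
    have hn: "h * real_of_int n \<noteq> h * real_of_int n'" using that h by simp
    have g: "\<bar>h * real_of_int n - h * real_of_int n'\<bar> = h * gap n n'"
      using that h by (auto simp: gap_def abs_mult simp flip: right_diff_distrib)
    have "cmod (ip (P (h * real_of_int n) (ka n m)) (P (h * real_of_int n') (ka n' l)))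
      \<le> A * ((h * gap n n') powr - \<sigma> * (mu (v n) (ka n m) * mu (v n') (ka n' l)))"
      using ip_P[OF hn] unfolding g v_def .
    also have "\<dots> \<le> A * ((h * gap n n') powr - \<sigma> * (2 powr real_of_int m * 2 powr real_of_int l))"
      using A_pos False by (intro mult_left_mono mult_mono mu_cls ka_in) auto
    finally show ?thesis using False by (simp add: avec_def)
  qed
qed

text \<open>Group the levels by class. In a class all measures are at most 2^m and the heights run
  down from \<open>ka n m\<close>, so the sum is geometric; 2 powr r undoes the half in
  \<open>ct\<close>.\<close>

lemma level_sum_le:
  assumes n: "n \<in> N" and r: "r > 0"
  shows "(\<Sum>k\<in>act n. 2 powr (real_of_int k * r) * mu (v n) k) \<le> (2 powr r * geo_const r) * (\<Sum>m\<in>Ms. ct n m powr r * 2 powr real_of_int m)"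
proof -
  have fA: "finite (act n)" by (simp add: act_def)
  have sub: "cls n ` act n \<subseteq> Ms"
  proof
    fix m assume "m \<in> cls n ` act n"
    then obtain k where k: "k \<in> act n" "m = cls n k" by auto
    hence "k \<in> Kc n m" by (simp add: Kc_def)
    from mu_cls(1)[OF this] k show "m \<in> Ms" using n by (auto simp: Ms_def act_def active_def)
  qed
  have "finite Ms" unfolding Ms_def using N by auto
  from sum.group[OF fA this sub, of "\<lambda>k. 2 powr (real_of_int k * r) * mu (v n) k"]
  have "(\<Sum>k\<in>act n. 2 powr (real_of_int k * r) * mu (v n) k) = (\<Sum>m\<in>Ms. \<Sum>k\<in>Kc n m. 2 powr (real_of_int k * r) * mu (v n) k)"
    unfolding Kc_def by simp
  also have "\<dots> \<le> (\<Sum>m\<in>Ms. (2 powr r * geo_const r) * (ct n m powr r * 2 powr real_of_int m))"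
  proof (rule sum_mono)
    fix m
    show "(\<Sum>k\<in>Kc n m. 2 powr (real_of_int k * r) * mu (v n) k) \<le> (2 powr r * geo_const r) * (ct n m powr r * 2 powr real_of_int m)"
    proof (cases "Kc n m = {}")
      case False
      have "(\<Sum>k\<in>Kc n m. 2 powr (real_of_int k * r) * mu (v n) k) \<le> (\<Sum>k\<in>Kc n m. (2 powr (real_of_int (ka n m) * r) * 2 powr real_of_int m) * 2 powr (- r * \<bar>real_of_int k - real_of_int (ka n m)\<bar>))"
      proof (rule sum_mono)
        fix k assume k: "k \<in> Kc n m"
        have "k \<le> ka n m" unfolding ka_def by (rule Max_ge[OF finite_Kc k])
        hence "real_of_int k * r = real_of_int (ka n m) * r + - r * \<bar>real_of_int k - real_of_int (ka n m)\<bar>"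
          by (simp add: algebra_simps)
        hence "2 powr (real_of_int k * r) = 2 powr (real_of_int (ka n m) * r) * 2 powr (- r * \<bar>real_of_int k - real_of_int (ka n m)\<bar>)"
          by (simp only: powr_add)
        hence "2 powr (real_of_int k * r) * mu (v n) k \<le> (2 powr (real_of_int (ka n m) * r) * 2 powr (- r * \<bar>real_of_int k - real_of_int (ka n m)\<bar>)) * 2 powr real_of_int m"
          using mu_cls(1)[OF k] by (simp only:) (rule mult_left_mono, auto)
        thus "2 powr (real_of_int k * r) * mu (v n) k \<le> (2 powr (real_of_int (ka n m) * r) * 2 powr real_of_int m) * 2 powr (- r * \<bar>real_of_int k - real_of_int (ka n m)\<bar>)"
          by (simp only: mult_ac)
      qed
      also have "\<dots> = (2 powr (real_of_int (ka n m) * r) * 2 powr real_of_int m) * (\<Sum>k\<in>Kc n m. 2 powr (- r * \<bar>real_of_int k - real_of_int (ka n m)\<bar>))"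
        by (simp add: sum_distrib_left)
      also have "\<dots> \<le> (2 powr (real_of_int (ka n m) * r) * 2 powr real_of_int m) * geo_const r"
        unfolding geo_const_def by (intro mult_left_mono sum_geometric_int r finite_Kc) auto
      also have "2 powr (real_of_int (ka n m) * r) = 2 powr r * ct n m powr r"
        using False by (simp add: ct_def powr_divide powr_powr)
      finally show ?thesis by (simp add: mult_ac)
    qed (simp add: ct_def)
  qed
  finally show ?thesis by (simp add: sum_distrib_left)
qed

lemma level_norm_powr_le:
  assumes n: "n \<in> N" and r: "r > 0" and q: "q > 0"
  shows "level_norm (ereal r) K (h powr \<sigma>) (u (h * real_of_int n)) powr q
    \<le> (2 powr r * geo_const r) powr (q / r) * (\<Sum>m\<in>Ms. ct n m powr r * 2 powr real_of_int m) powr (q / r)"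
proof -
  have "level_norm (ereal r) K (h powr \<sigma>) (u (h * real_of_int n)) powr q = (\<Sum>k\<in>act n. 2 powr (real_of_int k * r) * mu (v n) k) powr (q / r)"
    by (simp add: level_norm_def powr_powr act_def v_def)
  also have "\<dots> \<le> ((2 powr r * geo_const r) * (\<Sum>m\<in>Ms. ct n m powr r * 2 powr real_of_int m)) powr (q / r)"
    using q r by (intro powr_mono2 level_sum_le n) (auto intro!: sum_nonneg)
  also have "\<dots> = (2 powr r * geo_const r) powr (q / r) * (\<Sum>m\<in>Ms. ct n m powr r * 2 powr real_of_int m) powr (q / r)"
    by (rule powr_mult)
  finally show ?thesis .
qed

lemma discrete_endpoint:
  assumes \<sigma>: "\<sigma> > 1" and r: "r = 2 * \<sigma> / (\<sigma> - 1)"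
  shows "h * (\<Sum>n\<in>N. level_norm (ereal r) K (h powr \<sigma>) (u (h * real_of_int n)) powr 2)
    \<le> (2 powr r * geo_const r) powr (2 / r) * (endpoint_const \<sigma> * geo_const (min ((\<sigma> - 1) / 4) (1 / 8) / \<sigma>) * A * nsq \<psi>')"
proof -
  interpret av: atoms \<sigma> h A N Ms avec ct \<psi>' by (rule atoms_at)
  have r0: "r > 0" using \<sigma> by (simp add: r)
  have "h * (\<Sum>n\<in>N. level_norm (ereal r) K (h powr \<sigma>) (u (h * real_of_int n)) powr 2)
    \<le> h * (\<Sum>n\<in>N. (2 powr r * geo_const r) powr (2 / r) * av.S r n powr (2 / r))"
    unfolding av.S_def using h r0 by (intro mult_left_mono sum_mono level_norm_powr_le) auto
  also have "\<dots> = (2 powr r * geo_const r) powr (2 / r) * (h * (\<Sum>n\<in>N. av.S r n powr (2 / r)))"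
    by (simp add: sum_distrib_left mult_ac)
  also have "\<dots> \<le> (2 powr r * geo_const r) powr (2 / r) * (endpoint_const \<sigma> * geo_const (min ((\<sigma> - 1) / 4) (1 / 8) / \<sigma>) * A * nsq \<psi>')"
    by (intro mult_left_mono av.endpoint_estimate \<sigma> r refl) auto
  finally show ?thesis .
qed

lemma discrete_nonendpoint:
  assumes r: "r > 2" and \<gamma>: "\<gamma> = 2 * \<sigma> * (1 / 2 - 1 / r)" "0 < \<gamma>" "\<gamma> < 1" and q: "q = 2 / \<gamma>"
  shows "h * (\<Sum>n\<in>N. level_norm (ereal r) K (h powr \<sigma>) (u (h * real_of_int n)) powr q)
    \<le> (2 powr r * geo_const r) powr (q / r) * (HLS_const \<gamma> * (A * geo_const (min (1 / 2 - 1 / r) (1 / r))) * nsq \<psi>') powr (q / 2)"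
proof -
  interpret av: atoms \<sigma> h A N Ms avec ct \<psi>' by (rule atoms_at)
  have q0: "q > 0" using \<gamma> by (simp add: q)
  have "h * (\<Sum>n\<in>N. level_norm (ereal r) K (h powr \<sigma>) (u (h * real_of_int n)) powr q)
    \<le> h * (\<Sum>n\<in>N. (2 powr r * geo_const r) powr (q / r) * av.S r n powr (q / r))"
    unfolding av.S_def using h r q0 by (intro mult_left_mono sum_mono level_norm_powr_le) auto
  also have "\<dots> = (2 powr r * geo_const r) powr (q / r) * (h * (\<Sum>n\<in>N. av.S r n powr (q / r)))"
    by (simp add: sum_distrib_left mult_ac)
  also have "\<dots> \<le> (2 powr r * geo_const r) powr (q / r) * (HLS_const \<gamma> * (A * geo_const (min (1 / 2 - 1 / r) (1 / r))) * nsq \<psi>') powr (q / 2)"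
    by (intro mult_left_mono av.nonendpoint_estimate r \<gamma> q) auto
  finally show ?thesis .
qed

text \<open>The dual function at each time is the atom of the highest active level divided by its
  measure, so its L1 norm is 1. As the measure is at least h powr \<sigma>, its squared L2 norm is
  at most h powr - \<sigma>, which is the dispersive bound on the diagonal.\<close>

lemma discrete_sup:
  assumes \<sigma>: "0 < \<sigma>" "\<sigma> < 1" and q: "q = 2 / \<sigma>"
  shows "h * (\<Sum>n\<in>N. level_norm \<infinity> K (h powr \<sigma>) (u (h * real_of_int n)) powr q) \<le> (HLS_const \<sigma> * A * nsq \<psi>') powr (q / 2)"
proof (rule sup_estimate[OF \<sigma> q h N _ \<psi>'_L2])
  define km where "km n = Max (act n)" for n
  define w where "w n = 1 / mu (v n) (km n)" for n
  define b where "b n = (if act n = {} then (\<lambda>x. 0) else (\<lambda>x. complex_of_real (w n) * P (h * real_of_int n) (km n) x))" for n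
  have pos: "mu (v n) (km n) \<ge> h powr \<sigma>" "mu (v n) (km n) > 0" "w n > 0" "w n * mu (v n) (km n) = 1" if "act n \<noteq> {}" for n
  proof -
    have "km n \<in> act n" unfolding km_def using that by (intro Max_in) (auto simp: act_def)
    thus 1: "mu (v n) (km n) \<ge> h powr \<sigma>" by (simp add: act_def active_def)
    moreover have "h powr \<sigma> > 0" using h by simp
    ultimately show "mu (v n) (km n) > 0" by linarith
    thus "w n > 0" "w n * mu (v n) (km n) = 1" by (auto simp: w_def)
  qed
  have lv: "level_norm \<infinity> K (h powr \<sigma>) (u (h * real_of_int n)) = (if act n = {} then 0 else 2 powr real_of_int (km n))" for n
    by (simp add: level_norm_def act_def v_def km_def)
  show "b n \<in> L2" for n by (auto simp: b_def intro!: L2_cmult P_L2)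
  show "0 \<le> A" using A_pos by simp
  show "0 \<le> level_norm \<infinity> K (h powr \<sigma>) (u (h * real_of_int n))" for n by (rule level_norm_nonneg)
  show "nsq (b n) \<le> A * h powr - \<sigma>" for n
  proof (cases "act n = {}")
    case True thus ?thesis using A_pos by (simp add: b_def nsq_def)
  next
    case False
    have "nsq (b n) = (w n)\<^sup>2 * nsq (P (h * real_of_int n) (km n))" using False by (simp add: b_def nsq_cmult)
    also have "\<dots> \<le> (w n)\<^sup>2 * (A * mu (v n) (km n))" unfolding v_def by (intro mult_left_mono nsq_P) auto
    also have "\<dots> = A * w n * (w n * mu (v n) (km n))" by (simp add: power2_eq_square mult_ac)
    also have "\<dots> = A * w n" using pos(4)[OF False] by simp
    also have "w n \<le> h powr - \<sigma>" using pos(1)[OF False] h by (simp add: w_def powr_minus divide_inverse le_imp_inverse_le)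
    finally show ?thesis using A_pos by (simp add: mult_left_mono)
  qed
  show "level_norm \<infinity> K (h powr \<sigma>) (u (h * real_of_int n)) \<le> Re (ip \<psi>' (b n))" for n
  proof (cases "act n = {}")
    case False
    have "2 powr real_of_int (km n) = w n * (2 powr real_of_int (km n) * mu (v n) (km n))" using pos(4)[OF False] by (simp add: mult_ac)
    also have "\<dots> \<le> w n * Re (ip \<psi>' (P (h * real_of_int n) (km n)))"
      unfolding v_def using pos(3)[OF False] by (intro mult_left_mono Re_ip_P) auto
    finally show ?thesis using False by (simp add: lv b_def ip_cmult_right)
  qed (simp add: lv b_def)
  show "cmod (ip (b n) (b n')) \<le> A * (h * gap n n') powr - \<sigma>" if nn: "n \<noteq> n'" for n n'
  proof (cases "act n = {} \<or> act n' = {}")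
    case True thus ?thesis using A_pos by (auto simp: b_def)
  next
    case False
    hence ne: "act n \<noteq> {}" "act n' \<noteq> {}" by auto
    have hn: "h * real_of_int n \<noteq> h * real_of_int n'" using nn h by simp
    have g: "\<bar>h * real_of_int n - h * real_of_int n'\<bar> = h * gap n n'"
      using nn h by (auto simp: gap_def abs_mult simp flip: right_diff_distrib)
    have "cmod (ip (b n) (b n')) = w n * w n' * cmod (ip (P (h * real_of_int n) (km n)) (P (h * real_of_int n') (km n')))"
      using ne pos(3)[OF ne(1)] pos(3)[OF ne(2)] by (simp add: b_def ip_cmult_left ip_cmult_right norm_mult)
    also have "\<dots> \<le> w n * w n' * (A * ((h * gap n n') powr - \<sigma> * (mu (v n) (km n) * mu (v n') (km n'))))"
      using ip_P[OF hn, of "km n" "km n'"] pos(3)[OF ne(1)] pos(3)[OF ne(2)] unfolding g v_def by (intro mult_left_mono) auto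
    also have "\<dots> = A * (h * gap n n') powr - \<sigma> * (w n * mu (v n) (km n)) * (w n' * mu (v n') (km n'))" by (simp only: mult_ac)
    also have "\<dots> = A * (h * gap n n') powr - \<sigma>" by (simp only: pos(4)[OF ne(1)] pos(4)[OF ne(2)] mult_1_right)
    finally show ?thesis .
  qed
qed

end

end

section \<open>Passage to continuous time\<close>

context flow
begin

text \<open>Plancherel moves the difference to the frequency side, where the multipliers converge
  pointwise and 4 * |\<psi>|^2 dominates.\<close>

lemma u_continuous:
  assumes t: "t \<longlonglongrightarrow> t0"
  shows "(\<lambda>j. nsq (\<lambda>x. u t0 x - u (t j) x)) \<longlonglongrightarrow> 0"
proof -
  let ?w = "\<lambda>t \<xi>. cis (- t * (norm \<xi>)\<^sup>2) * \<psi> \<xi>"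
  have [measurable]: "\<psi> \<in> borel_measurable borel" by (rule L2_measurable[OF \<psi>])
  have pl: "nsq (\<lambda>x. u t0 x - u s x) = nsq (\<lambda>\<xi>. ?w t0 \<xi> - ?w s \<xi>) / (2 * pi) ^ DIM('a)" for s
    using fourier_L2_Plancherel_diff[OF u u Fu Fu, of t0 s] by (simp add: field_simps)
  have "(\<lambda>j. LINT \<xi>|lborel. (cmod (?w t0 \<xi> - ?w (t j) \<xi>))\<^sup>2) \<longlonglongrightarrow> (LINT \<xi>::'a|lborel. 0)"
  proof (rule integral_dominated_convergence[where w = "\<lambda>\<xi>. 4 * (cmod (\<psi> \<xi>))\<^sup>2"])
    show "(\<lambda>\<xi>. (cmod (?w t0 \<xi> - ?w (t j) \<xi>))\<^sup>2) \<in> borel_measurable lborel" for j by measurable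
    show "integrable lborel (\<lambda>\<xi>. 4 * (cmod (\<psi> \<xi>))\<^sup>2)" using L2_integrable[OF \<psi>] by (rule integrable_mult_right)
    show "AE \<xi> in lborel. (\<lambda>j. (cmod (?w t0 \<xi> - ?w (t j) \<xi>))\<^sup>2) \<longlonglongrightarrow> 0"
    proof (rule AE_I2)
      fix \<xi> :: 'a
      have "(\<lambda>j. (cmod (?w t0 \<xi> - ?w (t j) \<xi>))\<^sup>2) \<longlonglongrightarrow> (cmod (?w t0 \<xi> - ?w t0 \<xi>))\<^sup>2"
        by (intro tendsto_intros t)
      thus "(\<lambda>j. (cmod (?w t0 \<xi> - ?w (t j) \<xi>))\<^sup>2) \<longlonglongrightarrow> 0" by simp
    qed
    show "AE \<xi> in lborel. norm ((cmod (?w t0 \<xi> - ?w (t j) \<xi>))\<^sup>2) \<le> 4 * (cmod (\<psi> \<xi>))\<^sup>2" for j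
    proof (rule AE_I2)
      fix \<xi> :: 'a
      have "cmod (?w t0 \<xi> - ?w (t j) \<xi>) \<le> 2 * cmod (\<psi> \<xi>)"
        using norm_triangle_ineq4[of "?w t0 \<xi>" "?w (t j) \<xi>"] by (simp add: norm_mult)
      from power_mono[OF this norm_ge_zero, of 2]
      show "norm ((cmod (?w t0 \<xi> - ?w (t j) \<xi>))\<^sup>2) \<le> 4 * (cmod (\<psi> \<xi>))\<^sup>2" by (simp add: power_mult_distrib)
    qed
  qed simp
  hence "(\<lambda>j. nsq (\<lambda>\<xi>. ?w t0 \<xi> - ?w (t j) \<xi>)) \<longlonglongrightarrow> 0" by (simp add: nsq_def)
  from tendsto_divide[OF this tendsto_const, of "(2 * pi) ^ DIM('a)"] show ?thesis unfolding pl by simp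
qed

text \<open>The step functions \<open>s j\<close> built on the grid are measurable, and by
  semicontinuity their liminf dominates the integrand at every t. Monotonicity of
  \<open>nn_integral\<close> and Fatou for \<open>s j\<close> then finish, whether or not the
  integrand itself is measurable.\<close>

lemma continuous_from_discrete:
  fixes r :: ereal
  assumes lsc: "\<And>(v::'a \<Rightarrow> complex) s \<delta> K. v \<in> L2 \<Longrightarrow> (\<And>j::nat. s j \<in> L2) \<Longrightarrow> (\<lambda>j. nsq (\<lambda>x. v x - s j x)) \<longlonglongrightarrow> 0 \<Longrightarrow>
        \<delta> \<longlonglongrightarrow> (0::real) \<Longrightarrow> filterlim K at_top sequentially \<Longrightarrow>
        enn_rpow (lp_norm lborel r (\<lambda>x. ennreal (cmod (v x)))) q \<le> liminf (\<lambda>j. ennreal (B * level_norm r (K j) (\<delta> j) (s j) powr q))"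
    and disc: "\<And>h K N. h > 0 \<Longrightarrow> finite N \<Longrightarrow> h * (\<Sum>n\<in>N. level_norm r K (h powr \<sigma>) (u (h * real_of_int n)) powr q) \<le> C"
    and B: "B \<ge> 0" and \<sigma>: "\<sigma> > 0"
  shows "(\<integral>\<^sup>+ t. enn_rpow (lp_norm lborel r (\<lambda>x. ennreal (cmod (u t x)))) q \<partial>lborel) \<le> ennreal (B * C)"
proof -
  define h where "h j = 1 / real (Suc j)" for j
  have h: "h j > 0" for j by (simp add: h_def)
  have h0: "h \<longlonglongrightarrow> 0" unfolding h_def by (rule lim_1_over_n[THEN LIMSEQ_Suc])
  have hs0: "(\<lambda>j. h j powr \<sigma>) \<longlonglongrightarrow> 0"
    using tendsto_powr'[OF h0 tendsto_const[of \<sigma>]] \<sigma> h by (simp add: less_imp_le)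
  \<comment> \<open>About (j + 1)^2 steps of length 1 / (j + 1) in each direction, so the grids
    refine and exhaust the line at once.\<close>
  define N where "N j = {- (int (Suc j))\<^sup>2..(int (Suc j))\<^sup>2}" for j
  define Y where "Y j n = B * level_norm r j (h j powr \<sigma>) (u (h j * real_of_int n)) powr q" for j n
  have Y0: "Y j n \<ge> 0" for j n using B by (simp add: Y_def)
  define s where "s j t = (\<Sum>n\<in>N j. ennreal (Y j n) * indicator {h j * real_of_int n..<h j * real_of_int (n + 1)} t)" for j and t :: real
  have s_int: "(\<integral>\<^sup>+ t. s j t \<partial>lborel) \<le> ennreal (B * C)" for j
  proof -
    have "(\<integral>\<^sup>+ t. s j t \<partial>lborel) = (\<Sum>n\<in>N j. ennreal (Y j n) * emeasure lborel {h j * real_of_int n..<h j * real_of_int (n + 1)})"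
      unfolding s_def by (subst nn_integral_sum) (auto simp: nn_integral_cmult_indicator)
    also have "\<dots> = (\<Sum>n\<in>N j. ennreal (Y j n * h j))"
    proof (rule sum.cong[OF refl])
      fix n
      have "h j * real_of_int (n + 1) - h j * real_of_int n = h j" by (simp add: algebra_simps)
      moreover have "h j * real_of_int n \<le> h j * real_of_int (n + 1)" using h[of j] by simp
      ultimately show "ennreal (Y j n) * emeasure lborel {h j * real_of_int n..<h j * real_of_int (n + 1)} = ennreal (Y j n * h j)"
        using Y0 h[of j] by (simp add: ennreal_mult less_imp_le del: of_int_add)
    qed
    also have "\<dots> = ennreal (\<Sum>n\<in>N j. Y j n * h j)" using Y0 h[of j] by (intro sum_ennreal) (auto intro!: mult_nonneg_nonneg less_imp_le)
    also have "(\<Sum>n\<in>N j. Y j n * h j) = B * (h j * (\<Sum>n\<in>N j. level_norm r j (h j powr \<sigma>) (u (h j * real_of_int n)) powr q))"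
      by (simp add: Y_def sum_distrib_left mult_ac)
    also have "ennreal \<dots> \<le> ennreal (B * C)"
      by (intro ennreal_leI mult_left_mono disc h B) (simp add: N_def)
    finally show ?thesis .
  qed
  have pt: "enn_rpow (lp_norm lborel r (\<lambda>x. ennreal (cmod (u t x)))) q \<le> liminf (\<lambda>j. s j t)" for t
  proof -
    define n where "n j = \<lfloor>t / h j\<rfloor>" for j
    have n: "h j * real_of_int (n j) \<le> t" "t < h j * real_of_int (n j + 1)" for j
    proof -
      have "real_of_int (n j) \<le> t / h j" "t / h j < real_of_int (n j + 1)" unfolding n_def by linarith+
      thus "h j * real_of_int (n j) \<le> t" "t < h j * real_of_int (n j + 1)" using h[of j] by (auto simp: field_simps)
    qed
    have "(\<lambda>j. h j * real_of_int (n j) - t) \<longlonglongrightarrow> 0"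
    proof (rule Lim_null_comparison[OF _ h0])
      show "\<forall>\<^sub>F j in sequentially. norm (h j * real_of_int (n j) - t) \<le> h j"
      proof (rule always_eventually, rule allI)
        fix j show "norm (h j * real_of_int (n j) - t) \<le> h j" using n[of j] by (simp add: algebra_simps)
      qed
    qed
    hence tn: "(\<lambda>j. h j * real_of_int (n j)) \<longlonglongrightarrow> t" by (simp add: LIM_zero_iff)
    have "enn_rpow (lp_norm lborel r (\<lambda>x. ennreal (cmod (u t x)))) q \<le> liminf (\<lambda>j. ennreal (Y j (n j)))"
      unfolding Y_def by (rule lsc[OF u u u_continuous[OF tn] hs0]) (rule filterlim_ident)
    also have "\<dots> \<le> liminf (\<lambda>j. s j t)"
    proof (rule Liminf_mono)
      have "\<forall>\<^sub>F j in sequentially. real j \<ge> \<bar>t\<bar> + 1"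
        by (rule filterlim_at_top[THEN iffD1, rule_format, OF filterlim_real_sequentially])
      thus "\<forall>\<^sub>F j in sequentially. ennreal (Y j (n j)) \<le> s j t"
      proof eventually_elim
        case (elim j)
        have "\<bar>t / h j\<bar> = \<bar>t\<bar> * real (Suc j)" by (simp add: h_def abs_mult)
        also have "\<dots> \<le> (real (Suc j) - 1) * real (Suc j)" using elim by (intro mult_right_mono) auto
        also have "\<dots> = (real (Suc j))\<^sup>2 - real (Suc j)" by (simp add: power2_eq_square algebra_simps)
        finally have "\<bar>t / h j\<bar> \<le> (real (Suc j))\<^sup>2 - 1" by simp
        hence "real_of_int (n j) \<le> (real (Suc j))\<^sup>2" "- (real (Suc j))\<^sup>2 \<le> real_of_int (n j)" unfolding n_def by linarith+
        hence "real_of_int (n j) \<le> real_of_int ((int (Suc j))\<^sup>2)" "real_of_int (- (int (Suc j))\<^sup>2) \<le> real_of_int (n j)" by simp_all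
        hence nN: "n j \<in> N j" unfolding N_def by (simp only: of_int_le_iff atLeastAtMost_iff)
        have "ennreal (Y j (n j)) = ennreal (Y j (n j)) * indicator {h j * real_of_int (n j)..<h j * real_of_int (n j + 1)} t"
          using n[of j] by simp
        also have "\<dots> \<le> s j t" unfolding s_def
          by (rule member_le_sum[OF nN]) (auto simp: N_def)
        finally show ?case .
      qed
    qed
    finally show ?thesis .
  qed
  have "(\<integral>\<^sup>+ t. enn_rpow (lp_norm lborel r (\<lambda>x. ennreal (cmod (u t x)))) q \<partial>lborel) \<le> (\<integral>\<^sup>+ t. liminf (\<lambda>j. s j t) \<partial>lborel)"
    by (intro nn_integral_mono pt)
  also have "\<dots> \<le> liminf (\<lambda>j. \<integral>\<^sup>+ t. s j t \<partial>lborel)"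
    by (rule nn_integral_liminf) (simp add: s_def)
  also have "\<dots> \<le> ennreal (B * C)"
    using Liminf_mono[OF always_eventually, of "\<lambda>j. \<integral>\<^sup>+ t. s j t \<partial>lborel" "\<lambda>_. ennreal (B * C)" sequentially] s_int
    by (simp add: Liminf_const)
  finally show ?thesis .
qed

end

section \<open>Regimes of admissible exponents and assembly of the estimate\<close>

lemma admissible_cases:
  fixes \<sigma> :: real and q r :: ereal
  assumes \<sigma>: "\<sigma> > 0" and adm: "sharp_admissible \<sigma> q r"
  obtains (energy) "q = \<infinity>" "r = 2"
    | (sup) q' where "q = ereal q'" "r = \<infinity>" "\<sigma> < 1" "q' = 2 / \<sigma>"
    | (nonendpoint) q' r' where "q = ereal q'" "r = ereal r'" "r' > 2" "0 < 2 * \<sigma> * (1 / 2 - 1 / r')" "2 * \<sigma> * (1 / 2 - 1 / r') < 1" "q' = 2 / (2 * \<sigma> * (1 / 2 - 1 / r'))"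
    | (endpoint) r' where "q = ereal 2" "r = ereal r'" "\<sigma> > 1" "r' = 2 * \<sigma> / (\<sigma> - 1)"
proof -
  have q2: "2 \<le> q" and r2: "2 \<le> r" and eq: "inverse q = ereal \<sigma> * (ereal (1/2) - inverse r)"
    and ne: "\<not> (q = 2 \<and> r = \<infinity> \<and> \<sigma> = 1)" using adm by (auto simp: sharp_admissible_def)
  show thesis
  proof (cases q)
    case MInf thus ?thesis using q2 by simp
  next
    case PInf
    show ?thesis
    proof (cases r)
      case (real r')
      have r'2: "r' \<ge> 2" using r2 real by simp
      have "0 = \<sigma> * (1 / 2 - inverse r')" using eq PInf real r'2 by simp
      hence "inverse r' = 1 / 2" using \<sigma> by simp
      hence "r' = 2" using r'2 by (simp add: field_simps)
      hence "r = 2" using real by simp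
      from energy[OF PInf this] show ?thesis .
    next
      case PInf
      thus ?thesis using eq \<open>q = \<infinity>\<close> \<sigma> by simp
    next
      case MInf
      thus ?thesis using r2 by simp
    qed
  next
    case (real q')
    have q'2: "q' \<ge> 2" using q2 real by simp
    show ?thesis
    proof (cases r)
      case PInf
      have "inverse q' = \<sigma> / 2" using eq PInf real q'2 by simp
      hence q': "q' = 2 / \<sigma>" using q'2 \<sigma> by (simp add: field_simps)
      have "\<sigma> \<le> 1" using q'2 \<sigma> unfolding q' by (simp add: field_simps)
      \<comment> \<open>For \<sigma> = 1 this would be the excluded triple, since then q =
        2.\<close>
      moreover have "\<sigma> \<noteq> 1" using ne real PInf q' by auto
      ultimately have "\<sigma> < 1" by simp
      from sup[OF real PInf this q'] show ?thesis .
    next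
      case (real r')
      have r'2: "r' \<ge> 2" using r2 real by simp
      let ?\<gamma> = "2 * \<sigma> * (1 / 2 - 1 / r')"
      have iq: "inverse q' = \<sigma> * (1 / 2 - inverse r')" using eq \<open>q = ereal q'\<close> real q'2 r'2 by simp
      have g: "?\<gamma> = 2 / q'"
        unfolding inverse_eq_divide[of r', symmetric] divide_inverse[of 2 q'] iq by (simp only: mult.assoc)
      have g0: "?\<gamma> > 0" unfolding g using q'2 by simp
      have r'3: "r' > 2"
      proof (rule ccontr)
        assume "\<not> r' > 2" hence "r' = 2" using r'2 by simp
        thus False using g0 by simp
      qed
      have qg: "q' = 2 / ?\<gamma>" unfolding g using q'2 by simp
      show ?thesis
      proof (cases "q' = 2")
        case True
        hence "2 * \<sigma> * (1 / 2 - 1 / r') = 1" using g by simp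
        hence e: "\<sigma> * (r' - 2) = r'" using r'3 by (simp add: field_simps)
        have s1: "\<sigma> > 1"
        proof (rule ccontr)
          assume "\<not> \<sigma> > 1"
          hence "\<sigma> * (r' - 2) \<le> 1 * (r' - 2)" using r'3 by (intro mult_right_mono) auto
          thus False using e by simp
        qed
        moreover have "r' = 2 * \<sigma> / (\<sigma> - 1)" using e s1 by (simp add: field_simps)
        moreover have "q = ereal 2" using True \<open>q = ereal q'\<close> by simp
        ultimately show ?thesis using endpoint[of r'] real by blast
      next
        case False
        hence "?\<gamma> < 1" unfolding g using q'2 by simp
        from nonendpoint[OF \<open>q = ereal q'\<close> real r'3 g0 this qg] show ?thesis .
      qed
    next
      case MInf thus ?thesis using r2 by simp
    qed
  qed
qed

text \<open>The loss from \<open>unweight\<close> on the strip times the Plancherel factor.\<close>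

definition data_const :: "real \<Rightarrow> nat \<Rightarrow> real" where "data_const M d = (exp (M\<^sup>2))\<^sup>2 * (2 * pi) ^ d"

lemma flowI:
  fixes a :: "'a::euclidean_space"
  assumes "norm a = 1" "\<phi> \<in> L2" "fourier_L2 \<phi> \<psi>" "AE \<xi> in lborel. \<bar>a \<bullet> \<xi>\<bar> > M \<longrightarrow> \<psi> \<xi> = 0"
    "\<forall>t. u t \<in> L2 \<and> fourier_L2 (u t) (\<lambda>\<xi>. cis (- t * (norm \<xi>)\<^sup>2) * \<psi> \<xi>)"
  shows "flow a M \<psi> u" and "nsq (unweight M a \<psi>) \<le> data_const M DIM('a) * nsq \<phi>"
proof -
  have \<psi>: "\<psi> \<in> L2" by (rule fourier_L2_seq[OF assms(2,3)])
  show "flow a M \<psi> u" using assms \<psi> by unfold_locales auto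
  show "nsq (unweight M a \<psi>) \<le> data_const M DIM('a) * nsq \<phi>"
    using unweight_L2(2)[OF \<psi>, of M a] unfolding fourier_L2_Plancherel[OF assms(2,3)] by (simp add: data_const_def mult_ac)
qed

text \<open>Common end of the cases with finite q. The discrete bound is assumed as a multiple of
  the (q / 2)-th power of the squared data norm, so that the q-th root leaves the L2 norm of \<phi>
  with a constant free of a, \<phi>, \<psi> and u.\<close>

lemma Strichartz_from_discrete:
  fixes M q :: real and r :: ereal
  assumes q: "q > 0" and d: "DIM('a::euclidean_space) \<ge> 2"
    and lsc: "\<And>(v::'a \<Rightarrow> complex) s \<delta> K. v \<in> L2 \<Longrightarrow> (\<And>j::nat. s j \<in> L2) \<Longrightarrow> (\<lambda>j. nsq (\<lambda>x. v x - s j x)) \<longlonglongrightarrow> 0 \<Longrightarrow>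
        \<delta> \<longlonglongrightarrow> (0::real) \<Longrightarrow> filterlim K at_top sequentially \<Longrightarrow>
        enn_rpow (lp_norm lborel r (\<lambda>x. ennreal (cmod (v x)))) q \<le> liminf (\<lambda>j. ennreal (B * level_norm r (K j) (\<delta> j) (s j) powr q))"
    and B: "B \<ge> 0" and C1: "C1 \<ge> 0" and C2: "C2 \<ge> 0"
    and disc: "\<And>(a::'a) \<psi> u h K N. flow a M \<psi> u \<Longrightarrow> h > 0 \<Longrightarrow> finite N \<Longrightarrow>
        h * (\<Sum>n\<in>N. level_norm r K (h powr ((real DIM('a) - 1) / 2)) (u (h * real_of_int n)) powr q)
        \<le> C1 * (C2 * nsq (unweight M a \<psi>)) powr (q / 2)"
  shows "\<exists>C::real. \<forall>(a::'a) \<phi> \<psi> u.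
           norm a = 1 \<longrightarrow> \<phi> \<in> L2 \<longrightarrow> fourier_L2 \<phi> \<psi> \<longrightarrow>
           (AE \<xi> in lborel. \<bar>a \<bullet> \<xi>\<bar> > M \<longrightarrow> \<psi> \<xi> = 0) \<longrightarrow>
           (\<forall>t. u t \<in> L2 \<and> fourier_L2 (u t) (\<lambda>\<xi>. cis (- t * (norm \<xi>)\<^sup>2) * \<psi> \<xi>)) \<longrightarrow>
           lp_norm lborel (ereal q) (\<lambda>t. lp_norm lborel r (\<lambda>x. ennreal (cmod (u t x))))
             \<le> ennreal C * lp_norm lborel 2 (\<lambda>x. ennreal (cmod (\<phi> x)))"
proof (intro exI allI impI)
  fix a :: 'a and \<phi> \<psi> and u :: "real \<Rightarrow> 'a \<Rightarrow> complex"
  assume h: "norm a = 1" "\<phi> \<in> L2" "fourier_L2 \<phi> \<psi>" "AE \<xi> in lborel. \<bar>a \<bullet> \<xi>\<bar> > M \<longrightarrow> \<psi> \<xi> = 0"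
    "\<forall>t. u t \<in> L2 \<and> fourier_L2 (u t) (\<lambda>\<xi>. cis (- t * (norm \<xi>)\<^sup>2) * \<psi> \<xi>)"
  let ?D = "data_const M DIM('a)"
  note flow = flowI(1)[OF h] and D = flowI(2)[OF h]
  interpret flow a M \<psi> u by (rule flow)
  have \<sigma>: "\<sigma> > 0" using d by (simp add: \<sigma>_def)
  let ?E = "C1 * (C2 * nsq (unweight M a \<psi>)) powr (q / 2)"
  have "(\<integral>\<^sup>+ t. enn_rpow (lp_norm lborel r (\<lambda>x. ennreal (cmod (u t x)))) q \<partial>lborel) \<le> ennreal (B * ?E)"
    by (rule continuous_from_discrete[OF lsc _ B \<sigma>]) (use disc[OF flow] in \<open>auto simp: \<sigma>_def\<close>)
  also have "\<dots> \<le> ennreal ((B * C1 * (C2 * ?D) powr (q / 2)) * nsq \<phi> powr (q / 2))"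
  proof (intro ennreal_leI)
    have "(C2 * nsq (unweight M a \<psi>)) powr (q / 2) \<le> (C2 * (?D * nsq \<phi>)) powr (q / 2)"
      using q C2 D by (intro powr_mono2 mult_left_mono) auto
    also have "\<dots> = (C2 * ?D) powr (q / 2) * nsq \<phi> powr (q / 2)" by (simp only: powr_mult mult.assoc)
    finally have "B * C1 * (C2 * nsq (unweight M a \<psi>)) powr (q / 2) \<le> B * C1 * ((C2 * ?D) powr (q / 2) * nsq \<phi> powr (q / 2))"
      using B C1 by (intro mult_left_mono) auto
    thus "B * ?E \<le> (B * C1 * (C2 * ?D) powr (q / 2)) * nsq \<phi> powr (q / 2)" by (simp only: mult.assoc)
  qed
  finally have "enn_rpow (\<integral>\<^sup>+ t. enn_rpow (lp_norm lborel r (\<lambda>x. ennreal (cmod (u t x)))) q \<partial>lborel) (1 / q)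
    \<le> enn_rpow (ennreal ((B * C1 * (C2 * ?D) powr (q / 2)) * nsq \<phi> powr (q / 2))) (1 / q)"
    using q by (intro enn_rpow_mono) auto
  also have "\<dots> = ennreal ((B * C1 * (C2 * ?D) powr (q / 2)) powr (1 / q) * (nsq \<phi> powr (q / 2)) powr (1 / q))"
    using B C1 by (subst enn_rpow_ennreal) (auto simp: powr_mult)
  also have "(nsq \<phi> powr (q / 2)) powr (1 / q) = sqrt (nsq \<phi>)"
    using q by (simp add: powr_powr powr_half_sqrt)
  finally show "lp_norm lborel (ereal q) (\<lambda>t. lp_norm lborel r (\<lambda>x. ennreal (cmod (u t x))))
    \<le> ennreal ((B * C1 * (C2 * ?D) powr (q / 2)) powr (1 / q)) * lp_norm lborel 2 (\<lambda>x. ennreal (cmod (\<phi> x)))"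
    unfolding lp_norm_L2[OF h(2)] by (simp add: lp_norm_def ennreal_mult)
qed

text \<open>The constant is chosen before a and the data, so the estimate is uniform in the
  direction a; u is any family of functions with the prescribed transforms.\<close>

theorem theorem7p2:
  fixes M :: real and q r :: ereal
  assumes "DIM('a::euclidean_space) \<ge> 2"
    and "M > 0"
    and "sharp_admissible ((real DIM('a) - 1) / 2) q r"
  shows "\<exists>C::real. \<forall>(a::'a) \<phi> \<psi> (u :: real \<Rightarrow> 'a \<Rightarrow> complex).
           norm a = 1 \<longrightarrow> \<phi> \<in> L2 \<longrightarrow> fourier_L2 \<phi> \<psi> \<longrightarrow>
           (AE \<xi> in lborel. \<bar>a \<bullet> \<xi>\<bar> > M \<longrightarrow> \<psi> \<xi> = 0) \<longrightarrow>
           (\<forall>t. u t \<in> L2 \<and> fourier_L2 (u t) (\<lambda>\<xi>. cis (- t * (norm \<xi>)\<^sup>2) * \<psi> \<xi>)) \<longrightarrow>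
           lp_norm lborel q (\<lambda>t. lp_norm lborel r (\<lambda>x. ennreal (cmod (u t x))))
             \<le> ennreal C * lp_norm lborel 2 (\<lambda>x. ennreal (cmod (\<phi> x)))"
proof -
  define \<sigma> where "\<sigma> = (real DIM('a) - 1) / 2"
  define A where "A = max ((2 * pi) ^ DIM('a)) (sqrt pi ^ (DIM('a) - 1) * sqrt (pi / 2))"
  have \<sigma>: "\<sigma> > 0" using assms(1) by (simp add: \<sigma>_def)
  have A: "A \<ge> 0" by (auto simp: A_def le_max_iff_disj)
  have adm: "sharp_admissible \<sigma> q r" using assms(3) by (simp add: \<sigma>_def)
  note defs = \<sigma>_def A_def flow.\<sigma>_def flow.A_def
  show ?thesis
    using \<sigma> adm
  proof (cases rule: admissible_cases)
    case energy
    show ?thesis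
    proof (rule exI[of _ 1], intro allI impI)
      fix a :: 'a and \<phi> \<psi> :: "'a \<Rightarrow> complex" and u :: "real \<Rightarrow> 'a \<Rightarrow> complex"
      assume h: "\<phi> \<in> L2" "fourier_L2 \<phi> \<psi>" "\<forall>t. u t \<in> L2 \<and> fourier_L2 (u t) (\<lambda>\<xi>. cis (- t * (norm \<xi>)\<^sup>2) * \<psi> \<xi>)"
      \<comment> \<open>Conservation of the L2 norm: the multiplier has modulus 1.\<close>
      have nu: "nsq (u t) = nsq \<phi>" for t
      proof -
        have "nsq (\<lambda>\<xi>. cis (- t * (norm \<xi>)\<^sup>2) * \<psi> \<xi>) = nsq \<psi>" by (simp add: nsq_def norm_mult)
        thus ?thesis using fourier_L2_Plancherel[OF h(1,2)] fourier_L2_Plancherel[of "u t"] h(3) by simp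
      qed
      have "lp_norm lborel r (\<lambda>x. ennreal (cmod (u t x))) = lp_norm lborel 2 (\<lambda>x. ennreal (cmod (\<phi> x)))" for t
      proof -
        have "u t \<in> L2" using h(3) by simp
        thus ?thesis unfolding energy(2) by (simp only: lp_norm_L2 h(1) nu)
      qed
      thus "lp_norm lborel q (\<lambda>t. lp_norm lborel r (\<lambda>x. ennreal (cmod (u t x)))) \<le> ennreal 1 * lp_norm lborel 2 (\<lambda>x. ennreal (cmod (\<phi> x)))"
        unfolding energy by (auto simp: lp_norm_def[of _ \<infinity>] intro!: Inf_lower)
    qed
  next
    case (sup q')
    have q0: "q' > 0" using \<sigma> sup by simp
    have C2: "0 \<le> HLS_const \<sigma> * A" using HLS_const_pos[OF \<sigma> sup(3)] A by simp
    show ?thesis unfolding sup(1,2)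
    proof (rule Strichartz_from_discrete[OF q0 assms(1) level_norm_lsc_infinite[OF _ _ _ _ _ q0] _ _ C2])
      fix a :: 'a and \<psi> u and h :: real and K and N :: "int set"
      assume F: "flow a M \<psi> u" and h: "h > 0" "finite N"
      \<comment> \<open>The locale constants depend on the type only, so a single bound serves all
        a, \<psi> and u.\<close>
      have sA: "flow.\<sigma> TYPE('a) = \<sigma>" "flow.A TYPE('a) = A" using F by (simp_all add: defs)
      show "h * (\<Sum>n\<in>N. level_norm \<infinity> K (h powr ((real DIM('a) - 1) / 2)) (u (h * real_of_int n)) powr q')
        \<le> 1 * (HLS_const \<sigma> * A * nsq (unweight M a \<psi>)) powr (q' / 2)"
        using flow.discrete_sup[OF F h, of q' K] \<sigma> sup unfolding sA \<sigma>_def[symmetric] by simp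
    qed auto
  next
    case (nonendpoint q' r')
    let ?\<gamma> = "2 * \<sigma> * (1 / 2 - 1 / r')" and ?m = "min (1 / 2 - 1 / r') (1 / r')"
    have q0: "q' > 0" and r0: "r' > 0" and m0: "?m > 0" using nonendpoint by (simp_all add: field_simps)
    have C2: "0 \<le> HLS_const ?\<gamma> * (A * geo_const ?m)"
      using HLS_const_pos[OF nonendpoint(4,5)] A geo_const_pos[OF m0] by (auto intro!: mult_nonneg_nonneg less_imp_le)
    show ?thesis unfolding nonendpoint(1,2)
    proof (rule Strichartz_from_discrete[OF q0 assms(1) level_norm_lsc_finite[OF _ _ _ _ _ q0 r0] _ _ C2])
      fix a :: 'a and \<psi> u and h :: real and K and N :: "int set"
      assume F: "flow a M \<psi> u" and h: "h > 0" "finite N"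
      have sA: "flow.\<sigma> TYPE('a) = \<sigma>" "flow.A TYPE('a) = A" using F by (simp_all add: defs)
      show "h * (\<Sum>n\<in>N. level_norm (ereal r') K (h powr ((real DIM('a) - 1) / 2)) (u (h * real_of_int n)) powr q')
        \<le> (2 powr r' * geo_const r') powr (q' / r') * (HLS_const ?\<gamma> * (A * geo_const ?m) * nsq (unweight M a \<psi>)) powr (q' / 2)"
        using flow.discrete_nonendpoint[OF F h nonendpoint(3) refl, of q' K] nonendpoint(4,5,6) unfolding sA \<sigma>_def[symmetric] by blast
    qed auto
  next
    case (endpoint r')
    have two: "(0::real) < 2" and r0: "r' > 0" using endpoint by simp_all
    let ?\<delta> = "min ((\<sigma> - 1) / 4) (1 / 8) / \<sigma>"
    define C2 where "C2 = endpoint_const \<sigma> * geo_const ?\<delta> * A"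
    have C2: "C2 \<ge> 0" unfolding C2_def
      using endpoint_const_nonneg[OF endpoint(3)] geo_const_pos[of ?\<delta>] endpoint(3) A
      by (auto intro!: mult_nonneg_nonneg less_imp_le)
    show ?thesis unfolding endpoint(1,2)
    proof (rule Strichartz_from_discrete[OF two assms(1) level_norm_lsc_finite[OF _ _ _ _ _ two r0] _ _ C2])
      fix a :: 'a and \<psi> u and h :: real and K and N :: "int set"
      assume F: "flow a M \<psi> u" and h: "h > 0" "finite N"
      have sA: "flow.\<sigma> TYPE('a) = \<sigma>" "flow.A TYPE('a) = A" using F by (simp_all add: defs)
      \<comment> \<open>For q = 2 the power q / 2 is 1; this casts the linear bound into the common
        form.\<close>
      have "(C2 * nsq (unweight M a \<psi>)) powr (2 / 2) = C2 * nsq (unweight M a \<psi>)" using C2 by simp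
      thus "h * (\<Sum>n\<in>N. level_norm (ereal r') K (h powr ((real DIM('a) - 1) / 2)) (u (h * real_of_int n)) powr 2)
        \<le> (2 powr r' * geo_const r') powr (2 / r') * (C2 * nsq (unweight M a \<psi>)) powr (2 / 2)"
        using flow.discrete_endpoint[OF F h, of r' K] endpoint(3,4) unfolding sA \<sigma>_def[symmetric] C2_def by simp
    qed auto
  qed
qed

end
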